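(* Let $n\in\mathbb{N}\setminus\{0,1\}$, let $K$ be the Markov transition kernel of Kac's random walk on $SO(n)$, let $\mathcal{H}$ be the Haar probability measure on $SO(n)$, let $D$ be the Riemannian distance on $SO(n)$ induced by the Hilbert–Schmidt inner product, and let $$\tau_{D,2}(\varepsilon)=\inf\{t\in\mathbb{N}: W_{D,2}(\mu K^t,\mathcal{H})\le\varepsilon \text{ for all Borel probability measures } \mu \text{ on } SO(n)\}.$$ Then, for $\varepsilon>0$, $$\tau_{D,2}(\varepsilon)\le\left\lceil n^2\ln\left(\frac{\pi\sqrt{n}}{\varepsilon}\right)\right\rceil .$$
   Context: $\mathbb{N}=\{0,1,2,\dots\}$. $M(n,\mathbb{R})$ is the space of real $n\times n$ matrices with the Hilbert–Schmidt inner product $\langle a,b\rangle_{\mathrm{hs}}=\mathrm{Tr}(a^\dagger b)$, where $a^\dagger$ is the transpose. $SO(n)=\{a\in M(n,\mathbb{R}): aa^\dagger=\mathrm{id},\ \det a=1\}$, and $D$ is the Riemannian distance on the submanifold $SO(n)$ for the Riemannian structure obtained by restricting $\langle\cdot,\cdot\rangle_{\mathrm{hs}}$ to its tangent spaces (so $D(a,b)$ is the infimum of the Hilbert–Schmidt lengths of piecewise smooth curves in $SO(n)$ from $a$ to $b$). $\mathcal{H}$ is the unique bi-invariant Borel probability measure on $SO(n)$. For $1\le i<j\le n$ and $\theta\in[0,2\pi]$, $R(i,j,\theta)\in SO(n)$ is the linear map with $R(i,j,\theta)e_i=\cos\theta\, e_i+\sin\theta\, e_j$, $R(i,j,\theta)e_j=\cos\theta\,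 e_j-\sin\theta\, e_i$, and $R(i,j,\theta)e_k=e_k$ for $k\notin\{i,j\}$, where $e_1,\dots,e_n$ is the canonical basis of $\mathbb{R}^n$. The kernel of Kac's random walk is $$K_x(S)=\frac{1}{2\pi\binom{n}{2}}\sum_{1\le i<j\le n}\int_0^{2\pi}\delta_{R(i,j,\theta)x}(S)\,d\theta,\qquad x\in SO(n),\ S\subset SO(n)\text{ Borel}.$$ For a probability measure $\mu$, $\mu K(S)=\int K_x(S)\,d\mu(x)$, $\mu K^0=\mu$ and $\mu K^{t+1}=(\mu K^t)K$. For a metric space $(M,d)$, $p\ge1$ and Borel probability measures $\mu,\nu$ on $M$ with finite $p$th moments, the $L^p$ transportation cost (Wasserstein) distance is $W_{d,p}(\mu,\nu)=\inf\left(\int d(x,y)^p\,d\eta(x,y)\right)^{1/p}$, the infimum being over all couplings $\eta$ of $\mu$ and $\nu$ (probability measures on $M\times M$ with marginals $\mu,\nu$).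
   Formalization: The ceiling on the right is replaced by its maximum with 0, since for large ε (e.g. ε = eπ√n) it is negative while τ ≥ 0, so the literal inequality fails; where the ceiling is nonnegative the statements coincide. *)

theory Defs
  imports "HOL-Probability.Probability"
begin

section \<open>The special orthogonal group and its Riemannian distance\<close>

definition SO :: "(real^'n^'n) set" where
  "SO = {a. rotation_matrix a}"

definition hs_inner :: "real^'n^'n \<Rightarrow> real^'n^'n \<Rightarrow> real" where
  "hs_inner a b = trace (transpose a ** b)"

definition hs_norm :: "real^'n^'n \<Rightarrow> real" where
  "hs_norm a = sqrt (hs_inner a a)"

text \<open>Infinitely differentiable on the closed interval, with one-sided derivatives of all orders
  at the end points; \<open>F k\<close> is the \<open>k\<close>-th derivative.\<close>

definition smooth_on_interval :: "real \<Rightarrow> real \<Rightarrow> (real \<Rightarrow> 'a::real_normed_vector) \<Rightarrow> bool" where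
  "smooth_on_interval a b \<gamma> \<longleftrightarrow>
     (\<exists>F :: nat \<Rightarrow> real \<Rightarrow> 'a.
        (\<forall>t\<in>{a..b}. F 0 t = \<gamma> t) \<and>
        (\<forall>k. \<forall>t\<in>{a..b}. (F k has_vector_derivative F (Suc k) t) (at t within {a..b})))"

text \<open>Each piece is smooth up to its end points. The notion \<^const>\<open>piecewise_C1_differentiable_on\<close> does
  not ensure this: it admits speeds that are not integrable near a break point, for which
  \<^const>\<open>integral\<close> below would return \<open>0\<close>. Continuity on the unit interval follows, because adjacent
  pieces share their end point.\<close>

definition piecewise_smooth_path :: "(real \<Rightarrow> 'a::real_normed_vector) \<Rightarrow> bool" where
  "piecewise_smooth_path \<gamma> \<longleftrightarrow>
     (\<exists>N (s :: nat \<Rightarrow> real). s 0 = 0 \<and> s N = 1 \<and>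
        (\<forall>i<N. s i < s (Suc i) \<and> smooth_on_interval (s i) (s (Suc i)) \<gamma>))"

definition hs_length :: "(real \<Rightarrow> real^'n^'n) \<Rightarrow> real" where
  "hs_length \<gamma> = integral {0..1} (\<lambda>t. hs_norm (vector_derivative \<gamma> (at t)))"

definition SO_dist :: "real^'n^'n \<Rightarrow> real^'n^'n \<Rightarrow> real" where
  "SO_dist a b = Inf {hs_length \<gamma> | \<gamma>. piecewise_smooth_path \<gamma> \<and> path_image \<gamma> \<subseteq> SO \<and>
                                        pathstart \<gamma> = a \<and> pathfinish \<gamma> = b}"


section \<open>Borel probability measures on the special orthogonal group\<close>

definition SO_borel :: "(real^'n^'n) measure" where
  "SO_borel = restrict_space borel SO"

definition SO_prob :: "(real^'n^'n) measure \<Rightarrow> bool" where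
  "SO_prob \<mu> \<longleftrightarrow> prob_space \<mu> \<and> sets \<mu> = sets SO_borel"

definition SO_haar :: "(real^'n^'n) measure \<Rightarrow> bool" where
  "SO_haar \<mu> \<longleftrightarrow> SO_prob \<mu> \<and>
     (\<forall>g\<in>SO. distr \<mu> SO_borel (\<lambda>x. g ** x) = \<mu> \<and> distr \<mu> SO_borel (\<lambda>x. x ** g) = \<mu>)"


section \<open>Wasserstein distance\<close>

definition couplings :: "'a measure \<Rightarrow> 'a measure \<Rightarrow> ('a \<times> 'a) measure set" where
  "couplings \<mu> \<nu> = {\<eta>. prob_space \<eta> \<and> sets \<eta> = sets (\<mu> \<Otimes>\<^sub>M \<nu>) \<and>
                        distr \<eta> \<mu> fst = \<mu> \<and> distr \<eta> \<nu> snd = \<nu>}"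

definition ennreal_powr :: "ennreal \<Rightarrow> real \<Rightarrow> ennreal" where
  "ennreal_powr x r = (if x = \<top> then \<top> else ennreal (enn2real x powr r))"

definition wasserstein :: "('a \<Rightarrow> 'a \<Rightarrow> real) \<Rightarrow> real \<Rightarrow> 'a measure \<Rightarrow> 'a measure \<Rightarrow> ennreal" where
  "wasserstein d p \<mu> \<nu> =
     (INF \<eta>\<in>couplings \<mu> \<nu>. ennreal_powr (\<integral>\<^sup>+(x, y). ennreal (d x y powr p) \<partial>\<eta>) (1 / p))"


section \<open>Kac's random walk\<close>

text \<open>The \<open>k\<close>-th column is the image of the \<open>k\<close>-th canonical basis vector.\<close>

definition rot :: "'n::finite \<Rightarrow> 'n \<Rightarrow> real \<Rightarrow> real^'n^'n" where
  "rot i j \<theta> = transpose (\<chi> k.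
     if k = i then cos \<theta> *\<^sub>R axis i 1 + sin \<theta> *\<^sub>R axis j 1
     else if k = j then cos \<theta> *\<^sub>R axis j 1 - sin \<theta> *\<^sub>R axis i 1
     else axis k 1)"

text \<open>The index type carries a linear order only in order to express the pairs \<open>i < j\<close>.\<close>

definition kac_kernel ::
  "real^'n::{finite,linorder}^'n::{finite,linorder} \<Rightarrow> (real^'n::{finite,linorder}^'n::{finite,linorder}) measure" where
  "kac_kernel x = measure_of SO (sets SO_borel) (\<lambda>S.
     ennreal (1 / (2 * pi * real (CARD('n) choose 2))) *
     (\<Sum>(i, j)\<in>{(i, j). i < j}.
        \<integral>\<^sup>+\<theta>\<in>{0..2 * pi}. emeasure (return SO_borel (rot i j \<theta> ** x)) S \<partial>lborel))"

definition kac_step ::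
  "(real^'n::{finite,linorder}^'n::{finite,linorder}) measure \<Rightarrow> (real^'n::{finite,linorder}^'n::{finite,linorder}) measure" where
  "kac_step \<mu> = \<mu> \<bind> kac_kernel"

text \<open>The infimum of the empty set is \<open>\<infinity>\<close>. The second argument is the Haar measure.\<close>

definition kac_mixing_time ::
  "real \<Rightarrow> (real^'n::{finite,linorder}^'n::{finite,linorder}) measure \<Rightarrow> enat" where
  "kac_mixing_time \<epsilon> \<H> =
     Inf (enat ` {t. \<forall>\<mu>. SO_prob \<mu> \<longrightarrow>
                        wasserstein SO_dist 2 ((kac_step ^^ t) \<mu>) \<H> \<le> ennreal \<epsilon>})"


section \<open>Well-definedness of the walk\<close>

lemma rot_axis:
  assumes "i \<noteq> j"
  shows "rot i j \<theta> *v axis i 1 = cos \<theta> *\<^sub>R axis i 1 + sin \<theta> *\<^sub>R axis j 1"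
    and "rot i j \<theta> *v axis j 1 = cos \<theta> *\<^sub>R axis j 1 - sin \<theta> *\<^sub>R axis i 1"
    and "k \<noteq> i \<Longrightarrow> k \<noteq> j \<Longrightarrow> rot i j \<theta> *v axis k 1 = axis k 1"
  using assms
  by (simp_all add: rot_def matrix_vector_mult_basis column_def transpose_def vec_eq_iff)

lemma rot_mult:
  assumes "i \<noteq> j"
  shows "rot i j \<alpha> ** rot i j \<beta> = rot i j (\<alpha> + \<beta>)"
proof -
  have "(rot i j \<alpha> ** rot i j \<beta>) *v axis k 1 = rot i j (\<alpha> + \<beta>) *v axis k 1" for k
  proof -
    consider "k = i" | "k = j" | "k \<noteq> i" "k \<noteq> j" by blast
    then show ?thesis
    proof cases
      case 1
      then show ?thesis
        by (simp add: matrix_vector_mul_assoc[symmetric] rot_axis[OF assms] matrix_vector_right_distrib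
          matrix_vector_mult_scaleR sin_add cos_add scaleR_add_right scaleR_diff_right scaleR_diff_left scaleR_add_left mult.commute)
    next
      case 2
      then show ?thesis
        by (simp add: matrix_vector_mul_assoc[symmetric] rot_axis[OF assms] matrix_vector_mult_diff_distrib
          matrix_vector_mult_scaleR sin_add cos_add scaleR_diff_right scaleR_add_right scaleR_diff_left scaleR_add_left mult.commute)
    next
      case 3
      then show ?thesis
        by (simp add: matrix_vector_mul_assoc[symmetric] rot_axis[OF assms])
    qed
  qed
  then show ?thesis
    by (simp add: matrix_vector_mult_basis column_def vec_eq_iff)
qed

lemma rot_0: "rot i j 0 = mat 1"
  by (simp add: rot_def vec_eq_iff transpose_def mat_def axis_def)

lemma transpose_rot:
  assumes "i \<noteq> j"
  shows "transpose (rot i j \<theta>) = rot i j (- \<theta>)"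
  using assms by (auto simp: rot_def vec_eq_iff transpose_def axis_def)

lemma rot_in_SO:
  assumes "i \<noteq> j"
  shows "rot i j \<theta> \<in> SO"
proof -
  have orth: "orthogonal_matrix (rot i j \<theta>)" for \<theta>
    using assms by (simp add: orthogonal_matrix_def transpose_rot rot_mult rot_0)
  have "det (rot i j \<theta>) = det (rot i j (\<theta> / 2)) * det (rot i j (\<theta> / 2))"
    using rot_mult[OF assms, of "\<theta> / 2" "\<theta> / 2"] by (simp flip: det_mul)
  also have "\<dots> = 1"
    using det_orthogonal_matrix[OF orth, of "\<theta> / 2"] by auto
  finally show ?thesis
    using orth by (simp add: SO_def rotation_matrix_def)
qed

lemma SO_mult: "a \<in> SO \<Longrightarrow> b \<in> SO \<Longrightarrow> a ** b \<in> SO"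
  by (simp add: SO_def rotation_matrix_def orthogonal_matrix_mul det_mul)

lemma space_SO_borel [simp]: "space SO_borel = SO"
  by (simp add: SO_borel_def space_restrict_space)

lemma sets_kac_kernel [simp]: "sets (kac_kernel x) = sets SO_borel"
  unfolding kac_kernel_def space_SO_borel[symmetric] by (rule sets.sets_measure_of_eq)

lemma measurable_rot_mult:
  fixes i j :: "'n::finite"
  assumes "i \<noteq> j"
  shows "(\<lambda>p. rot i j (snd p) ** fst p) \<in> SO_borel \<Otimes>\<^sub>M lborel \<rightarrow>\<^sub>M SO_borel"
proof -
  have rot: "continuous_on UNIV (\<lambda>\<theta>. rot i j \<theta> $ k $ l)" for k l
    using assms by (cases "l = i"; cases "l = j") (auto simp: rot_def transpose_def intro!: continuous_intros)
  have rot': "continuous_on UNIV (\<lambda>p :: (real^'n^'n) \<times> real. rot i j (snd p) $ k $ l)" for k l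
    using continuous_on_compose2[OF rot continuous_on_snd[OF continuous_on_id]] by auto
  have "continuous_on UNIV (\<lambda>p :: (real^'n^'n) \<times> real. rot i j (snd p) ** fst p)"
    unfolding matrix_matrix_mult_def
    by (intro continuous_on_vec_lambda continuous_on_sum continuous_on_mult rot' continuous_on_component
        continuous_on_fst continuous_on_id)
  then have *: "(\<lambda>p :: (real^'n^'n) \<times> real. rot i j (snd p) ** fst p) \<in> borel \<Otimes>\<^sub>M borel \<rightarrow>\<^sub>M borel"
    unfolding borel_prod by (rule borel_measurable_continuous_onI)
  have "(\<lambda>p. (fst p, snd p)) \<in> SO_borel \<Otimes>\<^sub>M lborel \<rightarrow>\<^sub>M (borel \<Otimes>\<^sub>M borel :: ((real^'n^'n) \<times> real) measure)"
    unfolding SO_borel_def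
    by (intro measurable_Pair measurable_compose[OF measurable_fst] measurable_compose[OF measurable_snd])
       (auto intro: measurable_restrict_space1)
  from measurable_compose[OF this *]
  have "(\<lambda>p :: (real^'n^'n) \<times> real. rot i j (snd p) ** fst p) \<in> SO_borel \<Otimes>\<^sub>M lborel \<rightarrow>\<^sub>M borel"
    by simp
  then show ?thesis
    unfolding SO_borel_def
    using assms
    by (intro measurable_restrict_space2)
       (auto simp: space_pair_measure space_restrict_space SO_mult rot_in_SO)
qed

lemma measurable_emeasure_return_rot:
  assumes "i \<noteq> j" "S \<in> sets SO_borel"
  shows "(\<lambda>p. emeasure (return SO_borel (rot i j (snd p) ** fst p)) S)
           \<in> borel_measurable (SO_borel \<Otimes>\<^sub>M lborel)"
  using measurable_compose[OF measurable_rot_mult[OF assms(1)]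
      borel_measurable_indicator[OF assms(2)]] assms(2)
  by simp

lemma measurable_emeasure_return_rot':
  assumes "i \<noteq> j" "S \<in> sets SO_borel" "x \<in> SO"
  shows "(\<lambda>\<theta>. emeasure (return SO_borel (rot i j \<theta> ** x)) S) \<in> borel_measurable lborel"
proof -
  have "(\<lambda>\<theta>. (x, \<theta>)) \<in> lborel \<rightarrow>\<^sub>M SO_borel \<Otimes>\<^sub>M lborel"
    using assms(3) by (intro measurable_Pair1') simp
  from measurable_compose[OF this measurable_emeasure_return_rot[OF assms(1,2)]]
  show ?thesis by simp
qed

lemma emeasure_kac_kernel:
  fixes x :: "real^'n::{finite,linorder}^'n::{finite,linorder}"
  assumes x: "x \<in> SO" and S: "S \<in> sets SO_borel"
  shows "emeasure (kac_kernel x) S = ennreal (1 / (2 * pi * real (CARD('n) choose 2))) *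
     (\<Sum>(i, j)\<in>{(i, j). i < j}.
        \<integral>\<^sup>+\<theta>\<in>{0..2 * pi}. emeasure (return SO_borel (rot i j \<theta> ** x)) S \<partial>lborel)"
proof (rule emeasure_measure_of[OF kac_kernel_def])
  show "sets SO_borel \<subseteq> Pow (SO :: (real^'n::{finite,linorder}^'n::{finite,linorder}) set)"
    using sets.space_closed[of SO_borel] by simp
  show "S \<in> sets (kac_kernel x)" using S by simp
  let ?c = "ennreal (1 / (2 * pi * real (CARD('n) choose 2)))"
  let ?I = "\<lambda>S ij. \<integral>\<^sup>+\<theta>\<in>{0..2 * pi}. emeasure (return SO_borel (rot (fst ij) (snd ij) \<theta> ** x)) S \<partial>lborel"
  let ?f = "\<lambda>S. ?c * (\<Sum>(i, j)\<in>{(i, j). i < j}.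
        \<integral>\<^sup>+\<theta>\<in>{0..2 * pi}. emeasure (return SO_borel (rot i j \<theta> ** x)) S \<partial>lborel)"
  show "positive (sets (kac_kernel x)) ?f"
    by (auto simp: positive_def intro!: sum.neutral)
  show "countably_additive (sets (kac_kernel x)) ?f"
  proof (rule countably_additiveI)
    fix A :: "nat \<Rightarrow> (real^'n::{finite,linorder}^'n::{finite,linorder}) set"
    assume A: "range A \<subseteq> sets (kac_kernel x)" "disjoint_family A"
    have A': "A k \<in> sets SO_borel" for k using A(1) by auto
    have I: "?I (\<Union>k. A k) ij = (\<Sum>k. ?I (A k) ij)" if "fst ij < snd ij" for ij
    proof -
      have "?I (\<Union>k. A k) ij = (\<integral>\<^sup>+\<theta>. (\<Sum>k. emeasure (return SO_borel (rot (fst ij) (snd ij) \<theta> ** x)) (A k)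
              * indicator {0..2 * pi} \<theta>) \<partial>lborel)"
        using A A' by (intro nn_integral_cong)
          (subst ennreal_suminf_multc, subst suminf_emeasure, auto)
      also have "\<dots> = (\<Sum>k. ?I (A k) ij)"
        using that A' x by (intro nn_integral_suminf borel_measurable_times_ennreal
          measurable_emeasure_return_rot' borel_measurable_indicator) auto
      finally show ?thesis .
    qed
    have f: "?f B = ?c * (\<Sum>ij\<in>{(i, j). i < j}. ?I B ij)" for B
      by (intro arg_cong2[where f = "(*)"] sum.cong) auto
    have "(\<Sum>k. ?f (A k)) = ?c * (\<Sum>k. \<Sum>ij\<in>{(i, j). i < j}. ?I (A k) ij)"
      unfolding f by (rule ennreal_suminf_cmult)
    also have "(\<Sum>k. \<Sum>ij\<in>{(i, j). i < j}. ?I (A k) ij) = (\<Sum>ij\<in>{(i, j). i < j}. \<Sum>k. ?I (A k) ij)"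
      by (intro suminf_sum) auto
    also have "\<dots> = (\<Sum>ij\<in>{(i, j). i < j}. ?I (\<Union>k. A k) ij)"
      by (intro sum.cong refl I[symmetric]) auto
    finally show "(\<Sum>k. ?f (A k)) = ?f (\<Union>k. A k)"
      unfolding f .
  qed
qed

lemma card_less_pairs: "card {(i, j). i < (j :: 'n::{finite,linorder})} = CARD('n) choose 2"
proof -
  have "bij_betw (\<lambda>(i, j). {i, j}) {(i, j). i < (j :: 'n)} {K. K \<subseteq> UNIV \<and> card K = 2}"
    unfolding bij_betw_def
  proof
    show "inj_on (\<lambda>(i, j). {i, j}) {(i, j). i < (j :: 'n)}"
      by (auto simp: inj_on_def doubleton_eq_iff)
    show "(\<lambda>(i, j). {i, j}) ` {(i, j). i < (j :: 'n)} = {K. K \<subseteq> UNIV \<and> card K = 2}"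
    proof safe
      fix K :: "'n set" assume "card K = 2"
      then obtain a b where "K = {a, b}" "a \<noteq> b" by (auto simp: card_2_iff)
      then show "K \<in> (\<lambda>(i, j). {i, j}) ` {(i, j). i < j}"
        proof (cases "a < b")
        case True
        then show ?thesis
          using \<open>K = {a, b}\<close> by (intro image_eqI[where x = "(a, b)"]) auto
      next
        case False
        then show ?thesis
          using \<open>K = {a, b}\<close> \<open>a \<noteq> b\<close> by (intro image_eqI[where x = "(b, a)"]) auto
      qed
    qed auto
  qed
  from bij_betw_same_card[OF this] show ?thesis
    by (simp only: n_subsets[OF finite])
qed

lemma prob_space_kac_kernel:
  fixes x :: "real^'n::{finite,linorder}^'n::{finite,linorder}"
  assumes n: "CARD('n) \<ge> 2" and x: "x \<in> SO"
  shows "prob_space (kac_kernel x)"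
proof (rule prob_spaceI)
  let ?m = "real (CARD('n) choose 2)"
  have sp: "space (kac_kernel x) = SO"
    using sets_eq_imp_space_eq[OF sets_kac_kernel, of x] by simp
  have SO: "SO \<in> sets (SO_borel :: (real^'n::{finite,linorder}^'n::{finite,linorder}) measure)"
    using sets.top[of SO_borel] by simp
  have m: "?m > 0" using n by (simp add: zero_less_binomial)
  have I: "(\<integral>\<^sup>+\<theta>\<in>{0..2 * pi}. emeasure (return SO_borel (rot i j \<theta> ** x)) SO \<partial>lborel) = ennreal (2 * pi)"
    if "i < j" for i j
  proof -
    have "(\<integral>\<^sup>+\<theta>\<in>{0..2 * pi}. emeasure (return SO_borel (rot i j \<theta> ** x)) SO \<partial>lborel)
        = (\<integral>\<^sup>+\<theta>. indicator {0..2 * pi} \<theta> \<partial>lborel)"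
      using that x SO by (intro nn_integral_cong) (simp add: rot_in_SO SO_mult)
    then show ?thesis by simp
  qed
  have "emeasure (kac_kernel x) SO = ennreal (1 / (2 * pi * ?m)) *
      (\<Sum>ij\<in>{(i, j). i < (j :: 'n)}. ennreal (2 * pi))"
    unfolding emeasure_kac_kernel[OF x SO] by (intro arg_cong2[where f = "(*)"] sum.cong) (auto simp: I)
  also have "\<dots> = ennreal (1 / (2 * pi * ?m)) * ennreal (?m * (2 * pi))"
    by (simp add: card_less_pairs ennreal_mult ennreal_of_nat_eq_real_of_nat)
  also have "\<dots> = 1"
    using m by (simp flip: ennreal_mult)
  finally show "emeasure (kac_kernel x) (space (kac_kernel x)) = 1"
    by (simp add: sp)
qed

lemma measurable_kac_kernel:
  assumes n: "CARD('n::{finite,linorder}) \<ge> 2"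
  shows "kac_kernel \<in> SO_borel \<rightarrow>\<^sub>M subprob_algebra (SO_borel :: (real^'n::{finite,linorder}^'n::{finite,linorder}) measure)"
proof (rule measurable_subprob_algebra)
  fix S :: "(real^'n::{finite,linorder}^'n::{finite,linorder}) set" assume S: "S \<in> sets SO_borel"
  have "(\<lambda>x. \<integral>\<^sup>+\<theta>\<in>{0..2 * pi}. emeasure (return SO_borel (rot i j \<theta> ** x)) S \<partial>lborel)
      \<in> borel_measurable SO_borel" if "i < j" for i j
    using measurable_emeasure_return_rot[of i j, OF _ S] that
    by (intro lborel.borel_measurable_nn_integral)
       (auto simp: split_beta intro!: borel_measurable_times_ennreal)
  then have "(\<lambda>x :: real^'n::{finite,linorder}^'n::{finite,linorder}. ennreal (1 / (2 * pi * real (CARD('n) choose 2))) *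
     (\<Sum>(i, j)\<in>{(i, j). i < j}.
        \<integral>\<^sup>+\<theta>\<in>{0..2 * pi}. emeasure (return SO_borel (rot i j \<theta> ** x)) S \<partial>lborel)) \<in> borel_measurable SO_borel"
    by (intro borel_measurable_times_ennreal borel_measurable_sum) auto
  then show "(\<lambda>x. emeasure (kac_kernel x) S) \<in> borel_measurable SO_borel"
    by (rule measurable_cong[THEN iffD1, rotated]) (simp add: emeasure_kac_kernel S)
qed (use n in \<open>auto intro: prob_space_imp_subprob_space prob_space_kac_kernel\<close>)

lemma emeasure_kac_step:
  assumes "CARD('n::{finite,linorder}) \<ge> 2"
    and \<mu>: "SO_prob (\<mu> :: (real^'n::{finite,linorder}^'n::{finite,linorder}) measure)" and "S \<in> sets SO_borel"
  shows "emeasure (kac_step \<mu>) S = (\<integral>\<^sup>+x. emeasure (kac_kernel x) S \<partial>\<mu>)"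
proof -
  have "kac_kernel \<in> \<mu> \<rightarrow>\<^sub>M subprob_algebra (SO_borel :: (real^'n::{finite,linorder}^'n::{finite,linorder}) measure)"
    using measurable_kac_kernel[OF assms(1)] \<mu> measurable_cong_sets[of \<mu> SO_borel]
    by (auto simp: SO_prob_def)
  then show ?thesis
    unfolding kac_step_def using \<mu> assms(3)
    by (intro emeasure_bind) (auto simp: SO_prob_def prob_space.not_empty)
qed

lemma SO_prob_kac_step:
  assumes "CARD('n::{finite,linorder}) \<ge> 2"
    and \<mu>: "SO_prob (\<mu> :: (real^'n::{finite,linorder}^'n::{finite,linorder}) measure)"
  shows "SO_prob (kac_step \<mu>)"
proof -
  have K: "kac_kernel \<in> \<mu> \<rightarrow>\<^sub>M subprob_algebra (SO_borel :: (real^'n::{finite,linorder}^'n::{finite,linorder}) measure)"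
    using measurable_kac_kernel[OF assms(1)] \<mu> measurable_cong_sets[of \<mu> SO_borel]
    by (auto simp: SO_prob_def)
  interpret prob_space \<mu> using \<mu> by (simp add: SO_prob_def)
  have "space \<mu> = SO"
    using \<mu> sets_eq_imp_space_eq[of \<mu> SO_borel] by (simp add: SO_prob_def)
  then have "prob_space (kac_step \<mu>)"
    unfolding kac_step_def
    by (intro prob_space_bind[OF _ K] AE_I2 prob_space_kac_kernel assms(1)) simp
  moreover have "sets (kac_step \<mu>) = sets SO_borel"
    unfolding kac_step_def by (rule sets_bind) (auto simp: not_empty)
  ultimately show ?thesis by (simp add: SO_prob_def)
qed

end

theory Submission
  imports Defs
begin

text \<open>
  Let two copies of the walk use the same pair \<open>i < j\<close> but angles \<open>\<theta>\<close> and \<open>\<theta> + \<phi>\<close>. If \<open>\<gamma>\<close> is a curve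
  from \<open>x\<close> to \<open>y\<close>, then \<open>s \<mapsto> R(i,j,\<phi>(s)) \<gamma>(s)\<close> with \<open>\<phi>(0) = 0\<close> joins \<open>x\<close> to \<open>R(i,j,\<phi>(1)) y\<close>, and a suitable
  choice of \<open>\<phi>'\<close> cancels the \<open>(i,j)\<close> component of the velocity \<open>\<gamma>' \<gamma>\<^sup>T\<close>. Averaging over the \<open>N = n(n-1)/2\<close>
  pairs, Minkowski's inequality yields a mean squared length of at most \<open>1 - 1/N\<close> times the squared
  length of \<open>\<gamma>\<close>. Since \<open>1 - 1/N < exp(-2/n\<^sup>2)\<close>, the shifts can be taken rational and selected measurably
  at the rate \<open>exp(-2/n\<^sup>2)\<close>, so no measurable choice of geodesics is needed. As the law of \<open>\<theta>\<close> is
  invariant under shifts, this gives a coupling of the two laws at every step, starting from the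
  product coupling with the Haar measure. The initial cost is controlled by the diameter: splitting
  \<open>SO(n)\<close> matrices into plane rotations gives \<open>D(x, y) \<le> (\<pi>/2) \<parallel>x - y\<parallel> \<le> \<pi>\<surd>n\<close>.
\<close>

section \<open>Smooth curves\<close>

text \<open>The estimates are made for \<open>chain_dist\<close>, the infimum over chains of arcs
  that are smooth on the whole line. Chains are closed under concatenation, translation and
  twisting, with no gluing at break points; since the cost increases with the distance, the bound
  \<open>SO_dist\<close> \<le> \<open>chain_dist\<close> transfers the result. The factor 1 - 1/N
  has an algebraic source. For a curve in the group A = \<gamma>' \<gamma>^T is antisymmetric, so
  |\<gamma>'|^2 = |A|^2 is twice the sum of the squared entries over the pairs. The best twist for a
  pair removes exactly two times its squared entry, so over all N pairs the squared speeds lose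
  |\<gamma>'|^2 once. A common left rotation is an isometry, so the shared angle \<theta> drops out
  of the cost and only the shift \<phi> remains. Near-minimal chains and rational angles each cost a
  little. Both are paid for by the strict gap between 1/N = 2/(n(n-1)) and 2/n^2. The square root in
  W_2 turns exp(-2t/n^2) into exp(-t/n^2), whence the n^2 of the theorem.\<close>

primrec times_differentiable :: "nat \<Rightarrow> (real \<Rightarrow> 'a::real_normed_vector) \<Rightarrow> bool" where
  "times_differentiable 0 f \<longleftrightarrow> continuous_on UNIV f"
| "times_differentiable (Suc k) f \<longleftrightarrow>
     (\<exists>f'. (\<forall>t. (f has_vector_derivative f' t) (at t)) \<and> times_differentiable k f')"

text \<open>Smoothness is asked on all of the real line, so every derivative is two-sided and
  \<open>vector_derivative\<close> at a point is unambiguous. The one-sided notion of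
  \<open>smooth_on_interval\<close> follows by restriction.\<close>

definition smooth_curve :: "(real \<Rightarrow> 'a::real_normed_vector) \<Rightarrow> bool" where
  "smooth_curve f \<longleftrightarrow> (\<forall>k. times_differentiable k f)"

lemma times_differentiable_SucI:
  "(\<And>t. (f has_vector_derivative f' t) (at t)) \<Longrightarrow> times_differentiable k f' \<Longrightarrow> times_differentiable (Suc k) f"
  unfolding times_differentiable.simps by (intro exI conjI allI)

lemma times_differentiable_SucE:
  assumes "times_differentiable (Suc k) f"
  obtains f' where "\<And>t. (f has_vector_derivative f' t) (at t)" "times_differentiable k f'"
  using assms unfolding times_differentiable.simps by blast

lemma times_differentiable_SucD: "times_differentiable (Suc k) f \<Longrightarrow> times_differentiable k f"
proof (induction k arbitrary: f)
  case 0
  then show ?case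
    by (auto intro!: continuous_at_imp_continuous_on dest: has_vector_derivative_continuous)
next
  case (Suc k)
  then show ?case by (metis times_differentiable.simps(2))
qed

lemma times_differentiable_const: "times_differentiable k (\<lambda>t. c)"
proof (induction k arbitrary: c)
  case (Suc k)
  show ?case by (rule times_differentiable_SucI[OF has_vector_derivative_const Suc.IH])
qed simp

lemma times_differentiable_linear:
  assumes "bounded_linear h"
  shows "times_differentiable k f \<Longrightarrow> times_differentiable k (\<lambda>t. h (f t))"
proof (induction k arbitrary: f)
  case 0
  then show ?case using assms by (auto intro: bounded_linear.continuous_on)
next
  case (Suc k)
  from Suc.prems obtain f' where "\<And>t. (f has_vector_derivative f' t) (at t)" "times_differentiable k f'"
    by (rule times_differentiable_SucE) blast
  then show ?case
    by (rule times_differentiable_SucI[OF bounded_linear.has_vector_derivative[OF assms] Suc.IH])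
qed

lemma times_differentiable_add:
  "times_differentiable k f \<Longrightarrow> times_differentiable k g \<Longrightarrow> times_differentiable k (\<lambda>t. f t + g t)"
proof (induction k arbitrary: f g)
  case (Suc k)
  from Suc.prems obtain f' g' where
    "\<And>t. (f has_vector_derivative f' t) (at t)" "\<And>t. (g has_vector_derivative g' t) (at t)"
    "times_differentiable k f'" "times_differentiable k g'" by (elim times_differentiable_SucE) blast
  then show ?case
    by (rule times_differentiable_SucI[OF has_vector_derivative_add Suc.IH])
qed (auto intro: continuous_intros)

lemma times_differentiable_bilinear:
  assumes h: "bounded_bilinear h"
  shows "times_differentiable k f \<Longrightarrow> times_differentiable k g \<Longrightarrow> times_differentiable k (\<lambda>t. h (f t) (g t))"
proof (induction k arbitrary: f g)
  case 0
  then show ?case by (auto intro: bounded_bilinear.continuous_on[OF h])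
next
  case (Suc k)
  from Suc.prems obtain f' g' where d:
    "\<And>t. (f has_vector_derivative f' t) (at t)" "\<And>t. (g has_vector_derivative g' t) (at t)"
    "times_differentiable k f'" "times_differentiable k g'" by (elim times_differentiable_SucE) blast
  \<comment> \<open>Leibniz' rule pairs each derivative with an undifferentiated factor, so the
    factors themselves are lowered to order \<open>k\<close> before the induction hypothesis
    applies.\<close>
  have "times_differentiable k f" "times_differentiable k g"
    using Suc.prems by (auto intro: times_differentiable_SucD simp del: times_differentiable.simps)
  with d Suc.IH have "times_differentiable k (\<lambda>t. h (f t) (g' t) + h (f' t) (g t))"
    by (intro times_differentiable_add) auto
  then show ?case
  proof (rule times_differentiable_SucI[rotated])
    show "((\<lambda>t. h (f t) (g t)) has_vector_derivative h (f t) (g' t) + h (f' t) (g t)) (at t)" for t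
      using bounded_bilinear.has_vector_derivative[OF h d(1) d(2)] by simp
  qed
qed

lemma times_differentiable_cos_sin:
  "times_differentiable k \<phi> \<Longrightarrow>
     times_differentiable k (\<lambda>t. cos (\<phi> t)) \<and> times_differentiable k (\<lambda>t. sin (\<phi> t) :: real)"
proof (induction k)
  case 0
  then show ?case by (auto intro: continuous_intros)
next
  case (Suc k)
  from Suc.prems obtain \<phi>' where
    d: "\<And>t. (\<phi> has_vector_derivative \<phi>' t) (at t)" "times_differentiable k \<phi>'"
    by (rule times_differentiable_SucE) blast
  have IH: "times_differentiable k (\<lambda>t. cos (\<phi> t))" "times_differentiable k (\<lambda>t. sin (\<phi> t))"
    using Suc by (auto intro: times_differentiable_SucD simp del: times_differentiable.simps)
  have "((\<lambda>t. cos (\<phi> t)) has_vector_derivative - 1 *\<^sub>R (\<phi>' t * sin (\<phi> t))) (at t)"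
    "((\<lambda>t. sin (\<phi> t)) has_vector_derivative \<phi>' t * cos (\<phi> t)) (at t)" for t
    using d(1)[of t] unfolding has_real_derivative_iff_has_vector_derivative[symmetric]
    by (auto intro!: derivative_eq_intros)
  moreover have "times_differentiable k (\<lambda>t. - 1 *\<^sub>R (\<phi>' t * sin (\<phi> t)))"
    by (rule times_differentiable_linear[OF bounded_linear_scaleR_right,
          OF times_differentiable_bilinear[OF bounded_bilinear_mult d(2) IH(2)]])
  moreover have "times_differentiable k (\<lambda>t. \<phi>' t * cos (\<phi> t))"
    by (rule times_differentiable_bilinear[OF bounded_bilinear_mult d(2) IH(1)])
  ultimately show ?case
    by (intro conjI times_differentiable_SucI[of "\<lambda>t. cos (\<phi> t)" "\<lambda>t. - 1 *\<^sub>R (\<phi>' t * sin (\<phi> t))"]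
        times_differentiable_SucI[of "\<lambda>t. sin (\<phi> t)" "\<lambda>t. \<phi>' t * cos (\<phi> t)"])
qed

lemma smooth_curve_const: "smooth_curve (\<lambda>t. c)"
  by (simp add: smooth_curve_def times_differentiable_const)

lemma smooth_curve_linear: "bounded_linear h \<Longrightarrow> smooth_curve f \<Longrightarrow> smooth_curve (\<lambda>t. h (f t))"
  by (simp add: smooth_curve_def times_differentiable_linear)

lemma smooth_curve_add: "smooth_curve f \<Longrightarrow> smooth_curve g \<Longrightarrow> smooth_curve (\<lambda>t. f t + g t)"
  by (simp add: smooth_curve_def times_differentiable_add)

lemma smooth_curve_bilinear:
  "bounded_bilinear h \<Longrightarrow> smooth_curve f \<Longrightarrow> smooth_curve g \<Longrightarrow> smooth_curve (\<lambda>t. h (f t) (g t))"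
  by (simp add: smooth_curve_def times_differentiable_bilinear)

lemma smooth_curve_cos: "smooth_curve \<phi> \<Longrightarrow> smooth_curve (\<lambda>t. cos (\<phi> t) :: real)"
  and smooth_curve_sin: "smooth_curve \<phi> \<Longrightarrow> smooth_curve (\<lambda>t. sin (\<phi> t) :: real)"
  by (simp_all add: smooth_curve_def times_differentiable_cos_sin)

lemma smooth_curve_continuous: "smooth_curve f \<Longrightarrow> continuous_on UNIV f"
  using times_differentiable.simps(1) unfolding smooth_curve_def by blast

text \<open>Each order of differentiability comes with its own witness for the derivative;
  uniqueness of derivatives identifies them all.\<close>

lemma smooth_curve_derivative:
  assumes "smooth_curve f"
  obtains f' where "\<And>t. (f has_vector_derivative f' t) (at t)" "smooth_curve f'"
proof -
  have "times_differentiable (Suc 0) f" using assms by (simp only: smooth_curve_def)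
  then obtain f' where f': "\<And>t. (f has_vector_derivative f' t) (at t)"
    by (rule times_differentiable_SucE) blast
  have "times_differentiable k f'" for k
  proof -
    have "times_differentiable (Suc k) f" using assms by (simp only: smooth_curve_def)
    then obtain g where g: "\<And>t. (f has_vector_derivative g t) (at t)" "times_differentiable k g"
      by (rule times_differentiable_SucE) blast
    have "g = f'" using f' g(1) by (auto intro: vector_derivative_unique_at)
    with g show ?thesis by simp
  qed
  then show ?thesis using f' by (intro that[of f']) (auto simp: smooth_curve_def)
qed

lemma smooth_curveI:
  assumes "\<And>t. (f has_vector_derivative f' t) (at t)" "smooth_curve f'"
  shows "smooth_curve f"
  unfolding smooth_curve_def
proof
  fix k
  have "times_differentiable (Suc k) f" 
    by (rule times_differentiable_SucI[OF assms(1)]) (use assms(2) in \<open>simp add: smooth_curve_def\<close>)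
  then show "times_differentiable k f" by (rule times_differentiable_SucD)
qed

text \<open>Recovers a twist angle from its prescribed rate. Vanishing at 0 makes the twisted curve
  keep its starting point.\<close>

lemma smooth_curve_antiderivative:
  assumes "smooth_curve (f :: real \<Rightarrow> real)"
  obtains F where "\<And>t. (F has_vector_derivative f t) (at t)" "F 0 = 0" "smooth_curve F"
proof -
  have "\<exists>F. \<forall>x::real. - \<infinity> < x \<longrightarrow> x < \<infinity> \<longrightarrow> (F has_vector_derivative f x) (at x)"
    using smooth_curve_continuous[OF assms]
    by (intro einterval_antiderivative) (auto simp: continuous_on_eq_continuous_at)
  then obtain F where F: "\<And>t. (F has_vector_derivative f t) (at t)" by auto
  then have "((\<lambda>t. F t - F 0) has_vector_derivative f t) (at t)" for t
    using has_vector_derivative_diff[OF F[of t] has_vector_derivative_const[of "F 0"]] by simp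
  with assms show ?thesis
    by (intro that[of "\<lambda>t. F t - F 0"] smooth_curveI[of "\<lambda>t. F t - F 0" f]) auto
qed

text \<open>Supplies the sequence of derivatives that \<open>smooth_on_interval\<close> demands. A
  choice operator for derivatives makes this sequence an iterate; the chain rule for the inner
  affine map contributes one factor \<open>p\<close> per order.\<close>

lemma smooth_curve_affine:
  assumes "smooth_curve f"
  obtains G where "\<And>t. G 0 t = f (p * t + q)"
    "\<And>(k::nat) t. (G k has_vector_derivative G (Suc k) t) (at t)"
proof -
  define D where "D f = (SOME f'. (\<forall>t. (f has_vector_derivative f' t) (at t)) \<and> smooth_curve f')"
    for f :: "real \<Rightarrow> 'a"
  have D: "(\<forall>t. (f has_vector_derivative D f t) (at t)) \<and> smooth_curve (D f)" if "smooth_curve f" for f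
  proof -
    have "\<exists>f'. (\<forall>t. (f has_vector_derivative f' t) (at t)) \<and> smooth_curve f'"
    proof (rule smooth_curve_derivative[OF that])
      fix f' assume "\<And>t. (f has_vector_derivative f' t) (at t)" "smooth_curve f'"
      then show ?thesis by (intro exI[of _ f'] conjI allI)
    qed
    then show ?thesis unfolding D_def by (rule someI_ex)
  qed
  have s: "smooth_curve ((D ^^ k) f)" for k
  proof (induction k)
    case (Suc k)
    then show ?case using D[OF Suc] by simp
  qed (simp add: assms)
  have 1: "((\<lambda>t. (D ^^ k) f (p * t + q)) has_vector_derivative p *\<^sub>R (D ^^ Suc k) f (p * t + q)) (at t)" for k t
  proof -
    have "((D ^^ k) f has_vector_derivative (D ^^ Suc k) f (p * t + q)) (at (p * t + q))"
      using D[OF s[of k]] by simp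
    moreover have "((\<lambda>t. p * t + q) has_vector_derivative p) (at t)"
      unfolding has_real_derivative_iff_has_vector_derivative[symmetric]
      by (auto intro!: derivative_eq_intros)
    ultimately show ?thesis
      by (rule vector_diff_chain_at[unfolded o_def, rotated])
  qed
  define G where "G k t = p ^ k *\<^sub>R (D ^^ k) f (p * t + q)" for k t
  show ?thesis
  proof (rule that)
    show "(G k has_vector_derivative G (Suc k) t) (at t)" for k t
      using bounded_linear.has_vector_derivative[OF bounded_linear_scaleR_right[of "p ^ k"] 1[of k t]]
      unfolding G_def by (simp add: mult.commute del: funpow.simps)
    show "G 0 t = f (p * t + q)" for t by (simp add: G_def)
  qed
qed

section \<open>Rotations of a plane\<close>

definition outer :: "real^'n \<Rightarrow> real^'m \<Rightarrow> real^'m^'n" where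
  "outer u v = (\<chi> i j. u $ i * v $ j)"

definition skew :: "real^'n \<Rightarrow> real^'n \<Rightarrow> real^'n^'n" where
  "skew u v = outer v u - outer u v"

definition plane_rot :: "real^'n \<Rightarrow> real^'n \<Rightarrow> real \<Rightarrow> real^'n^'n" where
  "plane_rot u v \<theta> = mat 1 + (cos \<theta> - 1) *\<^sub>R (outer u u + outer v v) + sin \<theta> *\<^sub>R skew u v"

definition orthonormal_pair :: "real^'n \<Rightarrow> real^'n \<Rightarrow> bool" where
  "orthonormal_pair u v \<longleftrightarrow> u \<bullet> u = 1 \<and> v \<bullet> v = 1 \<and> u \<bullet> v = 0"

lemma orthonormal_pairD:
  assumes "orthonormal_pair u v"
  shows "u \<bullet> u = 1" "v \<bullet> v = 1" "u \<bullet> v = 0" "v \<bullet> u = 0"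
  using assms by (auto simp: orthonormal_pair_def inner_commute)

lemma hs_inner_eq_inner: "hs_inner a b = a \<bullet> b"
proof -
  have "hs_inner a b = (\<Sum>i\<in>UNIV. \<Sum>k\<in>UNIV. a $ k $ i * b $ k $ i)"
    by (simp add: hs_inner_def trace_def matrix_matrix_mult_def transpose_def)
  also have "\<dots> = a \<bullet> b"
    by (subst sum.swap) (simp add: inner_vec_def)
  finally show ?thesis .
qed

lemma hs_norm_eq_norm: "hs_norm a = norm a"
  by (simp add: hs_norm_def hs_inner_eq_inner norm_eq_sqrt_inner)

lemma inner_matrix_trace: "a \<bullet> b = trace (transpose a ** b)" for a b :: "real^'n^'n"
  by (metis hs_inner_eq_inner hs_inner_def)

lemma inner_orthogonal_mult_left:
  fixes a b :: "real^'n^'n"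
  assumes "orthogonal_matrix q"
  shows "(q ** a) \<bullet> (q ** b) = a \<bullet> b"
proof -
  have "transpose (q ** a) ** (q ** b) = transpose a ** (transpose q ** q) ** b"
    by (simp add: matrix_transpose_mul matrix_mul_assoc)
  then show ?thesis using assms by (simp add: inner_matrix_trace orthogonal_matrix)
qed

lemma inner_orthogonal_mult_right:
  fixes a b :: "real^'n^'n"
  assumes "orthogonal_matrix q"
  shows "(a ** q) \<bullet> (b ** q) = a \<bullet> b"
proof -
  have "trace (transpose (a ** q) ** (b ** q)) = trace ((transpose q ** (transpose a ** b)) ** q)"
    by (simp add: matrix_transpose_mul matrix_mul_assoc)
  also have "\<dots> = trace ((q ** transpose q) ** (transpose a ** b))"
    by (subst trace_mul_sym) (simp add: matrix_mul_assoc)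
  finally show ?thesis using assms by (simp add: inner_matrix_trace orthogonal_matrix_def)
qed

lemma norm_orthogonal_mult_left:
  "orthogonal_matrix q \<Longrightarrow> norm (q ** a) = norm a" for a :: "real^'n^'n"
  by (simp add: norm_eq_sqrt_inner inner_orthogonal_mult_left)

lemma norm_orthogonal_mult_right:
  "orthogonal_matrix q \<Longrightarrow> norm (a ** q) = norm a" for a :: "real^'n^'n"
  by (simp add: norm_eq_sqrt_inner inner_orthogonal_mult_right)

lemma bounded_bilinear_matrix_mult: "bounded_bilinear (\<lambda>(a::real^'n^'n) (b::real^'n^'n). a ** b)"
  unfolding bilinear_conv_bounded_bilinear[symmetric] bilinear_def
  by (auto intro!: linearI simp: matrix_add_ldistrib matrix_matrix_mult_def vec_eq_iff sum.distrib
      algebra_simps sum_distrib_left)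

lemma outer_vec: "outer u v *v x = (v \<bullet> x) *\<^sub>R u"
  by (simp add: outer_def matrix_vector_mult_def vec_eq_iff inner_vec_def sum_distrib_left ac_simps)

lemma skew_vec: "skew u v *v x = (u \<bullet> x) *\<^sub>R v - (v \<bullet> x) *\<^sub>R u"
  by (simp add: skew_def matrix_vector_mult_diff_rdistrib outer_vec)

lemma transpose_outer: "transpose (outer u v) = outer v u"
  by (simp add: outer_def transpose_def vec_eq_iff)

lemma transpose_add: "transpose (a + b) = transpose a + transpose b"
  and transpose_diff: "transpose (a - b) = transpose a - transpose b" for a b :: "real^'n^'m"
  by (simp_all add: transpose_def vec_eq_iff)

lemma inner_outer: "outer u v \<bullet> b = u \<bullet> (b *v v)"
  by (simp add: outer_def inner_vec_def matrix_vector_mult_def sum_distrib_left ac_simps)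

lemma inner_skew: "skew u v \<bullet> b = v \<bullet> (b *v u) - u \<bullet> (b *v v)"
  by (simp add: skew_def inner_diff_left inner_outer)

lemma plane_rot_vec:
  "plane_rot u v \<theta> *v x =
     x + ((cos \<theta> - 1) * (u \<bullet> x) - sin \<theta> * (v \<bullet> x)) *\<^sub>R u + ((cos \<theta> - 1) * (v \<bullet> x) + sin \<theta> * (u \<bullet> x)) *\<^sub>R v"
  by (simp add: plane_rot_def matrix_vector_mult_add_rdistrib scaleR_matrix_vector_assoc[symmetric]
      outer_vec skew_vec algebra_simps)

lemma plane_rot_0: "plane_rot u v 0 = mat 1"
  by (simp add: plane_rot_def)

lemma plane_rot_mult:
  assumes "orthonormal_pair u v"
  shows "plane_rot u v \<alpha> ** plane_rot u v \<beta> = plane_rot u v (\<alpha> + \<beta>)"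
proof -
  have "plane_rot u v \<alpha> *v (plane_rot u v \<beta> *v x) = plane_rot u v (\<alpha> + \<beta>) *v x" for x
    unfolding plane_rot_vec
    by (simp add: inner_add_right orthonormal_pairD[OF assms] cos_add sin_add algebra_simps)
  then show ?thesis by (simp add: matrix_eq matrix_vector_mul_assoc)
qed

lemma transpose_plane_rot: "transpose (plane_rot u v \<theta>) = plane_rot u v (- \<theta>)"
  by (simp add: plane_rot_def skew_def transpose_add transpose_diff transpose_scalar transpose_outer
      transpose_mat scaleR_diff_right flip: scalar_matrix_assoc)

lemma orthogonal_plane_rot: "orthonormal_pair u v \<Longrightarrow> orthogonal_matrix (plane_rot u v \<theta>)"
  by (simp add: orthogonal_matrix transpose_plane_rot plane_rot_mult plane_rot_0)

text \<open>The determinant is the square of that of the half-angle rotation, which is 1 or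
  -1.\<close>

lemma plane_rot_in_SO:
  assumes "orthonormal_pair u v"
  shows "plane_rot u v \<theta> \<in> SO"
proof -
  have "det (plane_rot u v \<theta>) = det (plane_rot u v (\<theta> / 2)) * det (plane_rot u v (\<theta> / 2))"
    using plane_rot_mult[OF assms, of "\<theta> / 2" "\<theta> / 2"] by (simp flip: det_mul)
  also have "\<dots> = 1"
    using det_orthogonal_matrix[OF orthogonal_plane_rot[OF assms], of "\<theta> / 2"] by auto
  finally show ?thesis
    using orthogonal_plane_rot[OF assms] by (simp add: SO_def rotation_matrix_def)
qed

lemma orthonormal_pair_axis: "i \<noteq> j \<Longrightarrow> orthonormal_pair (axis i 1) (axis j 1)"
  by (simp add: orthonormal_pair_def inner_axis_axis)

lemma rot_eq_plane_rot:
  assumes "i \<noteq> j"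
  shows "rot i j \<theta> = plane_rot (axis i 1) (axis j 1) \<theta>"
proof -
  have "rot i j \<theta> $ k $ l = plane_rot (axis i 1) (axis j 1) \<theta> $ k $ l" for k l
    using assms by (auto simp: rot_def plane_rot_def skew_def outer_def transpose_def axis_def mat_def)
  then show ?thesis by (simp add: vec_eq_iff)
qed

text \<open>The generator commutes with the rotation. It is written on the right so that the
  rotation can later be pulled out on the left, where it does not affect the norm.\<close>

lemma has_vector_derivative_plane_rot:
  assumes "orthonormal_pair u v" "(\<phi> has_vector_derivative \<phi>') (at t)"
  shows "((\<lambda>t. plane_rot u v (\<phi> t)) has_vector_derivative plane_rot u v (\<phi> t) ** (\<phi>' *\<^sub>R skew u v)) (at t)"
proof -
  have "(\<phi> has_real_derivative \<phi>') (at t)"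
    using assms(2) by (simp add: has_real_derivative_iff_has_vector_derivative)
  then have d: "((\<lambda>t. cos (\<phi> t) - 1) has_vector_derivative - sin (\<phi> t) * \<phi>') (at t)"
    "((\<lambda>t. sin (\<phi> t)) has_vector_derivative cos (\<phi> t) * \<phi>') (at t)"
    unfolding has_real_derivative_iff_has_vector_derivative[symmetric]
    by (auto intro!: derivative_eq_intros)
  have "((\<lambda>t. plane_rot u v (\<phi> t)) has_vector_derivative
      (- sin (\<phi> t) * \<phi>') *\<^sub>R (outer u u + outer v v) + (cos (\<phi> t) * \<phi>') *\<^sub>R skew u v) (at t)"
    unfolding plane_rot_def
    using has_vector_derivative_add[OF has_vector_derivative_add[OF has_vector_derivative_const[of "mat 1"]
        bounded_linear.has_vector_derivative[OF bounded_linear_scaleR_left d(1)]]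
        bounded_linear.has_vector_derivative[OF bounded_linear_scaleR_left d(2)]]
    by simp
  moreover have "(- sin (\<phi> t) * \<phi>') *\<^sub>R (outer u u + outer v v) + (cos (\<phi> t) * \<phi>') *\<^sub>R skew u v
      = plane_rot u v (\<phi> t) ** (\<phi>' *\<^sub>R skew u v)"
  proof -
    have "plane_rot u v (\<phi> t) *v ((\<phi>' *\<^sub>R skew u v) *v x) =
        ((- sin (\<phi> t) * \<phi>') *\<^sub>R (outer u u + outer v v) + (cos (\<phi> t) * \<phi>') *\<^sub>R skew u v) *v x" for x
      unfolding plane_rot_vec
      by (simp add: scaleR_matrix_vector_assoc[symmetric] matrix_vector_mult_add_rdistrib outer_vec skew_vec
          inner_diff_right orthonormal_pairD[OF assms(1)] algebra_simps)
    then show ?thesis by (simp add: matrix_eq matrix_vector_mul_assoc)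
  qed
  ultimately show ?thesis by simp
qed

text \<open>The speed of a twisted curve as a quadratic in the twist rate \<open>c\<close>; its
  leading coefficient is the squared norm of \<open>skew u v\<close>. With \<omega> the inner
  product in the linear term, the minimum is at c = -\<omega>/2 and lowers the squared speed by
  \<omega>^2/2.\<close>

lemma norm_plane_rot_derivative:
  assumes "orthonormal_pair u v" "orthogonal_matrix a"
  shows "(norm (plane_rot u v \<theta> ** b + plane_rot u v \<theta> ** (c *\<^sub>R skew u v) ** a))\<^sup>2
       = (norm b)\<^sup>2 + 2 * c * ((skew u v ** a) \<bullet> b) + 2 * c\<^sup>2"
proof -
  have 1: "plane_rot u v \<theta> ** b + plane_rot u v \<theta> ** (c *\<^sub>R skew u v) ** a
      = plane_rot u v \<theta> ** (b + c *\<^sub>R (skew u v ** a))"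
    by (simp add: matrix_add_ldistrib matrix_mul_assoc
        bounded_bilinear.scaleR_left[OF bounded_bilinear_matrix_mult]
        bounded_bilinear.scaleR_right[OF bounded_bilinear_matrix_mult])
  have "(skew u v ** a) \<bullet> (skew u v ** a) = skew u v \<bullet> skew u v"
    using assms(2) by (rule inner_orthogonal_mult_right)
  also have "\<dots> = 2"
    unfolding inner_skew skew_vec by (simp add: inner_diff_right orthonormal_pairD[OF assms(1)])
  finally show ?thesis
    unfolding 1 norm_orthogonal_mult_left[OF orthogonal_plane_rot[OF assms(1)]] power2_norm_eq_inner
    by (simp add: inner_add_left inner_add_right inner_commute power2_eq_square algebra_simps)
qed

section \<open>Short curves from the identity to a rotation\<close>

text \<open>Jordan's inequality: a concave function lies above its chord. It converts chords into
  arcs and is the source of the factor \<pi>/2.\<close>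

lemma two_over_pi_le_sin:
  assumes "0 \<le> x" "x \<le> pi / 2"
  shows "2 / pi * x \<le> sin x"
proof -
  have "concave_on {0..pi} sin"
    by (rule f''_le0_imp_concave[where f' = cos and f'' = "\<lambda>x. - sin x"])
       (auto intro!: derivative_eq_intros sin_ge_zero)
  from concave_onD[OF this, of "2 / pi * x" 0 "pi / 2"] show ?thesis
    using assms by (simp add: field_simps)
qed

text \<open>Conjugation by an orthogonal matrix that carries a coordinate axis to \<open>u\<close>
  makes the reflection diagonal with a single entry -1. It excludes rotations that negate just one
  direction.\<close>

lemma det_reflection:
  fixes u :: "real^'n"
  assumes "norm u = 1"
  shows "det (mat 1 - 2 *\<^sub>R outer u u) = - 1"
proof -
  fix k :: 'n
  obtain q where q: "orthogonal_matrix q" "q *v axis k 1 = u"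
    using orthogonal_matrix_exists_basis[OF assms] by metis
  let ?m = "mat 1 - 2 *\<^sub>R outer u u"
  have qu: "transpose q *v u = axis k 1"
    using q by (metis matrix_vector_mul_assoc matrix_vector_mul_lid orthogonal_matrix)
  have "(transpose q ** ?m ** q) *v x = (mat 1 - 2 *\<^sub>R outer (axis k 1) (axis k 1)) *v x" for x
  proof -
    have "u \<bullet> (q *v x) = axis k 1 \<bullet> x"
      using qu by (metis dot_lmul_matrix transpose_matrix_vector transpose_transpose)
    moreover have "transpose q *v (q *v x) = x"
      using q(1) by (simp add: matrix_vector_mul_assoc orthogonal_matrix del: transpose_matrix_vector)
    ultimately show ?thesis
      by (simp add: matrix_vector_mul_assoc[symmetric] matrix_vector_mult_diff_rdistrib
          scaleR_matrix_vector_assoc[symmetric] outer_vec matrix_vector_mult_diff_distrib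
          matrix_vector_mult_scaleR qu del: transpose_matrix_vector)
  qed
  then have "transpose q ** ?m ** q = mat 1 - 2 *\<^sub>R outer (axis k 1) (axis k 1)"
    by (simp add: matrix_eq)
  moreover have "det (mat 1 - 2 *\<^sub>R outer (axis k 1) (axis k 1) :: real^'n^'n)
      = (\<Prod>i\<in>UNIV. if i = k then - 1 else 1)"
  proof (subst det_diagonal)
    show "(\<Prod>i\<in>UNIV. (mat 1 - 2 *\<^sub>R outer (axis k 1) (axis k 1) :: real^'n^'n) $ i $ i)
        = (\<Prod>i\<in>UNIV. if i = k then - 1 else 1)"
      by (rule prod.cong) (auto simp: mat_def outer_def axis_def)
  qed (auto simp: mat_def outer_def axis_def)
  moreover have "(\<Prod>i\<in>UNIV. if i = k then - 1 else 1 :: real) = - 1" by simp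
  moreover have "det (transpose q ** ?m ** q) = (det q * det q) * det ?m"
    by (simp add: det_mul)
  moreover have "det q * det q = 1"
    using det_orthogonal_matrix[OF q(1)] by auto
  ultimately show ?thesis by simp
qed

declare transpose_matrix_vector [simp del]

lemma inner_matrix_vec_transpose: "x \<bullet> (a *v y) = (transpose a *v x) \<bullet> y" for a :: "real^'n^'m"
  by (metis dot_lmul_matrix transpose_matrix_vector)

lemma transpose_fixed:
  "orthogonal_matrix g \<Longrightarrow> g *v x = x \<Longrightarrow> transpose g *v x = x" for g :: "real^'n^'n"
  by (metis matrix_vector_mul_assoc matrix_vector_mul_lid orthogonal_matrix)

lemma SO_D: "g \<in> SO \<Longrightarrow> orthogonal_matrix g" "g \<in> SO \<Longrightarrow> det g = 1"
  by (simp_all add: SO_def rotation_matrix_def)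

text \<open>A maximiser of \<open>x \<bullet> g x\<close> on the unit sphere of the orthogonal complement of the fixed space is an
  eigenvector of \<open>g + g\<^sup>T\<close>, so it spans an invariant subspace of dimension at most two together with
  its image.\<close>

lemma SO_invariant_plane:
  fixes g :: "real^'n^'n"
  assumes g: "g \<in> SO" and "g \<noteq> mat 1"
  obtains u v \<theta> where "orthonormal_pair u v" "0 \<le> \<theta>" "\<theta> \<le> pi"
    "g *v u = cos \<theta> *\<^sub>R u + sin \<theta> *\<^sub>R v" "g *v v = cos \<theta> *\<^sub>R v - sin \<theta> *\<^sub>R u"
    "\<And>x. g *v x = x \<Longrightarrow> u \<bullet> x = 0 \<and> v \<bullet> x = 0"
proof -
  note og = SO_D(1)[OF g]
  let ?T = "transpose g"
  have Tg: "?T *v (g *v x) = x" and gT: "g *v (?T *v x) = x" for x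
    using og by (simp_all add: matrix_vector_mul_assoc orthogonal_matrix_def del: transpose_matrix_vector)
  have ig: "x \<bullet> (g *v y) = (?T *v x) \<bullet> y" for x y by (rule inner_matrix_vec_transpose)
  have gg: "(g *v x) \<bullet> (g *v y) = x \<bullet> y" for x y by (simp only: ig Tg)
  define V where "V = {y. \<forall>x \<in> {x. g *v x = x}. orthogonal x y}"
  have V: "subspace V" unfolding V_def by (rule subspace_orthogonal_to_vectors)
  have VI: "y \<in> V" if "\<And>x. g *v x = x \<Longrightarrow> x \<bullet> y = 0" for y
    using that by (simp add: V_def orthogonal_def)
  have VD: "x \<bullet> y = 0" if "y \<in> V" "g *v x = x" for x y
    using that by (simp add: V_def orthogonal_def)
  have Vd: "x - g *v x \<in> V" for x
    by (rule VI) (simp add: inner_diff_right ig transpose_fixed[OF og])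
  have Vg: "g *v y \<in> V" if "y \<in> V" for y
    by (rule VI) (simp add: ig transpose_fixed[OF og] VD that)
  have VT: "?T *v y \<in> V" if "y \<in> V" for y
  proof (rule VI)
    fix x assume "g *v x = x"
    then show "x \<bullet> (?T *v y) = 0"
      by (metis VD gg gT that)
  qed
  have "\<exists>x. x - g *v x \<noteq> 0"
    using \<open>g \<noteq> mat 1\<close> by (metis eq_iff_diff_eq_0 matrix_eq matrix_vector_mul_lid)
  then obtain y where y: "y \<in> V" "y \<noteq> 0" using Vd by blast
  have "compact (V \<inter> sphere 0 1)"
    using closed_subspace[OF V] by (simp add: closed_Int_compact)
  moreover have "(1 / norm y) *\<^sub>R y \<in> V \<inter> sphere 0 1"
    using y V by (auto simp: subspace_scale)
  moreover have "continuous_on (V \<inter> sphere 0 1) (\<lambda>x. x \<bullet> (g *v x))"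
    by (intro continuous_intros linear_continuous_on matrix_vector_mul_bounded_linear)
  ultimately have "\<exists>x\<in>V \<inter> sphere 0 1. \<forall>z\<in>V \<inter> sphere 0 1. z \<bullet> (g *v z) \<le> x \<bullet> (g *v x)"
    by (intro continuous_attains_sup) blast+
  then obtain u where u: "u \<in> V" "norm u = 1"
    and max: "\<And>x. x \<in> V \<Longrightarrow> norm x = 1 \<Longrightarrow> x \<bullet> (g *v x) \<le> u \<bullet> (g *v u)"
    by auto
  define l where "l = u \<bullet> (g *v u)"
  have uu: "u \<bullet> u = 1" using u(2) by (simp add: power2_norm_eq_inner[symmetric])
  have max': "x \<bullet> (g *v x) \<le> l * (x \<bullet> x)" if "x \<in> V" for x
  proof (cases "x = 0")
    case False
    have "((1 / norm x) *\<^sub>R x) \<bullet> (g *v ((1 / norm x) *\<^sub>R x)) \<le> l"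
      unfolding l_def using False that V by (intro max) (auto simp: subspace_scale)
    then have "(x \<bullet> (g *v x)) / (norm x)\<^sup>2 \<le> l"
      by (simp add: matrix_vector_mult_scaleR power2_eq_square)
    then show ?thesis using False by (simp add: field_simps power2_norm_eq_inner[symmetric])
  qed simp
  \<comment> \<open>The residual of the eigenvalue equation of g + g^T at \<open>u\<close>. It lies
    in \<open>V\<close> and is orthogonal to \<open>u\<close>, so it is an admissible direction for
    a first variation.\<close>
  define w where "w = g *v u + ?T *v u - (2 * l) *\<^sub>R u"
  have wV: "w \<in> V" unfolding w_def using V u(1) by (auto intro!: subspace_diff subspace_add subspace_scale Vg VT)
  have lT: "u \<bullet> (?T *v u) = l" by (simp add: l_def ig inner_commute)
  have wu: "u \<bullet> w = 0"
    by (simp add: w_def inner_diff_right inner_add_right uu lT l_def[symmetric])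
  \<comment> \<open>Comparing u + t w with the maximiser: the term linear in \<open>t\<close> is
    |w|^2, and no quadratic term can dominate it for small positive \<open>t\<close> unless w =
    0.\<close>
  have "t * (w \<bullet> w) \<le> t\<^sup>2 * (l * (w \<bullet> w) - w \<bullet> (g *v w))" for t
  proof -
    have "u + t *\<^sub>R w \<in> V" using V u(1) wV by (auto intro!: subspace_add subspace_scale)
    from max'[OF this] have "l + t * (u \<bullet> (g *v w) + w \<bullet> (g *v u)) + t\<^sup>2 * (w \<bullet> (g *v w)) \<le> l * (1 + t\<^sup>2 * (w \<bullet> w))"
      by (simp add: matrix_vector_right_distrib matrix_vector_mult_scaleR inner_add_left inner_add_right
          uu wu inner_commute[of w u] l_def[symmetric] power2_eq_square algebra_simps)
    moreover have "u \<bullet> (g *v w) + w \<bullet> (g *v u) = w \<bullet> w"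
    proof -
      have "w \<bullet> w = w \<bullet> (g *v u) + w \<bullet> (?T *v u) - 2 * l * (w \<bullet> u)"
        by (subst (2) w_def) (simp add: inner_diff_right inner_add_right)
      then show ?thesis using wu by (simp add: ig inner_commute)
    qed
    ultimately show ?thesis by (simp add: algebra_simps)
  qed
  note quad = this
  have "w = 0"
  proof (rule ccontr)
    assume "w \<noteq> 0"
    then have p: "w \<bullet> w > 0" by simp
    define K where "K = \<bar>l * (w \<bullet> w) - w \<bullet> (g *v w)\<bar> + 1"
    define t where "t = (w \<bullet> w) / (2 * K)"
    have K: "K > 0" "l * (w \<bullet> w) - w \<bullet> (g *v w) \<le> K" by (auto simp: K_def)
    have t: "t > 0" using K p by (simp add: t_def)
    have "t * (w \<bullet> w) \<le> t\<^sup>2 * K" using quad[of t] K(2) by (meson mult_left_mono order_trans zero_le_power2)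
    then have "w \<bullet> w \<le> t * K" using t by (simp add: power2_eq_square)
    also have "\<dots> = (w \<bullet> w) / 2" using K by (simp add: t_def)
    finally show False using p by simp
  qed
  then have gTu: "?T *v u = (2 * l) *\<^sub>R u - g *v u" by (simp add: w_def algebra_simps)
  have l_le: "l \<le> 1" "l \<ge> - 1"
    using Cauchy_Schwarz_ineq2[of u "g *v u"] gg[of u u] u(2) by (auto simp: l_def norm_eq_sqrt_inner)
  have "l \<noteq> 1"
  proof
    assume "l = 1"
    then have "(g *v u - u) \<bullet> (g *v u - u) = 0"
      by (simp add: inner_diff_left inner_diff_right gg uu inner_commute[of "g *v u" u] l_def[symmetric])
    then have "g *v u = u" by simp
    then show False using VD[OF u(1)] uu by simp
  qed
  show ?thesis
  proof (cases "l = - 1")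
    case True
    \<comment> \<open>Here g u = -u yields no second direction. Maximality makes |g x + x|^2 = 2 (x
      . x + x . g x) nonpositive on \<open>V\<close>, so \<open>g\<close> acts as -1 on all of
      it.\<close>
    have neg: "g *v x = - x" if "x \<in> V" for x
    proof -
      have "(g *v x + x) \<bullet> (g *v x + x) = 2 * (x \<bullet> x + x \<bullet> (g *v x))"
        by (simp add: inner_add_left inner_add_right gg inner_commute[of "g *v x" x])
      also have "\<dots> \<le> 0" using max'[OF that] True by simp
      finally have "g *v x + x = 0" by (metis inner_eq_zero_iff inner_ge_zero order_antisym)
      then show ?thesis by (simp add: eq_neg_iff_add_eq_0)
    qed
    \<comment> \<open>If \<open>V\<close> were the line through \<open>u\<close>, each x - g x would
      be a multiple of \<open>u\<close> and \<open>g\<close> would be the reflection along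
      \<open>u\<close>, of determinant -1.\<close>
    have "\<exists>z\<in>V. z \<noteq> 0 \<and> u \<bullet> z = 0"
    proof (rule ccontr)
      assume no: "\<not> (\<exists>z\<in>V. z \<noteq> 0 \<and> u \<bullet> z = 0)"
      have "g *v x = (mat 1 - 2 *\<^sub>R outer u u) *v x" for x
      proof -
        have "(x - g *v x) - (u \<bullet> (x - g *v x)) *\<^sub>R u \<in> V"
          by (rule subspace_diff[OF V Vd subspace_scale[OF V u(1)]])
        moreover have "u \<bullet> ((x - g *v x) - (u \<bullet> (x - g *v x)) *\<^sub>R u) = 0"
          by (simp add: inner_diff_right uu)
        ultimately have "x - g *v x = (u \<bullet> (x - g *v x)) *\<^sub>R u" using no by force
        also have "u \<bullet> (x - g *v x) = 2 * (u \<bullet> x)"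
        proof -
          have "- (?T *v u) = u"
            using Tg[of u] neg[OF u(1)] matrix_vector_mult_scaleR[of ?T "- 1" u] by simp
          then have "?T *v u = - u" by (metis minus_minus)
          then show ?thesis by (simp add: inner_diff_right ig)
        qed
        finally show ?thesis
          by (simp add: matrix_vector_mult_diff_rdistrib scaleR_matrix_vector_assoc[symmetric] outer_vec algebra_simps)
      qed
      then have "g = mat 1 - 2 *\<^sub>R outer u u" by (simp add: matrix_eq)
      then show False using det_reflection[OF u(2)] SO_D(2)[OF g] by simp
    qed
    then obtain z where z: "z \<in> V" "z \<noteq> 0" "u \<bullet> z = 0" by blast
    let ?v = "(1 / norm z) *\<^sub>R z"
    have v: "?v \<in> V" using V z(1) by (rule subspace_scale)
    show ?thesis
    proof (rule that[of u ?v pi])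
      show "orthonormal_pair u ?v"
        using z uu by (simp add: orthonormal_pair_def power2_eq_square flip: power2_norm_eq_inner)
    qed (use neg[OF u(1)] neg[OF v] VD[OF u(1)] VD[OF v] in \<open>auto simp: inner_commute\<close>)
  next
    case False
    define \<theta> where "\<theta> = arccos l"
    have l1: "- 1 < l" "l < 1" using l_le \<open>l \<noteq> 1\<close> False by auto
    have \<theta>: "0 \<le> \<theta>" "\<theta> \<le> pi" "cos \<theta> = l"
      using l1 by (auto simp: \<theta>_def arccos_lbound arccos_ubound)
    have s2: "sin \<theta> * sin \<theta> = 1 - l * l"
      using sin_squared_eq[of \<theta>] \<theta>(3) by (simp add: power2_eq_square)
    have "l * l < 1" using l1 by (simp add: abs_square_less_1[unfolded power2_eq_square])
    then have s: "sin \<theta> \<noteq> 0" using s2 by auto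
    \<comment> \<open>The part of g u orthogonal to \<open>u\<close>, of length |sin \<theta>|
      because |g u| = 1 and u . g u = cos \<theta>.\<close>
    define v where "v = (1 / sin \<theta>) *\<^sub>R (g *v u - l *\<^sub>R u)"
    have vV: "v \<in> V" unfolding v_def using V u(1) by (auto intro!: subspace_diff subspace_scale Vg)
    have gu: "g *v u = l *\<^sub>R u + sin \<theta> *\<^sub>R v" using s by (simp add: v_def)
    have uv: "u \<bullet> v = 0" by (simp add: v_def inner_diff_right uu l_def[symmetric])
    have "(g *v u - l *\<^sub>R u) \<bullet> (g *v u - l *\<^sub>R u) = sin \<theta> * sin \<theta>"
      by (simp add: inner_diff_left inner_diff_right gg uu inner_commute[of "g *v u" u] l_def[symmetric] s2)
    then have vv: "v \<bullet> v = 1" using s by (simp add: v_def)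
    \<comment> \<open>Applying \<open>g\<close> to the eigenvalue equation expresses g (g u) through
      g u and u, which closes the plane under \<open>g\<close>.\<close>
    have "u = (2 * l) *\<^sub>R (g *v u) - g *v (g *v u)"
      using arg_cong[OF gTu, of "(*v) g"] by (simp add: gT matrix_vector_mult_diff_distrib matrix_vector_mult_scaleR)
    then have "g *v (g *v u) = (2 * l) *\<^sub>R (g *v u) - u" by (simp add: algebra_simps)
    then have "g *v v = (1 / sin \<theta>) *\<^sub>R (l *\<^sub>R (g *v u) - u)"
      by (simp add: v_def matrix_vector_mult_scaleR matrix_vector_mult_diff_distrib flip: scaleR_diff_left)
    also have "l *\<^sub>R (g *v u) - u = (sin \<theta> * l) *\<^sub>R v - (sin \<theta> * sin \<theta>) *\<^sub>R u"
      unfolding gu s2 by (simp add: algebra_simps)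
    finally have gv: "g *v v = l *\<^sub>R v - sin \<theta> *\<^sub>R u" using s by (simp add: scaleR_diff_right)
    show ?thesis
      by (rule that[of u v \<theta>])
         (use \<theta> gu gv uu uv vv VD[OF u(1)] VD[OF vV] in \<open>auto simp: orthonormal_pair_def inner_commute\<close>)
  qed
qed

lemma inner_matrix_mult_right:
  fixes a b s :: "real^'n^'n"
  assumes "orthogonal_matrix a"
  shows "(s ** a) \<bullet> b = s \<bullet> (b ** transpose a)"
  using assms inner_orthogonal_mult_right[of "transpose a" "s ** a" b]
  by (simp add: matrix_mul_assoc[symmetric] orthogonal_matrix_def)

lemma bounded_linear_matrix_vector_left: "bounded_linear (\<lambda>a::real^'n^'m. a *v x)"
  unfolding linear_linear
  by (auto intro!: linearI simp: matrix_vector_mult_add_rdistrib scaleR_matrix_vector_assoc)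

text \<open>All rotations have the same norm as the identity, so the squared chord is affine in the
  trace and adds up over split-off planes.\<close>

lemma norm_SO_diff_mat_1:
  fixes g :: "real^'n^'n"
  assumes "g \<in> SO"
  shows "(norm (g - mat 1))\<^sup>2 = 2 * real CARD('n) - 2 * (g \<bullet> mat 1)"
proof -
  have 1: "mat 1 \<bullet> (mat 1 :: real^'n^'n) = real CARD('n)"
    by (simp add: inner_matrix_trace transpose_mat trace_I)
  have 2: "g \<bullet> g = real CARD('n)"
    using inner_orthogonal_mult_left[OF SO_D(1)[OF assms], of "mat 1" "mat 1"] 1 by simp
  show ?thesis
    by (simp add: power2_norm_eq_inner inner_diff_left inner_diff_right 1 2 inner_commute)
qed

lemma smooth_plane_rot:
  fixes u v :: "real^'n" and \<gamma> :: "real \<Rightarrow> real^'n^'n"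
  assumes "smooth_curve \<phi>" "smooth_curve \<gamma>"
  shows "smooth_curve (\<lambda>t. plane_rot u v (\<phi> t) ** \<gamma> t)"
proof -
  have "smooth_curve (\<lambda>t. plane_rot u v (\<phi> t))"
    unfolding plane_rot_def diff_conv_add_uminus
    by (intro smooth_curve_add smooth_curve_const
        smooth_curve_linear[OF bounded_linear_scaleR_left] smooth_curve_cos smooth_curve_sin assms(1))
  from smooth_curve_bilinear[OF bounded_bilinear_matrix_mult this assms(2)] show ?thesis .
qed

lemma has_vector_derivative_plane_rot_mult:
  fixes u v :: "real^'n" and \<gamma> :: "real \<Rightarrow> real^'n^'n"
  assumes "orthonormal_pair u v" "(\<phi> has_vector_derivative \<phi>') (at t)" "(\<gamma> has_vector_derivative \<gamma>') (at t)"
  shows "((\<lambda>t. plane_rot u v (\<phi> t) ** \<gamma> t) has_vector_derivative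
    plane_rot u v (\<phi> t) ** \<gamma>' + plane_rot u v (\<phi> t) ** (\<phi>' *\<^sub>R skew u v) ** \<gamma> t) (at t)"
  using bounded_bilinear.has_vector_derivative[OF bounded_bilinear_matrix_mult
      has_vector_derivative_plane_rot[OF assms(1,2)] assms(3)] .

text \<open>Splitting off the rotation of one invariant plane at a time, the squared speed and the squared
  chord both add up.\<close>

lemma SO_constant_speed_curve:
  fixes g :: "real^'n^'n"
  assumes "g \<in> SO"
  shows "\<exists>\<gamma> \<gamma>' c. smooth_curve \<gamma> \<and> (\<forall>t. (\<gamma> has_vector_derivative \<gamma>' t) (at t)) \<and> (\<forall>t. \<gamma> t \<in> SO) \<and>
    \<gamma> 0 = mat 1 \<and> \<gamma> 1 = g \<and> (\<forall>t x. g *v x = x \<longrightarrow> \<gamma> t *v x = x) \<and>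
    (\<forall>t. norm (\<gamma>' t) = c) \<and> c\<^sup>2 \<le> pi\<^sup>2 / 4 * (norm (g - mat 1))\<^sup>2"
  using assms
\<comment> \<open>The codimension of the fixed space drops with each plane split off. The clause
  that the curve fixes whatever \<open>g\<close> fixes is carried along to kill the cross term in
  the speed.\<close>
proof (induction "CARD('n) - dim {x. g *v x = x}" arbitrary: g rule: less_induct)
  case less
  show ?case
  proof (cases "g = mat 1")
    case True
    have "mat 1 \<in> (SO :: (real^'n^'n) set)"
      by (simp add: SO_def rotation_matrix_def orthogonal_matrix_id)
    with True show ?thesis
      by (intro exI[of _ "\<lambda>t. mat 1"] exI[of _ "\<lambda>t. 0"] exI[of _ 0])
        (auto simp: smooth_curve_const has_vector_derivative_const)
  next
    case False
    from SO_invariant_plane[OF less.prems False] obtain u v \<theta> where uv: "orthonormal_pair u v"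
      and \<theta>: "0 \<le> \<theta>" "\<theta> \<le> pi"
      and gu: "g *v u = cos \<theta> *\<^sub>R u + sin \<theta> *\<^sub>R v" and gv: "g *v v = cos \<theta> *\<^sub>R v - sin \<theta> *\<^sub>R u"
      and fixed: "\<And>x. g *v x = x \<Longrightarrow> u \<bullet> x = 0 \<and> v \<bullet> x = 0" by blast
    \<comment> \<open>Undoing the rotation of the invariant plane gives a matrix that fixes
      \<open>u\<close>, \<open>v\<close> and every fixed vector of \<open>g\<close>.\<close>
    define h where "h = plane_rot u v (- \<theta>) ** g"
    have g_eq: "g = plane_rot u v \<theta> ** h"
      by (simp add: h_def matrix_mul_assoc plane_rot_mult[OF uv] plane_rot_0)
    have h: "h \<in> SO" unfolding h_def by (intro SO_mult plane_rot_in_SO uv less.prems)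
    have ru: "plane_rot u v \<theta> *v u = g *v u" and rv: "plane_rot u v \<theta> *v v = g *v v"
      by (simp_all add: plane_rot_vec gu gv orthonormal_pairD[OF uv] algebra_simps)
    have "h *v u = plane_rot u v (- \<theta>) *v (plane_rot u v \<theta> *v u)"
      "h *v v = plane_rot u v (- \<theta>) *v (plane_rot u v \<theta> *v v)"
      unfolding ru rv h_def by (simp_all add: matrix_vector_mul_assoc)
    then have hu: "h *v u = u" and hv: "h *v v = v"
      by (simp_all add: matrix_vector_mul_assoc plane_rot_mult[OF uv] plane_rot_0)
    have hx: "h *v x = x" if "g *v x = x" for x
      using fixed[OF that] that by (simp add: h_def matrix_vector_mul_assoc[symmetric] plane_rot_vec)
    have sub: "subspace {x. a *v x = x}" for a :: "real^'n^'n"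
      by (auto simp: subspace_def matrix_vector_right_distrib matrix_vector_mult_scaleR)
    have "{x. g *v x = x} \<subset> {x. h *v x = x}"
      using hx hu fixed[of u] orthonormal_pairD(1)[OF uv] by (auto intro!: psubsetI)
    then have "dim {x. g *v x = x} < dim {x. h *v x = x}"
      by (intro dim_psubset) (simp add: span_eq_iff[THEN iffD2] sub)
    moreover have "dim {x. h *v x = x} \<le> CARD('n)"
      using dim_subset_UNIV[of "{x. h *v x = x}"] by simp
    ultimately have "CARD('n) - dim {x. h *v x = x} < CARD('n) - dim {x. g *v x = x}" by linarith
    from less.hyps[OF this h] obtain \<gamma> \<gamma>' c where \<gamma>: "smooth_curve \<gamma>"
      "\<And>t. (\<gamma> has_vector_derivative \<gamma>' t) (at t)" "\<And>t. \<gamma> t \<in> SO" "\<gamma> 0 = mat 1" "\<gamma> 1 = h"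
      "\<And>t x. h *v x = x \<Longrightarrow> \<gamma> t *v x = x"
      "\<And>t. norm (\<gamma>' t) = c" "c\<^sup>2 \<le> pi\<^sup>2 / 4 * (norm (h - mat 1))\<^sup>2" by blast
    \<comment> \<open>Differentiating \<gamma> x = x: the velocity annihilates \<open>u\<close> and
      \<open>v\<close>, hence is orthogonal to the generator of the new rotation and the squared
      speeds add.\<close>
    have d0: "\<gamma>' t *v x = 0" if "h *v x = x" for t x
    proof -
      have "((\<lambda>t. \<gamma> t *v x) has_vector_derivative \<gamma>' t *v x) (at t)"
        by (rule bounded_linear.has_vector_derivative[OF bounded_linear_matrix_vector_left \<gamma>(2)])
      then have "((\<lambda>t. x) has_vector_derivative \<gamma>' t *v x) (at t)" by (simp add: \<gamma>(6)[OF that])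
      then show ?thesis by (rule vector_derivative_unique_at) (rule has_vector_derivative_const)
    qed
    have lin: "((\<lambda>t. \<theta> * t) has_vector_derivative \<theta>) (at t)" for t
      unfolding has_real_derivative_iff_has_vector_derivative[symmetric] by (auto intro!: derivative_eq_intros)
    define \<Gamma> where "\<Gamma> t = plane_rot u v (\<theta> * t) ** \<gamma> t" for t
    define \<Gamma>' where "\<Gamma>' t = plane_rot u v (\<theta> * t) ** \<gamma>' t + plane_rot u v (\<theta> * t) ** (\<theta> *\<^sub>R skew u v) ** \<gamma> t" for t
    have "smooth_curve \<Gamma>"
      unfolding \<Gamma>_def by (intro smooth_plane_rot \<gamma>(1) smooth_curveI[OF lin smooth_curve_const])
    moreover have "(\<Gamma> has_vector_derivative \<Gamma>' t) (at t)" for t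
      unfolding \<Gamma>_def \<Gamma>'_def by (rule has_vector_derivative_plane_rot_mult[OF uv lin \<gamma>(2)])
    moreover have "\<Gamma> t \<in> SO" for t unfolding \<Gamma>_def by (intro SO_mult plane_rot_in_SO uv \<gamma>(3))
    moreover have "\<Gamma> 0 = mat 1" "\<Gamma> 1 = g" by (simp_all add: \<Gamma>_def plane_rot_0 \<gamma>(4,5) g_eq)
    moreover have "\<Gamma> t *v x = x" if "g *v x = x" for t x
      using fixed[OF that] \<gamma>(6)[OF hx[OF that]]
      by (simp add: \<Gamma>_def matrix_vector_mul_assoc[symmetric] plane_rot_vec)
    moreover have "norm (\<Gamma>' t) = sqrt (c\<^sup>2 + 2 * \<theta>\<^sup>2)" for t
    proof -
      note o = SO_D(1)[OF \<gamma>(3)[of t]]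
      have "(skew u v ** \<gamma> t) \<bullet> \<gamma>' t = 0"
        unfolding inner_matrix_mult_right[OF o] inner_skew
        by (simp add: matrix_vector_mul_assoc[symmetric] transpose_fixed[OF o \<gamma>(6)[OF hu]]
            transpose_fixed[OF o \<gamma>(6)[OF hv]] d0 hu hv del: transpose_matrix_vector)
      then have "(norm (\<Gamma>' t))\<^sup>2 = c\<^sup>2 + 2 * \<theta>\<^sup>2"
        unfolding \<Gamma>'_def norm_plane_rot_derivative[OF uv o] by (simp add: \<gamma>(7))
      then show ?thesis by (simp add: real_sqrt_unique)
    qed
    moreover have "(sqrt (c\<^sup>2 + 2 * \<theta>\<^sup>2))\<^sup>2 \<le> pi\<^sup>2 / 4 * (norm (g - mat 1))\<^sup>2"
    proof -
      \<comment> \<open>The planar rotation has squared speed 2 \<theta>^2 and squared chord 4 (1 -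
        cos \<theta>) = 8 sin(\<theta>/2)^2; Jordan's inequality compares them with the factor
        \<pi>^2/4.\<close>
      have "\<theta> \<le> pi * sin (\<theta> / 2)"
        using two_over_pi_le_sin[of "\<theta> / 2"] \<theta> by (simp add: field_simps)
      then have "\<theta>\<^sup>2 \<le> (pi * sin (\<theta> / 2))\<^sup>2" using \<theta> by (intro power_mono)
      also have "(pi * sin (\<theta> / 2))\<^sup>2 = pi\<^sup>2 * (1 - cos \<theta>) / 2"
        using cos_double_sin[of "\<theta> / 2"] by (simp add: power_mult_distrib)
      finally have 1: "2 * \<theta>\<^sup>2 \<le> pi\<^sup>2 / 4 * (4 * (1 - cos \<theta>))" by (simp add: algebra_simps)
      note oh = SO_D(1)[OF h]
      have "g = h + (cos \<theta> - 1) *\<^sub>R ((outer u u + outer v v) ** h) + sin \<theta> *\<^sub>R (skew u v ** h)"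
        unfolding g_eq plane_rot_def
        by (simp add: bounded_bilinear.add_left[OF bounded_bilinear_matrix_mult]
            bounded_bilinear.scaleR_left[OF bounded_bilinear_matrix_mult])
      then have "g \<bullet> mat 1 = h \<bullet> mat 1 + (cos \<theta> - 1) * (((outer u u + outer v v) ** h) \<bullet> mat 1)
          + sin \<theta> * ((skew u v ** h) \<bullet> mat 1)"
        by (metis inner_add_left inner_scaleR_left)
      also have "\<dots> = h \<bullet> mat 1 + 2 * (cos \<theta> - 1)"
        unfolding inner_matrix_mult_right[OF oh] inner_add_left inner_skew inner_outer
        by (simp add: transpose_fixed[OF oh hu] transpose_fixed[OF oh hv] orthonormal_pairD[OF uv]
            del: transpose_matrix_vector)
      finally have "(norm (g - mat 1))\<^sup>2 = (norm (h - mat 1))\<^sup>2 + 4 * (1 - cos \<theta>)"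
        unfolding norm_SO_diff_mat_1[OF h] norm_SO_diff_mat_1[OF less.prems] by simp
      then have "pi\<^sup>2 / 4 * (norm (g - mat 1))\<^sup>2
          = pi\<^sup>2 / 4 * (norm (h - mat 1))\<^sup>2 + pi\<^sup>2 / 4 * (4 * (1 - cos \<theta>))"
        by (simp only: distrib_left)
      moreover have "(sqrt (c\<^sup>2 + 2 * \<theta>\<^sup>2))\<^sup>2 = c\<^sup>2 + 2 * \<theta>\<^sup>2" by simp
      ultimately show ?thesis using 1 \<gamma>(8) by linarith
    qed
    ultimately show ?thesis by blast
  qed
qed

section \<open>Chains of smooth arcs\<close>

text \<open>The length is an argument of the relation, so integrability of the speed is part of it
  and no default value of \<open>integral\<close> can enter.\<close>

definition smooth_arc :: "real^'n^'n \<Rightarrow> real^'n^'n \<Rightarrow> real \<Rightarrow> bool" where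
  "smooth_arc a b l \<longleftrightarrow> (\<exists>\<gamma> \<gamma>'. smooth_curve \<gamma> \<and> (\<forall>t. (\<gamma> has_vector_derivative \<gamma>' t) (at t)) \<and>
     (\<forall>t. \<gamma> t \<in> SO) \<and> \<gamma> 0 = a \<and> \<gamma> 1 = b \<and> ((\<lambda>t. norm (\<gamma>' t)) has_integral l) {0..1})"

lemma smooth_arcI:
  assumes "smooth_curve \<gamma>" "\<And>t. (\<gamma> has_vector_derivative \<gamma>' t) (at t)" "\<And>t. \<gamma> t \<in> SO"
    "\<gamma> 0 = a" "\<gamma> 1 = b" "((\<lambda>t. norm (\<gamma>' t)) has_integral l) {0..1}"
  shows "smooth_arc a b l"
  unfolding smooth_arc_def using assms by (intro exI[of _ \<gamma>] exI[of _ \<gamma>'] conjI allI)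

lemma smooth_arcE:
  assumes "smooth_arc a b l"
  obtains \<gamma> \<gamma>' where "smooth_curve \<gamma>" "\<And>t. (\<gamma> has_vector_derivative \<gamma>' t) (at t)" "\<And>t. \<gamma> t \<in> SO"
    "\<gamma> 0 = a" "\<gamma> 1 = b" "((\<lambda>t. norm (\<gamma>' t)) has_integral l) {0..1}"
  using assms unfolding smooth_arc_def by blast

lemma smooth_arc_nonneg: "smooth_arc a b l \<Longrightarrow> 0 \<le> l"
  by (elim smooth_arcE) (auto intro: has_integral_nonneg)

lemma smooth_arc_in_SO: "smooth_arc a b l \<Longrightarrow> a \<in> SO \<and> b \<in> SO"
  by (elim smooth_arcE) auto

lemma smooth_arc_mult_left:
  assumes q: "q \<in> SO" and "smooth_arc a b l"
  shows "smooth_arc (q ** a) (q ** b) l"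
proof -
  obtain \<gamma> \<gamma>' where \<gamma>: "smooth_curve \<gamma>" "\<And>t. (\<gamma> has_vector_derivative \<gamma>' t) (at t)" "\<And>t. \<gamma> t \<in> SO"
    "\<gamma> 0 = a" "\<gamma> 1 = b" "((\<lambda>t. norm (\<gamma>' t)) has_integral l) {0..1}"
    using assms(2) by (rule smooth_arcE) blast
  note lin = bounded_bilinear.bounded_linear_right[OF bounded_bilinear_matrix_mult, of q]
  show ?thesis
    by (rule smooth_arcI[OF smooth_curve_linear[OF lin \<gamma>(1)] bounded_linear.has_vector_derivative[OF lin \<gamma>(2)]])
      (use \<gamma>(3-6) q in \<open>auto simp: SO_mult norm_orthogonal_mult_left SO_D\<close>)
qed

lemma smooth_arc_mult_right:
  assumes q: "q \<in> SO" and "smooth_arc a b l"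
  shows "smooth_arc (a ** q) (b ** q) l"
proof -
  obtain \<gamma> \<gamma>' where \<gamma>: "smooth_curve \<gamma>" "\<And>t. (\<gamma> has_vector_derivative \<gamma>' t) (at t)" "\<And>t. \<gamma> t \<in> SO"
    "\<gamma> 0 = a" "\<gamma> 1 = b" "((\<lambda>t. norm (\<gamma>' t)) has_integral l) {0..1}"
    using assms(2) by (rule smooth_arcE) blast
  note lin = bounded_bilinear.bounded_linear_left[OF bounded_bilinear_matrix_mult, of q]
  show ?thesis
    by (rule smooth_arcI[OF smooth_curve_linear[OF lin \<gamma>(1)] bounded_linear.has_vector_derivative[OF lin \<gamma>(2)]])
      (use \<gamma>(3-6) q in \<open>auto simp: SO_mult norm_orthogonal_mult_right SO_D\<close>)
qed

lemma SO_mat_1: "mat 1 \<in> SO"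
  by (simp add: SO_def rotation_matrix_def orthogonal_matrix_id)

lemma SO_transpose: "g \<in> SO \<Longrightarrow> transpose g \<in> SO"
  by (simp add: SO_def rotation_matrix_def det_transpose)

lemma SO_transpose_mult: "g \<in> SO \<Longrightarrow> transpose g ** g = mat 1" "g \<in> SO \<Longrightarrow> g ** transpose g = mat 1"
  by (simp_all add: SO_def rotation_matrix_def orthogonal_matrix_def)

text \<open>Right translation by \<open>x\<close> carries a curve from the identity to y x^T into
  one from \<open>x\<close> to \<open>y\<close>, and preserves both speed and chord.\<close>

lemma smooth_arc_chord:
  assumes x: "x \<in> SO" and y: "y \<in> SO"
  obtains l where "smooth_arc x y l" "l \<le> pi / 2 * norm (x - y)"
proof -
  let ?g = "y ** transpose x"
  have "?g \<in> SO" using x y by (intro SO_mult SO_transpose)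
  from SO_constant_speed_curve[OF this] obtain \<gamma> \<gamma>' c where \<gamma>: "smooth_curve \<gamma>"
    "\<And>t. (\<gamma> has_vector_derivative \<gamma>' t) (at t)" "\<And>t. \<gamma> t \<in> SO" "\<gamma> 0 = mat 1" "\<gamma> 1 = ?g"
    "\<And>t. norm (\<gamma>' t) = c" "c\<^sup>2 \<le> pi\<^sup>2 / 4 * (norm (?g - mat 1))\<^sup>2"
    by blast
  have c: "c \<ge> 0" using \<gamma>(6)[of 0] by auto
  have "((\<lambda>t. norm (\<gamma>' t)) has_integral c) {0..1}"
    using has_integral_const_real[of c 0 1] by (simp add: \<gamma>(6))
  then have "smooth_arc (mat 1) ?g c" by (intro smooth_arcI[OF \<gamma>(1-5)])
  from smooth_arc_mult_right[OF x this] have "smooth_arc x y c"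
    by (simp add: matrix_mul_assoc[symmetric] SO_transpose_mult x)
  moreover have "norm (?g - mat 1) = norm (x - y)"
  proof -
    have "(?g - mat 1) ** x = y - x"
      by (simp add: bounded_bilinear.diff_left[OF bounded_bilinear_matrix_mult] matrix_mul_assoc[symmetric]
          SO_transpose_mult x)
    then show ?thesis
      using norm_orthogonal_mult_right[OF SO_D(1)[OF x], of "?g - mat 1"] by (simp add: norm_minus_commute)
  qed
  then have "c\<^sup>2 \<le> (pi / 2 * norm (x - y))\<^sup>2"
    using \<gamma>(7) by (simp add: power_mult_distrib power_divide)
  then have "c \<le> pi / 2 * norm (x - y)" by (rule power2_le_imp_le) simp
  ultimately show ?thesis by (rule that)
qed

text \<open>A formal concatenation: arcs are prepended one at a time, so length estimates and twists
  pass from arcs to chains by rule induction.\<close>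

inductive chain :: "real^'n^'n \<Rightarrow> real^'n^'n \<Rightarrow> real \<Rightarrow> bool" where
  chain_refl: "a \<in> SO \<Longrightarrow> chain a a 0"
| chain_arc: "smooth_arc a b l \<Longrightarrow> chain b c m \<Longrightarrow> chain a c (l + m)"

lemma chain_nonneg: "chain a b l \<Longrightarrow> 0 \<le> l"
  by (induction rule: chain.induct) (auto dest: smooth_arc_nonneg)

lemma chain_trans: "chain a b l \<Longrightarrow> chain b c m \<Longrightarrow> chain a c (l + m)"
  by (induction rule: chain.induct) (auto simp: add.assoc intro: chain_arc)

lemma chain_mult_left: "chain a b l \<Longrightarrow> q \<in> SO \<Longrightarrow> chain (q ** a) (q ** b) l"
  by (induction rule: chain.induct) (auto intro: chain.intros SO_mult smooth_arc_mult_left)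

lemma smooth_arc_imp_chain: "smooth_arc a b l \<Longrightarrow> chain a b l"
  using chain_arc[of a b l b 0] chain_refl[of b] smooth_arc_in_SO by fastforce

text \<open>A majorant of \<open>SO_dist\<close> on the group that stands in for it throughout the
  coupling argument.\<close>

definition chain_dist :: "real^'n^'n \<Rightarrow> real^'n^'n \<Rightarrow> real" where
  "chain_dist a b = Inf {l. chain a b l}"

lemma bdd_below_chain: "bdd_below {l. chain a b l}"
  by (auto intro!: bdd_belowI[of _ 0] chain_nonneg)

lemma chain_dist_le: "chain a b l \<Longrightarrow> chain_dist a b \<le> l"
  unfolding chain_dist_def by (intro cInf_lower bdd_below_chain) simp

lemma chain_exists: "a \<in> SO \<Longrightarrow> b \<in> SO \<Longrightarrow> \<exists>l. chain a b l"
  by (metis smooth_arc_chord smooth_arc_imp_chain)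

lemma chain_dist_nonneg: "a \<in> SO \<Longrightarrow> b \<in> SO \<Longrightarrow> 0 \<le> chain_dist a b"
  unfolding chain_dist_def using chain_exists by (intro cInf_greatest) (auto intro: chain_nonneg)

lemma chain_dist_approx:
  assumes "a \<in> SO" "b \<in> SO" "chain_dist a b < r"
  obtains l where "chain a b l" "l < r"
  using assms chain_exists[of a b] cInf_less_iff[OF _ bdd_below_chain, of a b r]
  unfolding chain_dist_def by auto

lemma chain_dist_triangle:
  assumes "a \<in> SO" "b \<in> SO" "c \<in> SO"
  shows "chain_dist a c \<le> chain_dist a b + chain_dist b c"
proof (rule field_le_epsilon)
  fix e :: real assume "e > 0"
  then obtain l m where "chain a b l" "l < chain_dist a b + e / 2" "chain b c m" "m < chain_dist b c + e / 2"
    using assms by (metis chain_dist_approx half_gt_zero less_add_same_cancel1)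
  then show "chain_dist a c \<le> chain_dist a b + chain_dist b c + e"
    using chain_dist_le[OF chain_trans, of a b l c m] by linarith
qed

lemma chain_dist_le_norm: "a \<in> SO \<Longrightarrow> b \<in> SO \<Longrightarrow> chain_dist a b \<le> pi / 2 * norm (a - b)"
  by (metis smooth_arc_chord smooth_arc_imp_chain chain_dist_le order_trans)

text \<open>Translating chains gives one inequality for every \<open>q\<close>; the other is the
  same inequality for the inverse \<open>transpose q\<close>.\<close>

lemma chain_dist_mult_left:
  assumes "q \<in> SO" "a \<in> SO" "b \<in> SO"
  shows "chain_dist (q ** a) (q ** b) = chain_dist a b"
proof -
  have le: "chain_dist (q ** a) (q ** b) \<le> chain_dist a b" if ab: "q \<in> SO" "a \<in> SO" "b \<in> SO" for q a b :: "real^'n^'n"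
  proof (rule field_le_epsilon)
    fix e :: real assume "e > 0"
    then obtain l where "chain a b l" "l < chain_dist a b + e"
      by (elim chain_dist_approx[OF ab(2,3), of "chain_dist a b + e", rotated]) simp
    then show "chain_dist (q ** a) (q ** b) \<le> chain_dist a b + e"
      using chain_dist_le[OF chain_mult_left, of a b l q] ab by linarith
  qed
  show ?thesis
    using le[OF assms] le[of "transpose q" "q ** a" "q ** b"] assms
    by (simp add: matrix_mul_assoc SO_transpose_mult SO_mult SO_transpose)
qed

lemma norm_SO: "a \<in> SO \<Longrightarrow> norm a = sqrt (real CARD('n))" for a :: "real^'n^'n"
  using inner_orthogonal_mult_left[OF SO_D(1), of a "mat 1" "mat 1"]
  by (simp add: norm_eq_sqrt_inner inner_matrix_trace transpose_mat trace_I)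

text \<open>Every rotation has norm sqrt n, so a chord has length at most 2 sqrt n, and the
  arc-chord factor \<pi>/2 does the rest.\<close>

lemma chain_dist_le_diameter:
  fixes a b :: "real^'n^'n"
  assumes "a \<in> SO" "b \<in> SO"
  shows "chain_dist a b \<le> pi * sqrt (real CARD('n))"
proof -
  have "norm (a - b) \<le> 2 * sqrt (real CARD('n))"
    using norm_triangle_ineq4[of a b] by (simp add: norm_SO assms)
  then have "pi / 2 * norm (a - b) \<le> pi / 2 * (2 * sqrt (real CARD('n)))"
    by (intro mult_left_mono) auto
  from order_trans[OF chain_dist_le_norm[OF assms] this] show ?thesis by simp
qed

section \<open>From chains to piecewise smooth paths: \<open>SO_dist\<close> is at most
  \<open>chain_dist\<close>\<close>

lemma smooth_arc_reparam:
  assumes "smooth_arc a b l" "c < d"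
  obtains \<gamma> where "smooth_on_interval c d \<gamma>" "\<And>t. \<gamma> t \<in> SO" "\<gamma> c = a" "\<gamma> d = b"
    "((\<lambda>t. hs_norm (vector_derivative \<gamma> (at t))) has_integral l) {c..d}"
proof -
  obtain \<gamma> \<gamma>' where \<gamma>: "smooth_curve \<gamma>" "\<And>t. (\<gamma> has_vector_derivative \<gamma>' t) (at t)" "\<And>t. \<gamma> t \<in> SO"
    "\<gamma> 0 = a" "\<gamma> 1 = b" "((\<lambda>t. norm (\<gamma>' t)) has_integral l) {0..1}"
    using assms(1) by (rule smooth_arcE) blast
  \<comment> \<open>The affine map t \<mapsto> p t + q sends [c, d] onto [0, 1]. The factor
    \<open>p\<close> in the speed cancels against the 1/p from the substitution, so the length is
    unchanged.\<close>
  define p where "p = 1 / (d - c)"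
  have p: "p > 0" using assms(2) by (simp add: p_def)
  define q where "q = - p * c"
  obtain G where G: "\<And>t. G 0 t = \<gamma> (p * t + q)" "\<And>(k::nat) t. (G k has_vector_derivative G (Suc k) t) (at t)"
    using smooth_curve_affine[OF \<gamma>(1), of p q] by metis
  show ?thesis
  proof (rule that[of "\<lambda>t. \<gamma> (p * t + q)"])
    show "smooth_on_interval c d (\<lambda>t. \<gamma> (p * t + q))"
      unfolding smooth_on_interval_def using G(1) has_vector_derivative_at_within[OF G(2)]
      by (intro exI[of _ G]) auto
    have dc: "p * (d - c) = 1" using assms(2) by (simp add: p_def)
    show "\<gamma> (p * c + q) = a" "\<gamma> (p * d + q) = b"
      using \<gamma>(4,5) dc by (simp_all add: q_def algebra_simps)
    have "vector_derivative (\<lambda>t. \<gamma> (p * t + q)) (at t) = p *\<^sub>R \<gamma>' (p * t + q)" for t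
    proof (rule vector_derivative_at)
      have "((\<lambda>t. p * t + q) has_vector_derivative p) (at t)"
        unfolding has_real_derivative_iff_has_vector_derivative[symmetric]
        by (auto intro!: derivative_eq_intros)
      from vector_diff_chain_at[OF this \<gamma>(2)]
      show "((\<lambda>t. \<gamma> (p * t + q)) has_vector_derivative p *\<^sub>R \<gamma>' (p * t + q)) (at t)"
        by (simp add: o_def)
    qed
    then have e: "hs_norm (vector_derivative (\<lambda>t. \<gamma> (p * t + q)) (at t)) = p *\<^sub>R norm (\<gamma>' (p * t + q))" for t
      using p by (simp add: hs_norm_eq_norm)
    have "((\<lambda>t. norm (\<gamma>' (p *\<^sub>R t + q))) has_integral l /\<^sub>R p ^ DIM(real)) (cbox ((0 - q) /\<^sub>R p) ((1 - q) /\<^sub>R p))"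
      by (rule has_integral_affinity'[OF _ p]) (use \<gamma>(6) in simp)
    also have "cbox ((0 - q) /\<^sub>R p) ((1 - q) /\<^sub>R p) = {c..d}"
      using p dc by (simp add: q_def field_simps)
    finally have "((\<lambda>t. norm (\<gamma>' (p * t + q))) has_integral l / p) {c..d}"
      using p by (simp add: divide_inverse mult.commute)
    from has_integral_cmul[OF this, of p]
    show "((\<lambda>t. hs_norm (vector_derivative (\<lambda>t. \<gamma> (p * t + q)) (at t))) has_integral l) {c..d}"
      unfolding e using p by simp
  qed (rule \<gamma>(3))
qed

lemma smooth_on_interval_cong:
  "(\<And>t. t \<in> {a..b} \<Longrightarrow> f t = g t) \<Longrightarrow> smooth_on_interval a b f \<longleftrightarrow> smooth_on_interval a b g"
  unfolding smooth_on_interval_def by simp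

text \<open>At a break point a glued curve may have no derivative. Agreement on the open interval
  suffices, because the end points do not affect the integral.\<close>

lemma has_integral_speed_cong:
  fixes f g :: "real \<Rightarrow> real^'n^'n"
  assumes "((\<lambda>t. hs_norm (vector_derivative g (at t))) has_integral l) {c..d}"
    and eq: "\<And>t. t \<in> {c<..<d} \<Longrightarrow> f t = g t"
  shows "((\<lambda>t. hs_norm (vector_derivative f (at t))) has_integral l) {c..d}"
  unfolding cbox_interval[symmetric]
proof (rule has_integral_spike_interior)
  fix t assume "t \<in> box c d"
  then have t: "t \<in> {c<..<d}" by simp
  then have "eventually (\<lambda>s. s \<in> {c<..<d}) (nhds t)"
    by (intro eventually_nhds_in_open) auto
  then have "eventually (\<lambda>s. f s = g s) (nhds t)" by eventually_elim (rule eq)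
  then show "hs_norm (vector_derivative f (at t)) = hs_norm (vector_derivative g (at t))"
    using t eq by (subst vector_derivative_cong_eq) (auto simp: eventually_at_filter elim: eventually_mono)
qed (use assms in simp)

text \<open>The first arc takes the left half of [c, d] and the remaining chain the right half, so
  \<open>d\<close> stays fixed in the induction and only \<open>c\<close> is generalised.\<close>

lemma chain_path:
  assumes "chain a b l" "c < d"
  shows "\<exists>\<gamma> N s. s 0 = c \<and> s N = d \<and> (\<forall>i<N. s i < s (Suc i) \<and> smooth_on_interval (s i) (s (Suc i)) \<gamma>) \<and>
    (\<forall>t. \<gamma> t \<in> SO) \<and> \<gamma> c = a \<and> \<gamma> d = b \<and> c \<le> d \<and>
    ((\<lambda>t. hs_norm (vector_derivative \<gamma> (at t))) has_integral l) {c..d}"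
  using assms
proof (induction arbitrary: c rule: chain.induct)
  case (chain_refl a)
  have "smooth_curve (\<lambda>t. a)" by (rule smooth_curve_const)
  then have "smooth_arc a a 0"
    by (rule smooth_arcI[OF _ has_vector_derivative_const]) (use chain_refl in auto)
  from smooth_arc_reparam[OF this chain_refl(2)] obtain \<gamma> where "smooth_on_interval c d \<gamma>" "\<And>t. \<gamma> t \<in> SO" "\<gamma> c = a" "\<gamma> d = a"
    "((\<lambda>t. hs_norm (vector_derivative \<gamma> (at t))) has_integral 0) {c..d}" by blast
  with chain_refl(2) show ?case
    by (intro exI[of _ \<gamma>] exI[of _ "Suc 0"] exI[of _ "\<lambda>i. if i = 0 then c else d"]) auto
next
  case (chain_arc a b l e m)
  define z where "z = (c + d) / 2"
  have z: "c < z" "z < d" using chain_arc.prems by (auto simp: z_def)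
  obtain \<alpha> where \<alpha>: "smooth_on_interval c z \<alpha>" "\<And>t. \<alpha> t \<in> SO" "\<alpha> c = a" "\<alpha> z = b"
    "((\<lambda>t. hs_norm (vector_derivative \<alpha> (at t))) has_integral l) {c..z}"
    using smooth_arc_reparam[OF chain_arc.hyps(1) z(1)] by blast
  obtain \<beta> N s where \<beta>: "s 0 = z" "s N = d" "\<And>i. i < N \<Longrightarrow> s i < s (Suc i)"
    "\<And>i. i < N \<Longrightarrow> smooth_on_interval (s i) (s (Suc i)) \<beta>"
    "\<And>t. \<beta> t \<in> SO" "\<beta> z = b" "\<beta> d = e" "((\<lambda>t. hs_norm (vector_derivative \<beta> (at t))) has_integral m) {z..d}"
    using chain_arc.IH[OF z(2)] by blast
  define \<gamma> where "\<gamma> t = (if t \<le> z then \<alpha> t else \<beta> t)" for t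
  have \<gamma>\<alpha>: "\<gamma> t = \<alpha> t" if "t \<le> z" for t using that by (simp add: \<gamma>_def)
  \<comment> \<open>Both pieces take the value \<open>b\<close> at \<open>z\<close>, so the glued
    curve agrees with \<open>\<beta>\<close> on the closed interval, as smoothness up to the end
    point requires.\<close>
  have \<gamma>\<beta>: "\<gamma> t = \<beta> t" if "z \<le> t" for t using that \<alpha>(4) \<beta>(6) by (auto simp: \<gamma>_def)
  have zs: "z \<le> s i" if "i \<le> N" for i
    using that
  proof (induction i)
    case (Suc i)
    then show ?case using \<beta>(3)[of i] by simp
  qed (simp add: \<beta>(1))
  define r where "r = case_nat c s"
  have "r i < r (Suc i) \<and> smooth_on_interval (r i) (r (Suc i)) \<gamma>" if "i < Suc N" for i
  proof (cases i)
    case 0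
    then show ?thesis using z \<alpha>(1) \<beta>(1) smooth_on_interval_cong[of c z \<gamma> \<alpha>] \<gamma>\<alpha> by (simp add: r_def)
  next
    case (Suc j)
    then have "j < N" using that by simp
    then show ?thesis
      using Suc \<beta>(3,4)[of j] smooth_on_interval_cong[of "s j" "s (Suc j)" \<gamma> \<beta>] \<gamma>\<beta> zs[of j] by (simp add: r_def)
  qed
  moreover have "((\<lambda>t. hs_norm (vector_derivative \<gamma> (at t))) has_integral l + m) {c..d}"
  proof (rule has_integral_combine)
    show "((\<lambda>t. hs_norm (vector_derivative \<gamma> (at t))) has_integral l) {c..z}"
      by (rule has_integral_speed_cong[OF \<alpha>(5)]) (simp add: \<gamma>\<alpha>)
    show "((\<lambda>t. hs_norm (vector_derivative \<gamma> (at t))) has_integral m) {z..d}"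
      by (rule has_integral_speed_cong[OF \<beta>(8)]) (simp add: \<gamma>\<beta>)
  qed (use z in auto)
  moreover have "r 0 = c" "r (Suc N) = d" by (simp_all add: r_def \<beta>(2))
  moreover have "\<forall>t. \<gamma> t \<in> SO" "\<gamma> c = a" "\<gamma> d = e" using \<alpha>(2,3) \<beta>(5,7) z by (simp_all add: \<gamma>_def)
  ultimately show ?case using chain_arc.prems
    by (intro exI[of _ \<gamma>] exI[of _ "Suc N"] exI[of _ r]) auto
qed

text \<open>Gives the lower bound that makes the infimum in \<open>SO_dist\<close> meaningful. A
  speed that is not integrable is harmless, since \<open>integral\<close> then returns 0.\<close>

lemma hs_length_set_nonneg:
  "x \<in> {hs_length \<gamma> | \<gamma>. piecewise_smooth_path \<gamma> \<and> path_image \<gamma> \<subseteq> SO \<and> pathstart \<gamma> = a \<and> pathfinish \<gamma> = b}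
    \<Longrightarrow> 0 \<le> x"
  unfolding hs_length_def hs_norm_eq_norm mem_Collect_eq
  by (elim exE conjE) (metis Henstock_Kurzweil_Integration.integral_nonneg not_integrable_integral norm_ge_zero order_refl)

lemma SO_dist_le_chain:
  assumes "chain a b l"
  shows "SO_dist a b \<le> l" "0 \<le> SO_dist a b"
proof -
  let ?S = "{hs_length \<gamma> | \<gamma>. piecewise_smooth_path \<gamma> \<and> path_image \<gamma> \<subseteq> SO \<and> pathstart \<gamma> = a \<and> pathfinish \<gamma> = b}"
  obtain \<gamma> N s where \<gamma>: "s 0 = (0::real)" "s N = 1"
    "\<forall>i<N. s i < s (Suc i) \<and> smooth_on_interval (s i) (s (Suc i)) \<gamma>"
    "\<forall>t. \<gamma> t \<in> SO" "\<gamma> 0 = a" "\<gamma> 1 = b" "((\<lambda>t. hs_norm (vector_derivative \<gamma> (at t))) has_integral l) {0..1}"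
    using chain_path[OF assms, of 0 1] by auto
  then have "l \<in> ?S"
    by (auto simp: piecewise_smooth_path_def path_image_def pathstart_def pathfinish_def hs_length_def
        integral_unique intro!: exI[of _ \<gamma>])
  moreover have "bdd_below ?S" using hs_length_set_nonneg by (rule bdd_belowI)
  ultimately show "SO_dist a b \<le> l" unfolding SO_dist_def by (rule cInf_lower)
  show "0 \<le> SO_dist a b"
    unfolding SO_dist_def using \<open>l \<in> ?S\<close> hs_length_set_nonneg by (intro cInf_greatest) auto
qed

lemma SO_dist_le_chain_dist:
  assumes "a \<in> SO" "b \<in> SO"
  shows "0 \<le> SO_dist a b" "SO_dist a b \<le> chain_dist a b"
proof -
  show "0 \<le> SO_dist a b" using chain_exists[OF assms] SO_dist_le_chain(2) by blast
  show "SO_dist a b \<le> chain_dist a b"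
    unfolding chain_dist_def using chain_exists[OF assms] by (intro cInf_greatest) (auto intro: SO_dist_le_chain)
qed

section \<open>The contraction\<close>

lemma sum_symmetric_pairs:
  fixes f :: "'n::{finite,linorder} \<Rightarrow> 'n \<Rightarrow> real"
  assumes sym: "\<And>i j. f i j = f j i" and diag: "\<And>i. f i i = 0"
  shows "(\<Sum>i\<in>UNIV. \<Sum>j\<in>UNIV. f i j) = 2 * (\<Sum>(i, j)\<in>{(i, j). i < j}. f i j)"
proof -
  let ?U = "{(i, j). i < (j::'n)}" and ?L = "{(i, j). j < (i::'n)}" and ?D = "{(i, j). i = (j::'n)}"
  have "(\<Sum>i\<in>UNIV. \<Sum>j\<in>UNIV. f i j) = (\<Sum>(i, j)\<in>UNIV. f i j)"
    by (simp add: sum.cartesian_product)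
  also have "UNIV = (?U \<union> ?L) \<union> ?D" by auto
  also have "(\<Sum>(i, j)\<in>(?U \<union> ?L) \<union> ?D. f i j)
      = (\<Sum>(i, j)\<in>?U. f i j) + (\<Sum>(i, j)\<in>?L. f i j) + (\<Sum>(i, j)\<in>?D. f i j)"
    by (subst sum.union_disjoint; (subst sum.union_disjoint)?) auto
  also have "(\<Sum>(i, j)\<in>?D. f i j) = 0" by (rule sum.neutral) (auto simp: diag)
  also have "(\<Sum>(i, j)\<in>?L. f i j) = (\<Sum>(i, j)\<in>?U. f i j)"
    by (rule sum.reindex_bij_witness[of _ prod.swap prod.swap]) (auto simp: sym)
  finally show ?thesis by simp
qed

abbreviation pairs :: "('n::{finite,linorder} \<times> 'n) set" where
  "pairs \<equiv> {(i, j). i < j}"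

lemma bounded_linear_transpose: "bounded_linear (transpose :: real^'n^'m \<Rightarrow> real^'m^'n)"
  unfolding linear_linear by (auto intro!: linearI simp: transpose_add transpose_scalar)

lemma transpose_nth: "transpose a $ i $ j = a $ j $ i"
  by (simp add: transpose_def)

text \<open>The linear coefficient of \<open>norm_plane_rot_derivative\<close>. At a = \<gamma>, b =
  \<gamma>' and p = (i, j) it is twice the (j, i) entry of \<gamma>' \<gamma>^T.\<close>

definition drift :: "'n \<times> 'n \<Rightarrow> real^'n^'n \<Rightarrow> real^'n^'n \<Rightarrow> real" where
  "drift p a b = (skew (axis (fst p) 1) (axis (snd p) 1) ** a) \<bullet> b"

text \<open>The velocity of a curve in the group, translated to the identity, is antisymmetric, so the
  coordinates above the diagonal account for half of its squared norm.\<close>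

lemma sum_drift_squares:
  fixes \<gamma> \<gamma>' :: "real \<Rightarrow> real^'n::{finite,linorder}^'n::{finite,linorder}"
  assumes d: "(\<gamma> has_vector_derivative \<gamma>' t) (at t)" and SO: "\<And>t. \<gamma> t \<in> SO"
  shows "(\<Sum>p\<in>pairs. (drift p (\<gamma> t) (\<gamma>' t))\<^sup>2) = 2 * (norm (\<gamma>' t))\<^sup>2"
proof -
  note o = SO_D(1)[OF SO[of t]]
  define A where "A = \<gamma>' t ** transpose (\<gamma> t)"
  from bounded_bilinear.has_vector_derivative[OF bounded_bilinear_matrix_mult d
      bounded_linear.has_vector_derivative[OF bounded_linear_transpose d]]
  have "((\<lambda>t. \<gamma> t ** transpose (\<gamma> t)) has_vector_derivative \<gamma> t ** transpose (\<gamma>' t) + A) (at t)"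
    by (simp add: A_def)
  \<comment> \<open>The product \<gamma> \<gamma>^T is constant, so its derivative A^T + A
    vanishes.\<close>
  then have "((\<lambda>t. mat 1) has_vector_derivative \<gamma> t ** transpose (\<gamma>' t) + A) (at t)"
    by (simp only: SO_transpose_mult(2)[OF SO])
  then have "\<gamma> t ** transpose (\<gamma>' t) + A = 0"
    by (rule vector_derivative_unique_at) (rule has_vector_derivative_const)
  moreover have "\<gamma> t ** transpose (\<gamma>' t) = transpose A"
    by (simp add: A_def matrix_transpose_mul)
  ultimately have "transpose A + A = 0" by simp
  then have A: "A $ i $ j = - A $ j $ i" for i j
  proof -
    have "(transpose A + A) $ i $ j = 0" by (simp only: \<open>transpose A + A = 0\<close> zero_index)
    then show ?thesis by (simp only: vector_add_component transpose_nth)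
  qed
  have sq: "(A $ i $ j)\<^sup>2 = (A $ j $ i)\<^sup>2" for i j
    by (simp only: A[of i j] power2_minus)
  have dr: "drift p (\<gamma> t) (\<gamma>' t) = 2 * A $ snd p $ fst p" for p
  proof -
    have "drift p (\<gamma> t) (\<gamma>' t) = A $ snd p $ fst p - A $ fst p $ snd p"
      unfolding drift_def inner_matrix_mult_right[OF o] inner_skew A_def[symmetric]
      by (simp add: matrix_vector_mult_basis column_def inner_axis')
    then show ?thesis using A[of "fst p" "snd p"] by linarith
  qed
  have "(norm (\<gamma>' t))\<^sup>2 = A \<bullet> A"
    unfolding A_def power2_norm_eq_inner using o by (simp add: inner_orthogonal_mult_right)
  also have "\<dots> = (\<Sum>i\<in>UNIV. \<Sum>j\<in>UNIV. (A $ i $ j)\<^sup>2)"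
    by (simp add: inner_vec_def power2_eq_square)
  also have "\<dots> = 2 * (\<Sum>(i, j)\<in>pairs. (A $ i $ j)\<^sup>2)"
  proof (rule sum_symmetric_pairs)
    show "(A $ i $ j)\<^sup>2 = (A $ j $ i)\<^sup>2" for i j by (rule sq)
    show "(A $ i $ i)\<^sup>2 = 0" for i
    proof -
      have "A $ i $ i = 0" using A[of i i] by linarith
      then show ?thesis by simp
    qed
  qed
  also have "(\<Sum>(i, j)\<in>pairs. (A $ i $ j)\<^sup>2) = (\<Sum>p\<in>pairs. (A $ snd p $ fst p)\<^sup>2)"
    by (rule sum.cong[OF refl]) (simp only: split_beta sq)
  \<comment> \<open>Each drift is twice an entry and the pairs carry half of the squared norm: 4
    times 1/2 gives the factor 2.\<close>
  finally show ?thesis by (simp add: dr power_mult_distrib sum_distrib_left[symmetric])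
qed

text \<open>Twisting at the optimal rate leaves the squared speed |\<gamma>'|^2 - \<omega>^2/2 for
  each pair. By \<open>sum_drift_squares\<close> these add up to (N - 1) |\<gamma>'|^2. Minkowski's
  inequality then takes the sum of squares through the time integral.\<close>

lemma smooth_arc_twist:
  fixes a b :: "real^'n::{finite,linorder}^'n::{finite,linorder}"
  assumes "smooth_arc a b l"
  shows "\<exists>\<phi> L. (\<forall>p\<in>pairs. smooth_arc a (rot (fst p) (snd p) (\<phi> p) ** b) (L p)) \<and>
    L2_set L pairs \<le> sqrt (real (CARD('n) choose 2) - 1) * l"
proof -
  obtain \<gamma> \<gamma>' where \<gamma>: "smooth_curve \<gamma>" "\<And>t. (\<gamma> has_vector_derivative \<gamma>' t) (at t)" "\<And>t. \<gamma> t \<in> SO"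
    "\<gamma> 0 = a" "\<gamma> 1 = b" "((\<lambda>t. norm (\<gamma>' t)) has_integral l) {0..1}"
    using assms by (rule smooth_arcE) blast
  have s\<gamma>': "smooth_curve \<gamma>'"
  proof -
    obtain g where g: "\<And>t. (\<gamma> has_vector_derivative g t) (at t)" "smooth_curve g"
      using smooth_curve_derivative[OF \<gamma>(1)] by metis
    have "g = \<gamma>'" using vector_derivative_unique_at[OF g(1) \<gamma>(2)] by auto
    with g(2) show ?thesis by simp
  qed
  define \<omega> where "\<omega> p t = drift p (\<gamma> t) (\<gamma>' t)" for p t
  have s\<omega>: "smooth_curve (\<omega> p)" for p
    unfolding \<omega>_def drift_def
    by (rule smooth_curve_bilinear[OF bounded_bilinear_inner
          smooth_curve_linear[OF bounded_bilinear.bounded_linear_right[OF bounded_bilinear_matrix_mult] \<gamma>(1)] s\<gamma>'])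
  have "\<exists>\<phi>. (\<forall>t. (\<phi> has_vector_derivative - \<omega> p t / 2) (at t)) \<and> \<phi> 0 = 0 \<and> smooth_curve \<phi>" for p
  proof -
    have "smooth_curve (\<lambda>t. - \<omega> p t / 2)"
      using smooth_curve_linear[OF bounded_linear_mult_right[of "- 1 / 2"] s\<omega>[of p]] by simp
    then show ?thesis by (rule smooth_curve_antiderivative) blast
  qed
  then obtain \<phi> where \<phi>: "\<And>p t. (\<phi> p has_vector_derivative - \<omega> p t / 2) (at t)" "\<And>p. \<phi> p 0 = 0"
    "\<And>p. smooth_curve (\<phi> p)" by metis
  define w where "w p t = sqrt ((norm (\<gamma>' t))\<^sup>2 - (\<omega> p t)\<^sup>2 / 2)" for p t
  \<comment> \<open>Collects the speeds of all twisted curves in one Euclidean vector, padded with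
    zeros off the pairs. Minkowski's integral inequality becomes the bound of the norm of an
    integral by the integral of the norm.\<close>
  define v :: "real \<Rightarrow> real^('n \<times> 'n)" where "v t = (\<chi> p. if p \<in> pairs then w p t else 0)" for t
  define L where "L p = integral {0..1} (\<lambda>t. w p t)" for p
  have cont: "continuous_on S (\<lambda>t. w p t)" for S p
    unfolding w_def
    using continuous_on_subset[OF smooth_curve_continuous[OF s\<gamma>']]
      continuous_on_subset[OF smooth_curve_continuous[OF s\<omega>]]
    by (intro continuous_intros) auto
  have contv: "continuous_on S v" for S
    unfolding v_def
  proof (rule continuous_on_vec_lambda)
    show "continuous_on S (\<lambda>t. if p \<in> pairs then w p t else 0)" for p
      by (cases "p \<in> pairs") (simp_all only: if_True if_False cont continuous_on_const)
  qed
  have arc: "smooth_arc a (rot (fst p) (snd p) (\<phi> p 1) ** b) (L p)" if "p \<in> pairs" for p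
  proof -
    let ?u = "axis (fst p) 1 :: real^'n::{finite,linorder}" and ?v = "axis (snd p) 1 :: real^'n::{finite,linorder}"
    have ne: "fst p \<noteq> snd p" using that by auto
    note uv = orthonormal_pair_axis[OF ne]
    define \<Gamma>' where "\<Gamma>' t = plane_rot ?u ?v (\<phi> p t) ** \<gamma>' t
      + plane_rot ?u ?v (\<phi> p t) ** ((- \<omega> p t / 2) *\<^sub>R skew ?u ?v) ** \<gamma> t" for t
    have n: "norm (\<Gamma>' t) = w p t" for t
    proof -
      have "(norm (\<Gamma>' t))\<^sup>2 = (norm (\<gamma>' t))\<^sup>2 - (\<omega> p t)\<^sup>2 / 2"
        unfolding \<Gamma>'_def norm_plane_rot_derivative[OF uv SO_D(1)[OF \<gamma>(3)]]
        by (simp add: \<omega>_def drift_def power2_eq_square)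
      then show ?thesis unfolding w_def by (metis norm_ge_zero real_sqrt_abs abs_of_nonneg)
    qed
    show ?thesis
    proof (rule smooth_arcI)
      show "smooth_curve (\<lambda>t. plane_rot ?u ?v (\<phi> p t) ** \<gamma> t)" by (intro smooth_plane_rot \<phi>(3) \<gamma>(1))
      show "((\<lambda>t. plane_rot ?u ?v (\<phi> p t) ** \<gamma> t) has_vector_derivative \<Gamma>' t) (at t)" for t
        unfolding \<Gamma>'_def by (rule has_vector_derivative_plane_rot_mult[OF uv \<phi>(1) \<gamma>(2)])
      show "plane_rot ?u ?v (\<phi> p t) ** \<gamma> t \<in> SO" for t by (intro SO_mult plane_rot_in_SO uv \<gamma>(3))
      show "plane_rot ?u ?v (\<phi> p 0) ** \<gamma> 0 = a" by (simp add: \<phi>(2) plane_rot_0 \<gamma>(4))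
      show "plane_rot ?u ?v (\<phi> p 1) ** \<gamma> 1 = rot (fst p) (snd p) (\<phi> p 1) ** b"
        by (simp add: rot_eq_plane_rot[OF ne] \<gamma>(5))
      show "((\<lambda>t. norm (\<Gamma>' t)) has_integral L p) {0..1}"
        unfolding n L_def by (intro integrable_integral integrable_continuous_real cont)
    qed
  qed
  have "L2_set L pairs \<le> sqrt (real (CARD('n) choose 2) - 1) * l"
  proof -
    have iv: "v integrable_on {0..1}" by (intro integrable_continuous_real contv)
    have comp: "integral {0..1} v $ p = L p" if "p \<in> pairs" for p
    proof -
      have "integral {0..1} v $ p = integral {0..1} (\<lambda>t. v t $ p)"
        using integral_component_eq_cart iv by metis
      also have "\<dots> = L p" using that by (simp add: v_def L_def)
      finally show ?thesis .
    qed
    have "L2_set L pairs = L2_set (\<lambda>p. norm (integral {0..1} v $ p)) pairs"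
      unfolding L2_set_def by (intro arg_cong[of _ _ sqrt] sum.cong) (auto simp: comp)
    also have "\<dots> \<le> norm (integral {0..1} v)"
      unfolding norm_vec_def L2_set_def by (intro real_sqrt_le_mono sum_mono2) auto
    also have "\<dots> \<le> integral {0..1} (\<lambda>t. sqrt (real (CARD('n) choose 2) - 1) * norm (\<gamma>' t))"
    proof (rule integral_norm_bound_integral[OF iv])
      show "(\<lambda>t. sqrt (real (CARD('n) choose 2) - 1) * norm (\<gamma>' t)) integrable_on {0..1}"
        using \<gamma>(6) by (intro integrable_on_mult_right) (auto simp: integrable_on_def)
      fix t
      \<comment> \<open>One squared drift is at most the sum of all, which is 2 |\<gamma>'|^2. The
        radicand is therefore nonnegative and squaring the \<open>sqrt\<close> in \<open>w\<close>
        really undoes it.\<close>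
      have nn: "0 \<le> (norm (\<gamma>' t))\<^sup>2 - (\<omega> p t)\<^sup>2 / 2" if "p \<in> pairs" for p
      proof -
        have "(\<omega> p t)\<^sup>2 \<le> (\<Sum>p\<in>pairs. (\<omega> p t)\<^sup>2)"
          using that by (intro member_le_sum) auto
        then show ?thesis using sum_drift_squares[of \<gamma> \<gamma>', OF \<gamma>(2,3)] by (simp add: \<omega>_def)
      qed
      have "(norm (v t))\<^sup>2 = (\<Sum>p\<in>UNIV. (if p \<in> pairs then (norm (\<gamma>' t))\<^sup>2 - (\<omega> p t)\<^sup>2 / 2 else 0))"
      proof -
        have "(norm (v t))\<^sup>2 = (\<Sum>p\<in>UNIV. (v t $ p)\<^sup>2)"
          unfolding power2_norm_eq_inner inner_vec_def by (simp add: power2_eq_square)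
        also have "\<dots> = (\<Sum>p\<in>UNIV. (if p \<in> pairs then (norm (\<gamma>' t))\<^sup>2 - (\<omega> p t)\<^sup>2 / 2 else 0))"
          by (intro sum.cong refl) (use nn in \<open>simp add: v_def w_def\<close>)
        finally show ?thesis .
      qed
      also have "\<dots> = (\<Sum>p\<in>pairs. (norm (\<gamma>' t))\<^sup>2 - (\<omega> p t)\<^sup>2 / 2)"
        by (subst sum.If_cases) auto
      also have "\<dots> = real (card (pairs :: ('n \<times> 'n) set)) * (norm (\<gamma>' t))\<^sup>2 - (norm (\<gamma>' t))\<^sup>2"
        using sum_drift_squares[of \<gamma> \<gamma>', OF \<gamma>(2,3)]
        by (simp add: sum_subtractf sum_divide_distrib[symmetric] \<omega>_def)
      also have "\<dots> = (real (CARD('n) choose 2) - 1) * (norm (\<gamma>' t))\<^sup>2"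
        by (simp add: card_less_pairs algebra_simps)
      finally have "norm (v t) = sqrt ((real (CARD('n) choose 2) - 1) * (norm (\<gamma>' t))\<^sup>2)"
        by (metis norm_ge_zero real_sqrt_abs abs_of_nonneg)
      then show "norm (v t) \<le> sqrt (real (CARD('n) choose 2) - 1) * norm (\<gamma>' t)"
        by (simp add: real_sqrt_mult)
    qed
    also have "\<dots> = sqrt (real (CARD('n) choose 2) - 1) * l"
      using \<gamma>(6) by (simp add: integral_unique)
    finally show ?thesis .
  qed
  with arc show ?thesis by (intro exI[of _ "\<lambda>p. \<phi> p 1"] exI[of _ L]) simp
qed

text \<open>After the first arc has been twisted, the rest of the chain starts at a rotated point;
  left translation moves it there at no cost, and rotations of the same plane add their angles. The
  bounds add by the triangle inequality for \<open>L2_set\<close>.\<close>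

lemma chain_twist:
  fixes a b :: "real^'n::{finite,linorder}^'n::{finite,linorder}"
  assumes "chain a b l" and n: "CARD('n) \<ge> 2"
  shows "\<exists>\<phi> L. (\<forall>p\<in>pairs. chain a (rot (fst p) (snd p) (\<phi> p) ** b) (L p)) \<and>
    L2_set L pairs \<le> sqrt (real (CARD('n) choose 2) - 1) * l"
  using assms(1)
proof (induction rule: chain.induct)
  case (chain_refl a)
  show ?case
    by (intro exI[of _ "\<lambda>p. 0"]) (auto simp: rot_0 L2_set_def intro: chain.chain_refl chain_refl)
next
  case (chain_arc a b l c m)
  obtain \<phi> L where 1: "\<And>p. p \<in> pairs \<Longrightarrow> smooth_arc a (rot (fst p) (snd p) (\<phi> p) ** b) (L p)"
    "L2_set L pairs \<le> sqrt (real (CARD('n) choose 2) - 1) * l"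
    using smooth_arc_twist[OF chain_arc.hyps(1)] by blast
  obtain \<psi> M where 2: "\<And>p. p \<in> pairs \<Longrightarrow> chain b (rot (fst p) (snd p) (\<psi> p) ** c) (M p)"
    "L2_set M pairs \<le> sqrt (real (CARD('n) choose 2) - 1) * m"
    using chain_arc.IH by blast
  have "chain a (rot (fst p) (snd p) (\<phi> p + \<psi> p) ** c) (L p + M p)" if "p \<in> pairs" for p
  proof -
    have ne: "fst p \<noteq> snd p" using that by auto
    from chain.chain_arc[OF 1(1)[OF that] chain_mult_left[OF 2(1)[OF that] rot_in_SO[OF ne, of "\<phi> p"]]]
    show ?thesis by (simp add: matrix_mul_assoc rot_mult[OF ne])
  qed
  moreover have "L2_set (\<lambda>p. L p + M p) pairs \<le> sqrt (real (CARD('n) choose 2) - 1) * (l + m)"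
    using L2_set_triangle_ineq[of L M pairs] 1(2) 2(2) by (simp add: algebra_simps)
  ultimately show ?case by (intro exI[of _ "\<lambda>p. \<phi> p + \<psi> p"] exI[of _ "\<lambda>p. L p + M p"]) auto
qed

section \<open>Measurable choice of the angle shifts\<close>

lemma chain_dist_lipschitz:
  assumes "x \<in> SO" "y \<in> SO" "x' \<in> SO" "y' \<in> SO"
  shows "chain_dist x y \<le> chain_dist x' y' + pi / 2 * (norm (x - x') + norm (y - y'))"
proof -
  have "chain_dist x y \<le> chain_dist x x' + (chain_dist x' y' + chain_dist y' y)"
    using chain_dist_triangle[of x x' y] chain_dist_triangle[of x' y' y] assms by linarith
  also have "\<dots> \<le> pi / 2 * norm (x - x') + (chain_dist x' y' + pi / 2 * norm (y - y'))"
    using chain_dist_le_norm[of x x'] chain_dist_le_norm[of y' y] assms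
    by (intro add_mono) (simp_all add: norm_minus_commute)
  finally show ?thesis by (simp add: algebra_simps)
qed

lemma continuous_chain_dist:
  "continuous_on (SO \<times> SO) (\<lambda>p :: (real^'n^'n) \<times> (real^'n^'n). chain_dist (fst p) (snd p))"
  unfolding continuous_on_iff
proof (intro ballI allI impI)
  fix p :: "(real^'n^'n) \<times> (real^'n^'n)" and e :: real
  assume p: "p \<in> SO \<times> SO" and e: "0 < e"
  show "\<exists>d>0. \<forall>q\<in>SO \<times> SO. dist q p < d \<longrightarrow> dist (chain_dist (fst q) (snd q)) (chain_dist (fst p) (snd p)) < e"
  \<comment> \<open>Each of the two coordinates contributes at most \<pi>/2 times e/(2 \<pi>), that
    is e/4.\<close>
  proof (intro exI[of _ "e / (2 * pi)"] conjI ballI impI)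
    fix q :: "(real^'n^'n) \<times> (real^'n^'n)"
    assume q: "q \<in> SO \<times> SO" "dist q p < e / (2 * pi)"
    have "norm (fst q - fst p) < e / (2 * pi)" "norm (snd q - snd p) < e / (2 * pi)"
      using q(2) dist_fst_le[of q p] dist_snd_le[of q p] by (simp_all add: dist_norm)
    then have "pi / 2 * (norm (fst q - fst p) + norm (snd q - snd p)) < pi / 2 * (2 * (e / (2 * pi)))"
      by (intro mult_strict_left_mono) auto
    also have "\<dots> = e / 2" by simp
    finally have b: "pi / 2 * (norm (fst q - fst p) + norm (snd q - snd p)) < e" using e by simp
    have SO: "fst p \<in> SO" "snd p \<in> SO" "fst q \<in> SO" "snd q \<in> SO" using p q(1) by auto
    from b chain_dist_lipschitz[OF SO] chain_dist_lipschitz[OF SO(3,4,1,2)]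
    show "dist (chain_dist (fst q) (snd q)) (chain_dist (fst p) (snd p)) < e"
      by (simp add: dist_real_def norm_minus_commute)
  qed (use e in simp)
qed

lemma measurable_SO_borel_imp_borel: "f \<in> M \<rightarrow>\<^sub>M SO_borel \<Longrightarrow> f \<in> M \<rightarrow>\<^sub>M borel"
  unfolding SO_borel_def by (rule measurable_restrict_space2_iff[THEN iffD1, THEN conjunct1])

lemma borel_measurable_chain_dist:
  "(\<lambda>p. chain_dist (fst p) (snd p)) \<in> borel_measurable (SO_borel \<Otimes>\<^sub>M SO_borel)"
proof -
  have "(\<lambda>p. (fst p, snd p)) \<in> SO_borel \<Otimes>\<^sub>M SO_borel \<rightarrow>\<^sub>M borel \<Otimes>\<^sub>M borel"
    by (intro measurable_Pair measurable_SO_borel_imp_borel measurable_fst measurable_snd)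
  then have "(\<lambda>p :: (real^'n^'n) \<times> (real^'n^'n). p) \<in> SO_borel \<Otimes>\<^sub>M SO_borel \<rightarrow>\<^sub>M restrict_space borel (SO \<times> SO)"
    by (intro measurable_restrict_space2) (auto simp: space_pair_measure borel_prod)
  from measurable_compose[OF this borel_measurable_continuous_on_restrict[OF continuous_chain_dist]]
  show ?thesis .
qed

text \<open>The factor for the squared distance in one step, hence the 2 in the exponent.\<close>

definition contraction_rate :: "'n::{finite,linorder} itself \<Rightarrow> real" where
  "contraction_rate _ = exp (- 2 / (real CARD('n))\<^sup>2)"

text \<open>With N = n(n-1)/2, 1/N is strictly larger than 2/n^2, and 1 - x \<le> exp(-x). The
  strictness is what later pays for approximate chains and rational angles.\<close>

lemma choose_2_bound:
  assumes "n \<ge> 2"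
  shows "real (n choose 2) - 1 < real (n choose 2) * exp (- 2 / (real n)\<^sup>2)"
proof -
  have eq: "real (n choose 2) = real n * (real n - 1) / 2"
    using assms by (simp add: choose_two real_of_nat_div of_nat_diff)
  have n: "real n \<ge> 2" using assms by simp
  then have pos: "0 < real (n choose 2)" unfolding eq by simp
  have "real n * (real n - 1) < (real n)\<^sup>2" using n by (simp add: power2_eq_square)
  then have "2 / (real n)\<^sup>2 < 1 / real (n choose 2)"
    unfolding eq using n by (simp add: frac_less2 power2_eq_square)
  then have "1 - 1 / real (n choose 2) < 1 + (- 2 / (real n)\<^sup>2)" by simp
  also have "\<dots> \<le> exp (- 2 / (real n)\<^sup>2)" by (rule exp_ge_add_one_self)
  finally have "real (n choose 2) * (1 - 1 / real (n choose 2)) < real (n choose 2) * exp (- 2 / (real n)\<^sup>2)"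
    using pos by (intro mult_strict_left_mono)
  then show ?thesis using pos by (simp add: right_diff_distrib)
qed

lemma continuous_rot:
  assumes "i \<noteq> j"
  shows "isCont (rot i j) \<theta>"
proof -
  have "((\<lambda>t. plane_rot (axis i 1) (axis j 1) t) has_vector_derivative
      plane_rot (axis i 1) (axis j 1) \<theta> ** (1 *\<^sub>R skew (axis i 1) (axis j 1))) (at \<theta>)"
    by (rule has_vector_derivative_plane_rot[OF orthonormal_pair_axis[OF assms]]) (rule has_vector_derivative_id)
  then have "isCont (\<lambda>t. plane_rot (axis i 1) (axis j 1) t) \<theta>"
    by (rule has_vector_derivative_continuous)
  then show ?thesis by (simp add: rot_eq_plane_rot[OF assms, abs_def])
qed

text \<open>Right multiplication by \<open>y\<close> preserves norms and \<open>chain_dist\<close>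
  is Lipschitz with constant \<pi>/2, so an error of 2c/\<pi> in the rotation matrix costs at most
  \<open>c\<close>.\<close>

lemma rational_rot:
  assumes "i \<noteq> j" "x \<in> SO" "y \<in> SO" "c > 0"
  shows "\<exists>q :: rat. chain_dist x (rot i j (of_rat q) ** y) \<le> chain_dist x (rot i j \<theta> ** y) + c"
proof -
  obtain d where d: "d > 0" "\<And>t. dist t \<theta> < d \<Longrightarrow> dist (rot i j t) (rot i j \<theta>) < 2 / pi * c"
    using continuous_rot[OF assms(1), of \<theta>] \<open>c > 0\<close>
    by (auto simp: continuous_at_eps_delta dist_norm real_norm_def)
       (metis divide_pos_pos mult_pos_pos pi_gt_zero zero_less_numeral)
  obtain q where q: "\<theta> < of_rat q" "of_rat q < \<theta> + d"
    using of_rat_dense[of \<theta> "\<theta> + d"] d(1) by auto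
  have "dist (rot i j (of_rat q)) (rot i j \<theta>) < 2 / pi * c"
    using q by (intro d(2)) (simp add: dist_real_def)
  moreover have "rot i j (of_rat q) ** y - rot i j \<theta> ** y = (rot i j (of_rat q) - rot i j \<theta>) ** y"
    by (simp add: bounded_bilinear.diff_left[OF bounded_bilinear_matrix_mult])
  ultimately have "norm (rot i j (of_rat q) ** y - rot i j \<theta> ** y) < 2 / pi * c"
    using norm_orthogonal_mult_right[OF SO_D(1)[OF assms(3)]] by (simp add: dist_norm)
  then have "pi / 2 * norm (rot i j (of_rat q) ** y - rot i j \<theta> ** y) \<le> c"
    by (simp add: field_simps)
  then show ?thesis
    using chain_dist_lipschitz[of x "rot i j (of_rat q) ** y" x "rot i j \<theta> ** y"] assms
    by (intro exI[of _ q]) (simp add: SO_mult rot_in_SO)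
qed

text \<open>The gap (k' - k) D between the proved and the claimed bound is spent twice: on a chain
  that is only nearly minimal and on rounding the angles. For D = 0 there is no gap, but the angles
  0 already do.\<close>

lemma rational_twist:
  fixes x y :: "real^'n::{finite,linorder}^'n::{finite,linorder}"
  assumes n: "CARD('n) \<ge> 2" and x: "x \<in> SO" and y: "y \<in> SO"
  shows "\<exists>q :: 'n \<times> 'n \<Rightarrow> rat. (\<Sum>p\<in>pairs. (chain_dist x (rot (fst p) (snd p) (of_rat (q p)) ** y))\<^sup>2)
    \<le> real (CARD('n) choose 2) * contraction_rate TYPE('n) * (chain_dist x y)\<^sup>2"
proof (cases "chain_dist x y = 0")
  case True
  then show ?thesis by (intro exI[of _ "\<lambda>_. 0"]) (simp add: rot_0 split_beta)
next
  case False
  let ?N = "real (CARD('n) choose 2)" and ?D = "chain_dist x y"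
  define k where "k = sqrt (?N - 1)"
  define k' where "k' = sqrt (?N * contraction_rate TYPE('n))"
  have D: "?D > 0" using False chain_dist_nonneg[OF x y] by simp
  have N: "?N \<ge> 1" using n by (simp add: Suc_le_eq zero_less_binomial)
  have kk: "0 \<le> k" "k < k'"
    using N choose_2_bound[OF n] by (auto simp: k_def k'_def contraction_rate_def)
  \<comment> \<open>Chosen so that (k + 1) \<delta> uses exactly the gap and k \<delta> stays
    strictly below it. The \<open>k + 1\<close> also keeps the denominator positive when n = 2,
    where k = 0.\<close>
  define \<delta> where "\<delta> = (k' - k) * ?D / (k + 1)"
  have \<delta>: "\<delta> > 0" using kk D by (simp add: \<delta>_def)
  obtain l where l: "chain x y l" "l < ?D + \<delta>"
    using chain_dist_approx[OF x y, of "?D + \<delta>"] \<delta> by auto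
  obtain \<phi> L where \<phi>: "\<And>p. p \<in> pairs \<Longrightarrow> chain x (rot (fst p) (snd p) (\<phi> p) ** y) (L p)"
    "L2_set L pairs \<le> k * l"
    using chain_twist[OF l(1) n] unfolding k_def by blast
  have "k * l \<le> k * (?D + \<delta>)" using kk l(2) by (intro mult_left_mono) auto
  also have "k * \<delta> < (k + 1) * \<delta>" using \<delta> by simp
  then have "k * (?D + \<delta>) < k * ?D + (k + 1) * \<delta>" by (simp add: distrib_left)
  also have "(k + 1) * \<delta> = (k' - k) * ?D" using kk by (simp add: \<delta>_def)
  finally have e: "L2_set L pairs < k' * ?D" using \<phi>(2) by (simp add: algebra_simps)
  \<comment> \<open>A constant \<open>c\<close> over the N pairs has \<open>L2_set\<close> norm c
    sqrt N, so this is the whole remaining gap spread evenly.\<close>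
  define c where "c = (k' * ?D - L2_set L pairs) / sqrt ?N"
  have "0 < sqrt ?N" using n by simp
  with e have c: "c > 0" unfolding c_def by (intro divide_pos_pos) simp_all
  have "\<exists>q :: rat. chain_dist x (rot (fst p) (snd p) (of_rat q) ** y) \<le> L p + c" if p: "p \<in> pairs" for p
  proof -
    have "fst p \<noteq> snd p" using p by auto
    from rational_rot[OF this x y c, of "\<phi> p"] show ?thesis
      using chain_dist_le[OF \<phi>(1)[OF p]] by (meson add_mono order_refl order_trans)
  qed
  then obtain q :: "'n \<times> 'n \<Rightarrow> rat" where
    q: "\<And>p. p \<in> pairs \<Longrightarrow> chain_dist x (rot (fst p) (snd p) (of_rat (q p)) ** y) \<le> L p + c"
    by metis
  let ?f = "\<lambda>p. chain_dist x (rot (fst p) (snd p) (of_rat (q p)) ** y)"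
  have "L2_set ?f pairs \<le> L2_set (\<lambda>p. L p + c) pairs"
    by (rule L2_set_mono[OF q]) (auto intro!: chain_dist_nonneg SO_mult rot_in_SO x y)
  also have "\<dots> \<le> L2_set L pairs + L2_set (\<lambda>p. c) (pairs :: ('n \<times> 'n) set)"
    by (rule L2_set_triangle_ineq)
  also have "\<dots> = k' * ?D"
    using c n by (simp add: L2_set_constant card_less_pairs) (simp add: c_def)
  finally have "(L2_set ?f pairs)\<^sup>2 \<le> (k' * ?D)\<^sup>2" by (intro power_mono) auto
  also have "(k' * ?D)\<^sup>2 = ?N * contraction_rate TYPE('n) * ?D\<^sup>2"
    by (simp add: k'_def power_mult_distrib contraction_rate_def)
  also have "(L2_set ?f pairs)\<^sup>2 = (\<Sum>p\<in>pairs. (?f p)\<^sup>2)"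
    by (simp add: L2_set_def sum_nonneg)
  finally show ?thesis by (rule exI[of _ q])
qed

lemma measurable_rot_mult_const:
  assumes "i \<noteq> j"
  shows "(\<lambda>x. rot i j \<theta> ** x) \<in> SO_borel \<rightarrow>\<^sub>M SO_borel"
proof -
  have "(\<lambda>x. (x, \<theta>)) \<in> SO_borel \<rightarrow>\<^sub>M SO_borel \<Otimes>\<^sub>M lborel" by (rule measurable_Pair2') simp
  from measurable_compose[OF this measurable_rot_mult[OF assms]] show ?thesis by simp
qed

text \<open>The families of rational angles indexed by pairs form a countable type. Each family
  satisfies the inequality on a measurable set, and the least index of a family that does so is
  measurable in the two points.\<close>

lemma measurable_twist:
  assumes n: "CARD('n::{finite,linorder}) \<ge> 2"
  obtains \<Phi> :: "(real^'n::{finite,linorder}^'n::{finite,linorder}) \<times> (real^'n::{finite,linorder}^'n::{finite,linorder}) \<Rightarrow> 'n \<times> 'n \<Rightarrow> real"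
  where "\<And>p. (\<lambda>z. \<Phi> z p) \<in> borel_measurable (SO_borel \<Otimes>\<^sub>M SO_borel)"
    "\<And>x y. x \<in> SO \<Longrightarrow> y \<in> SO \<Longrightarrow>
      (\<Sum>p\<in>pairs. (chain_dist x (rot (fst p) (snd p) (\<Phi> (x, y) p) ** y))\<^sup>2)
      \<le> real (CARD('n) choose 2) * contraction_rate TYPE('n) * (chain_dist x y)\<^sup>2"
proof -
  let ?M = "SO_borel \<Otimes>\<^sub>M SO_borel :: ((real^'n::{finite,linorder}^'n::{finite,linorder}) \<times> (real^'n::{finite,linorder}^'n::{finite,linorder})) measure"
  define Q where "Q k p = (of_rat ((from_nat k :: 'n \<times> 'n \<Rightarrow> rat) p) :: real)" for k p
  define P where "P k z \<longleftrightarrow> (\<Sum>p\<in>pairs. (chain_dist (fst z) (rot (fst p) (snd p) (Q k p) ** snd z))\<^sup>2)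
      \<le> real (CARD('n) choose 2) * contraction_rate TYPE('n) * (chain_dist (fst z) (snd z))\<^sup>2"
    for k and z :: "(real^'n::{finite,linorder}^'n::{finite,linorder}) \<times> (real^'n::{finite,linorder}^'n::{finite,linorder})"
  define K where "K z = (LEAST k. P k z)" for z
  have f: "(\<lambda>z. chain_dist (fst z) (rot (fst p) (snd p) (Q k p) ** snd z)) \<in> borel_measurable ?M"
    if "p \<in> pairs" for k and p :: "'n \<times> 'n"
  proof -
    have "fst p \<noteq> snd p" using that by auto
    then have "(\<lambda>z. (fst z, rot (fst p) (snd p) (Q k p) ** snd z)) \<in> ?M \<rightarrow>\<^sub>M ?M"
      by (intro measurable_Pair measurable_fst measurable_compose[OF measurable_snd measurable_rot_mult_const])
    from measurable_compose[OF this borel_measurable_chain_dist] show ?thesis by simp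
  qed
  have "Measurable.pred ?M (P k)" for k
  proof -
    have [measurable]: "(\<lambda>z. \<Sum>p\<in>pairs. (chain_dist (fst z) (rot (fst p) (snd p) (Q k p) ** snd z))\<^sup>2)
        \<in> borel_measurable ?M"
      by (intro borel_measurable_sum borel_measurable_power f)
    note [measurable] = borel_measurable_chain_dist
    show ?thesis unfolding P_def by measurable
  qed
  then have K: "K \<in> ?M \<rightarrow>\<^sub>M count_space UNIV" unfolding K_def by (rule measurable_Least)
  have PK: "P (K (x, y)) (x, y)" if xy: "x \<in> SO" "y \<in> SO" for x y
  proof -
    obtain q :: "'n \<times> 'n \<Rightarrow> rat" where q: "(\<Sum>p\<in>pairs. (chain_dist x (rot (fst p) (snd p) (of_rat (q p)) ** y))\<^sup>2)
    \<le> real (CARD('n) choose 2) * contraction_rate TYPE('n) * (chain_dist x y)\<^sup>2"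
      using rational_twist[OF n xy] by blast
    have "P (to_nat q) (x, y)" unfolding P_def Q_def using q by simp
    then show ?thesis unfolding K_def by (rule LeastI)
  qed
  show ?thesis
  proof (rule that[of "\<lambda>z p. Q (K z) p"])
    show "(\<lambda>z. Q (K z) p) \<in> borel_measurable ?M" for p
      by (rule measurable_compose[OF K]) simp
  qed (use PK in \<open>simp add: P_def\<close>)
qed

section \<open>The coupled step\<close>

text \<open>Periodicity reduces the shift to r in [0, 2 \<pi>). The shifted interval is cut at 2
  \<pi> and the part beyond is moved back by one period.\<close>

lemma nn_integral_periodic_shift:
  fixes f :: "real \<Rightarrow> ennreal"
  assumes f[measurable]: "f \<in> borel_measurable borel"
    and per: "\<And>\<theta> k::int. f (\<theta> + 2 * pi * of_int k) = f \<theta>"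
  shows "(\<integral>\<^sup>+\<theta>\<in>{0..2 * pi}. f (\<theta> + \<phi>) \<partial>lborel) = (\<integral>\<^sup>+\<theta>\<in>{0..2 * pi}. f \<theta> \<partial>lborel)"
proof -
  define k where "k = \<lfloor>\<phi> / (2 * pi)\<rfloor>"
  define r where "r = \<phi> - 2 * pi * of_int k"
  have "of_int k \<le> \<phi> / (2 * pi)" "\<phi> / (2 * pi) < of_int k + 1" by (simp_all add: k_def)
  then have r: "0 \<le> r" "r < 2 * pi" by (simp_all add: r_def field_simps)
  have shift: "(\<integral>\<^sup>+\<theta>. g \<theta> \<partial>lborel) = (\<integral>\<^sup>+\<theta>. g (\<theta> + c) \<partial>lborel)"
    if "g \<in> borel_measurable borel" for g :: "real \<Rightarrow> ennreal" and c
    using nn_integral_real_affine[OF that, of 1 c] by (simp add: add.commute)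
  \<comment> \<open>Half-open intervals differ from closed ones by a null set and tile exactly, so
    the pieces can be split and rejoined.\<close>
  have ae: "(\<integral>\<^sup>+\<theta>\<in>{a..b}. g \<theta> \<partial>lborel) = (\<integral>\<^sup>+\<theta>. g \<theta> * indicator {a..<b} \<theta> \<partial>lborel)"
    for g :: "real \<Rightarrow> ennreal" and a b
    by (intro nn_integral_cong_AE eventually_mono[OF AE_lborel_singleton[of b]]) (auto simp: indicator_def)
  have fr: "f (\<theta> + \<phi>) = f (\<theta> + r)" for \<theta>
    using per[of "\<theta> + r" k] by (simp add: r_def add.assoc)
  have "(\<integral>\<^sup>+\<theta>\<in>{0..2 * pi}. f (\<theta> + \<phi>) \<partial>lborel) = (\<integral>\<^sup>+\<theta>. f (\<theta> + r) * indicator {0..<2 * pi} \<theta> \<partial>lborel)"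
    unfolding ae fr ..
  also have "\<dots> = (\<integral>\<^sup>+\<theta>. f \<theta> * indicator {r..<2 * pi + r} \<theta> \<partial>lborel)"
    by (subst (2) shift[of _ r]) (auto intro!: nn_integral_cong simp: indicator_def)
  also have "\<dots> = (\<integral>\<^sup>+\<theta>. f \<theta> * indicator {r..<2 * pi} \<theta> + f \<theta> * indicator {2 * pi..<2 * pi + r} \<theta> \<partial>lborel)"
    using r by (intro nn_integral_cong) (auto simp: indicator_def)
  also have "\<dots> = (\<integral>\<^sup>+\<theta>. f \<theta> * indicator {r..<2 * pi} \<theta> \<partial>lborel)
      + (\<integral>\<^sup>+\<theta>. f \<theta> * indicator {2 * pi..<2 * pi + r} \<theta> \<partial>lborel)"
    by (rule nn_integral_add) auto
  also have "(\<integral>\<^sup>+\<theta>. f \<theta> * indicator {2 * pi..<2 * pi + r} \<theta> \<partial>lborel)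
      = (\<integral>\<^sup>+\<theta>. f (\<theta> + 2 * pi) * indicator {2 * pi..<2 * pi + r} (\<theta> + 2 * pi) \<partial>lborel)"
    by (rule shift) simp
  also have "\<dots> = (\<integral>\<^sup>+\<theta>. f \<theta> * indicator {0..<r} \<theta> \<partial>lborel)"
    using per[of _ 1] by (intro nn_integral_cong) (auto simp: indicator_def)
  also have "(\<integral>\<^sup>+\<theta>. f \<theta> * indicator {r..<2 * pi} \<theta> \<partial>lborel) + (\<integral>\<^sup>+\<theta>. f \<theta> * indicator {0..<r} \<theta> \<partial>lborel)
      = (\<integral>\<^sup>+\<theta>. f \<theta> * indicator {r..<2 * pi} \<theta> + f \<theta> * indicator {0..<r} \<theta> \<partial>lborel)"
    by (rule nn_integral_add[symmetric]) auto
  also have "\<dots> = (\<integral>\<^sup>+\<theta>. f \<theta> * indicator {0..<2 * pi} \<theta> \<partial>lborel)"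
    using r by (intro nn_integral_cong) (auto simp: indicator_def)
  also have "\<dots> = (\<integral>\<^sup>+\<theta>\<in>{0..2 * pi}. f \<theta> \<partial>lborel)" unfolding ae ..
  finally show ?thesis .
qed

text \<open>The average behind \<open>kac_kernel\<close>, taken of arbitrary functions of pair and
  angle so that it serves costs as well as indicators of events.\<close>

definition kac_average :: "('n::{finite,linorder} \<times> 'n \<Rightarrow> real \<Rightarrow> ennreal) \<Rightarrow> ennreal" where
  "kac_average h = ennreal (1 / (2 * pi * real (CARD('n) choose 2))) *
     (\<Sum>p\<in>pairs. \<integral>\<^sup>+\<theta>\<in>{0..2 * pi}. h p \<theta> \<partial>lborel)"

lemma kac_average_cong:
  assumes "\<And>p \<theta>. p \<in> pairs \<Longrightarrow> g p \<theta> = h p \<theta>"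
  shows "kac_average g = kac_average h"
  unfolding kac_average_def using assms by (intro arg_cong2[where f = "(*)"] sum.cong nn_integral_cong) auto

text \<open>The randomness of one step as a probability space, so that the coupling can be a
  push-forward and Fubini's theorem applies.\<close>

definition angle_space :: "(('n::{finite,linorder} \<times> 'n) \<times> real) measure" where
  "angle_space = measure_pmf (pmf_of_set pairs) \<Otimes>\<^sub>M uniform_measure lborel {0..2 * pi}"

lemma prob_space_uniform_angle: "prob_space (uniform_measure lborel {0..2 * pi})"
  by (rule prob_space_uniform_measure) auto

lemma prob_space_angle_space: "prob_space angle_space"
  unfolding angle_space_def
  by (intro prob_space_pair measure_pmf.prob_space_axioms prob_space_uniform_angle)

lemma pairs_nonempty:
  assumes "CARD('n::{finite,linorder}) \<ge> 2"
  shows "(pairs :: ('n \<times> 'n) set) \<noteq> {}"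
proof -
  have "card (pairs :: ('n \<times> 'n) set) > 0" using assms by (simp add: card_less_pairs zero_less_binomial)
  then show ?thesis by (metis card.empty less_irrefl)
qed

text \<open>The uniform densities 1/N on pairs and 1/(2 \<pi>) on angles multiply to the
  normalisation of the kernel. That n is at least 2 makes the set of pairs nonempty, as
  \<open>pmf_of_set\<close> requires.\<close>

lemma nn_integral_angle_space:
  assumes n: "CARD('n::{finite,linorder}) \<ge> 2" and f: "f \<in> borel_measurable angle_space"
  shows "(\<integral>\<^sup>+w. f w \<partial>angle_space) = kac_average (\<lambda>(p :: 'n \<times> 'n) \<theta>. f (p, \<theta>))"
proof -
  interpret U: prob_space "uniform_measure lborel {0..2 * pi}" by (rule prob_space_uniform_angle)
  have f': "(\<lambda>\<theta>. f (p, \<theta>)) \<in> borel_measurable lborel" for p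
  proof -
    have "(\<lambda>\<theta>. f (p, \<theta>)) \<in> borel_measurable (uniform_measure lborel {0..2 * pi})"
      using f unfolding angle_space_def by (rule measurable_compose[OF measurable_Pair1', rotated]) simp
    then show ?thesis by simp
  qed
  have "(\<integral>\<^sup>+w. f w \<partial>angle_space)
      = (\<integral>\<^sup>+p. \<integral>\<^sup>+\<theta>. f (p, \<theta>) \<partial>uniform_measure lborel {0..2 * pi} \<partial>measure_pmf (pmf_of_set pairs))"
    unfolding angle_space_def by (rule U.nn_integral_fst[symmetric]) (use f in \<open>simp add: angle_space_def\<close>)
  also have "\<dots> = (\<Sum>p\<in>pairs. \<integral>\<^sup>+\<theta>. f (p, \<theta>) \<partial>uniform_measure lborel {0..2 * pi}) / card (pairs :: ('n \<times> 'n) set)"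
    by (rule nn_integral_pmf_of_set[OF pairs_nonempty[OF n] finite])
  also have "(\<lambda>p. \<integral>\<^sup>+\<theta>. f (p, \<theta>) \<partial>uniform_measure lborel {0..2 * pi})
      = (\<lambda>p. (\<integral>\<^sup>+\<theta>\<in>{0..2 * pi}. f (p, \<theta>) \<partial>lborel) / ennreal (2 * pi))"
  proof
    fix p
    show "(\<integral>\<^sup>+\<theta>. f (p, \<theta>) \<partial>uniform_measure lborel {0..2 * pi})
        = (\<integral>\<^sup>+\<theta>\<in>{0..2 * pi}. f (p, \<theta>) \<partial>lborel) / ennreal (2 * pi)"
      by (subst nn_integral_uniform_measure[OF f'[of p]]) simp_all
  qed
  also have "(\<Sum>p\<in>pairs. (\<integral>\<^sup>+\<theta>\<in>{0..2 * pi}. f (p, \<theta>) \<partial>lborel) / ennreal (2 * pi)) / card (pairs :: ('n \<times> 'n) set)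
      = (\<Sum>p\<in>pairs. \<integral>\<^sup>+\<theta>\<in>{0..2 * pi}. f (p, \<theta>) \<partial>lborel)
        * (ennreal (1 / (2 * pi)) * ennreal (1 / real (CARD('n) choose 2)))"
  proof -
    have c: "(0::real) < real (CARD('n) choose 2)" using n by (simp add: zero_less_binomial)
    have "(0::real) < 2 * pi" by simp
    note inv = inverse_ennreal[OF this, unfolded inverse_eq_divide] inverse_ennreal[OF c, unfolded inverse_eq_divide]
    show ?thesis
      by (simp only: divide_ennreal_def sum_distrib_right[symmetric] card_less_pairs
          ennreal_of_nat_eq_real_of_nat inv mult.assoc)
  qed
  also have "ennreal (1 / (2 * pi)) * ennreal (1 / real (CARD('n) choose 2))
      = ennreal (1 / (2 * pi * real (CARD('n) choose 2)))"
    by (subst ennreal_mult[symmetric]) simp_all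
  finally show ?thesis
    unfolding kac_average_def by (simp only: mult.commute)
qed

text \<open>Off the index pairs \<open>i < j\<close>, \<^const>\<open>rot\<close> need not be a rotation; \<open>pair_rot\<close> is one everywhere.\<close>

definition pair_rot :: "'n::{finite,linorder} \<times> 'n \<Rightarrow> real \<Rightarrow> real^'n::{finite,linorder}^'n::{finite,linorder}" where
  "pair_rot p \<theta> = (if p \<in> pairs then rot (fst p) (snd p) \<theta> else mat 1)"

lemma pair_rot_in_SO: "pair_rot p \<theta> \<in> SO"
  by (auto simp: pair_rot_def SO_mat_1 intro: rot_in_SO)

lemma measurable_pair_rot_mult:
  assumes g: "g \<in> M \<rightarrow>\<^sub>M SO_borel" and t: "t \<in> borel_measurable M"
  shows "(\<lambda>z. pair_rot p (t z) ** g z) \<in> M \<rightarrow>\<^sub>M SO_borel"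
proof (cases "p \<in> pairs")
  case True
  then have ne: "fst p \<noteq> snd p" by auto
  have "(\<lambda>z. (g z, t z)) \<in> M \<rightarrow>\<^sub>M SO_borel \<Otimes>\<^sub>M lborel" using g t by (intro measurable_Pair) simp_all
  from measurable_compose[OF this measurable_rot_mult[OF ne]] True show ?thesis by (simp add: pair_rot_def)
next
  case False
  then have "(\<lambda>z. pair_rot p (t z) ** g z) = g" by (auto simp: pair_rot_def)
  with g show ?thesis by simp
qed

lemma rot_periodic:
  "rot i j (\<theta> + 2 * pi * of_int k) = rot i j \<theta>"
proof -
  have *: "sin (\<theta> + 2 * pi * of_int k) = sin \<theta>" "cos (\<theta> + 2 * pi * of_int k) = cos \<theta>"
    using sin_int_2pin[of k] cos_int_2pin[of k] by (simp_all add: sin_add cos_add)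
  show ?thesis unfolding rot_def * ..
qed

text \<open>Yields the second marginal of the coupling. The shift may depend on the pair, but is
  constant while the angle is integrated.\<close>

lemma kac_average_shift:
  assumes f: "f \<in> borel_measurable SO_borel" and y: "y \<in> SO"
  shows "kac_average (\<lambda>p \<theta>. f (pair_rot p (\<theta> + \<phi> p) ** y)) = kac_average (\<lambda>p \<theta>. f (pair_rot p \<theta> ** y))"
  unfolding kac_average_def
proof (intro arg_cong2[where f = "(*)"] sum.cong refl)
  fix p :: "'a \<times> 'a" assume p: "p \<in> pairs"
  have "(\<lambda>\<theta>. pair_rot p \<theta> ** y) \<in> borel \<rightarrow>\<^sub>M SO_borel"
    using y by (intro measurable_pair_rot_mult) auto
  from measurable_compose[OF this f]
  show "(\<integral>\<^sup>+\<theta>\<in>{0..2 * pi}. f (pair_rot p (\<theta> + \<phi> p) ** y) \<partial>lborel)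
      = (\<integral>\<^sup>+\<theta>\<in>{0..2 * pi}. f (pair_rot p \<theta> ** y) \<partial>lborel)"
    by (rule nn_integral_periodic_shift) (use p in \<open>simp add: pair_rot_def rot_periodic\<close>)
qed

lemma emeasure_kac_kernel_average:
  assumes "x \<in> SO" "S \<in> sets SO_borel"
  shows "emeasure (kac_kernel x) S = kac_average (\<lambda>p \<theta>. indicator S (pair_rot p \<theta> ** x))"
  unfolding emeasure_kac_kernel[OF assms] kac_average_def
  using assms
  by (intro arg_cong2[where f = "(*)"] sum.cong refl) (auto intro!: nn_integral_cong simp: pair_rot_def split_beta)

lemma SO_prob_sets: "SO_prob \<mu> \<Longrightarrow> sets \<mu> = sets SO_borel"
  and SO_prob_space: "SO_prob \<mu> \<Longrightarrow> space \<mu> = SO"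
  and SO_prob_prob: "SO_prob \<mu> \<Longrightarrow> prob_space \<mu>"
  using sets_eq_imp_space_eq[of \<mu> SO_borel] by (auto simp: SO_prob_def)

lemma emeasure_kac_step_average:
  fixes \<mu> :: "(real^'n::{finite,linorder}^'n::{finite,linorder}) measure"
  assumes n: "CARD('n) \<ge> 2" and \<mu>: "SO_prob \<mu>" and S: "S \<in> sets SO_borel"
  shows "emeasure (kac_step \<mu>) S = (\<integral>\<^sup>+x. kac_average (\<lambda>p \<theta>. indicator S (pair_rot p \<theta> ** x)) \<partial>\<mu>)"
  unfolding emeasure_kac_step[OF assms]
  by (intro nn_integral_cong emeasure_kac_kernel_average S) (simp add: SO_prob_space[OF \<mu>])

lemma measurable_fst_snd_angle: "(\<lambda>z. fst (snd z)) \<in> M \<Otimes>\<^sub>M angle_space \<rightarrow>\<^sub>M count_space UNIV"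
  and measurable_snd_snd_angle: "(\<lambda>z. snd (snd z))
    \<in> M \<Otimes>\<^sub>M (angle_space :: (('n::{finite,linorder} \<times> 'n) \<times> real) measure) \<rightarrow>\<^sub>M borel"
proof -
  have "fst \<in> angle_space \<rightarrow>\<^sub>M measure_pmf (pmf_of_set pairs)" unfolding angle_space_def by (rule measurable_fst)
  then show "(\<lambda>z. fst (snd z)) \<in> M \<Otimes>\<^sub>M angle_space \<rightarrow>\<^sub>M count_space UNIV"
    by (intro measurable_compose[OF measurable_snd]) simp
  have "snd \<in> (angle_space :: (('n \<times> 'n) \<times> real) measure) \<rightarrow>\<^sub>M uniform_measure lborel {0..2 * pi}" unfolding angle_space_def by (rule measurable_snd)
  then have "snd \<in> (angle_space :: (('n \<times> 'n) \<times> real) measure) \<rightarrow>\<^sub>M borel"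
    by (simp cong: measurable_cong_sets)
  then show "(\<lambda>z. snd (snd z)) \<in> M \<Otimes>\<^sub>M (angle_space :: (('n \<times> 'n) \<times> real) measure) \<rightarrow>\<^sub>M borel"
    by (rule measurable_compose[OF measurable_snd])
qed

lemma measurable_random_rot_mult:
  assumes "g \<in> M \<rightarrow>\<^sub>M SO_borel" "p \<in> M \<rightarrow>\<^sub>M count_space UNIV" "t \<in> borel_measurable M"
  shows "(\<lambda>z. pair_rot (p z) (t z) ** g z) \<in> M \<rightarrow>\<^sub>M SO_borel"
  using measurable_compose_countable'[OF measurable_pair_rot_mult[OF assms(1,3)] assms(2)]
  by (simp add: countable_finite)

text \<open>After Fubini the point is integrated first; by left invariance that inner integral is
  the Haar measure of \<open>S\<close> whatever the pair and the angle.\<close>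

lemma kac_step_haar:
  fixes \<H> :: "(real^'n::{finite,linorder}^'n::{finite,linorder}) measure"
  assumes n: "CARD('n) \<ge> 2" and H: "SO_haar \<H>"
  shows "kac_step \<H> = \<H>"
proof (rule measure_eqI)
  have P: "SO_prob \<H>" using H by (simp add: SO_haar_def)
  note sH = SO_prob_sets[OF P] and spH = SO_prob_space[OF P]
  interpret H: prob_space \<H> using P by (rule SO_prob_prob)
  interpret A: prob_space "angle_space :: (('n \<times> 'n) \<times> real) measure" by (rule prob_space_angle_space)
  interpret HA: pair_sigma_finite \<H> "angle_space :: (('n \<times> 'n) \<times> real) measure" ..
  show "sets (kac_step \<H>) = sets \<H>"
    using SO_prob_sets[OF SO_prob_kac_step[OF n P]] sH by simp
  fix S assume "S \<in> sets (kac_step \<H>)"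
  then have S: "S \<in> sets SO_borel" using SO_prob_sets[OF SO_prob_kac_step[OF n P]] by simp
  have id: "(\<lambda>x. x) \<in> \<H> \<rightarrow>\<^sub>M SO_borel" using sH by (simp add: measurable_ident_sets)
  let ?r = "\<lambda>z :: (real^'n::{finite,linorder}^'n::{finite,linorder}) \<times> ('n \<times> 'n) \<times> real.
    pair_rot (fst (snd z)) (snd (snd z)) ** fst z"
  have r: "?r \<in> \<H> \<Otimes>\<^sub>M angle_space \<rightarrow>\<^sub>M SO_borel"
    by (intro measurable_random_rot_mult measurable_compose[OF measurable_fst id] measurable_fst_snd_angle
        measurable_snd_snd_angle)
  have f: "(\<lambda>z. indicator S (?r z) :: ennreal) \<in> borel_measurable (\<H> \<Otimes>\<^sub>M angle_space)"
    by (rule measurable_compose[OF r borel_measurable_indicator[OF S]])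
  have inv: "(\<integral>\<^sup>+x. indicator S (pair_rot p \<theta> ** x) \<partial>\<H>) = emeasure \<H> S" for p \<theta>
  proof -
    have m: "(\<lambda>x. pair_rot p \<theta> ** x) \<in> \<H> \<rightarrow>\<^sub>M SO_borel"
      by (rule measurable_pair_rot_mult[OF id]) simp
    have "emeasure \<H> S = emeasure (distr \<H> SO_borel (\<lambda>x. pair_rot p \<theta> ** x)) S"
      using H pair_rot_in_SO[of p \<theta>] by (simp add: SO_haar_def)
    also have "\<dots> = (\<integral>\<^sup>+x. indicator S x \<partial>distr \<H> SO_borel (\<lambda>x. pair_rot p \<theta> ** x))"
      using S by simp
    also have "\<dots> = (\<integral>\<^sup>+x. indicator S (pair_rot p \<theta> ** x) \<partial>\<H>)"
      by (rule nn_integral_distr[OF m]) (use S in simp)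
    finally show ?thesis by simp
  qed
  have "emeasure (kac_step \<H>) S = (\<integral>\<^sup>+x. \<integral>\<^sup>+w. indicator S (?r (x, w)) \<partial>angle_space \<partial>\<H>)"
    unfolding emeasure_kac_step_average[OF n P S]
  proof (rule nn_integral_cong)
    fix x assume x: "x \<in> space \<H>"
    have "(\<lambda>w. indicator S (?r (x, w)) :: ennreal) \<in> borel_measurable angle_space"
      using x by (rule measurable_compose[OF measurable_Pair1' f])
    from nn_integral_angle_space[OF n this]
    show "kac_average (\<lambda>p \<theta>. indicator S (pair_rot p \<theta> ** x)) = (\<integral>\<^sup>+w. indicator S (?r (x, w)) \<partial>angle_space)"
      by simp
  qed
  also have "\<dots> = (\<integral>\<^sup>+w. \<integral>\<^sup>+x. indicator S (?r (x, w)) \<partial>\<H> \<partial>angle_space)"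
    by (rule HA.Fubini'[symmetric]) (use f in \<open>simp add: split_beta'\<close>)
  also have "\<dots> = emeasure \<H> S" by (simp add: inv A.emeasure_space_1)
  finally show "emeasure (kac_step \<H>) S = emeasure \<H> S" .
qed

lemma couplingsD:
  assumes "\<eta> \<in> couplings \<mu> \<nu>" "SO_prob \<mu>" "SO_prob \<nu>"
  shows "prob_space \<eta>" "sets \<eta> = sets (SO_borel \<Otimes>\<^sub>M SO_borel)" "space \<eta> = SO \<times> SO"
    "distr \<eta> \<mu> fst = \<mu>" "distr \<eta> \<nu> snd = \<nu>"
proof -
  have "sets \<eta> = sets (\<mu> \<Otimes>\<^sub>M \<nu>)" using assms(1) by (simp add: couplings_def)
  also have "\<dots> = sets (SO_borel \<Otimes>\<^sub>M SO_borel)"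
    by (rule sets_pair_measure_cong[OF SO_prob_sets[OF assms(2)] SO_prob_sets[OF assms(3)]])
  finally show s: "sets \<eta> = sets (SO_borel \<Otimes>\<^sub>M SO_borel)" .
  show "space \<eta> = SO \<times> SO" using sets_eq_imp_space_eq[OF s] by (simp add: space_pair_measure)
qed (use assms in \<open>auto simp: couplings_def\<close>)

text \<open>The new coupling is the image of \<eta> and an independent pair and angle under
  (\<open>T1\<close>, \<open>T2\<close>), where only \<open>T2\<close> uses the shift selected from
  both current points.\<close>

lemma coupled_step:
  fixes \<mu> \<nu> :: "(real^'n::{finite,linorder}^'n::{finite,linorder}) measure"
  assumes n: "CARD('n) \<ge> 2" and \<mu>: "SO_prob \<mu>" and \<nu>: "SO_prob \<nu>" and \<eta>: "\<eta> \<in> couplings \<mu> \<nu>"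
  shows "\<exists>\<eta>'\<in>couplings (kac_step \<mu>) (kac_step \<nu>).
    (\<integral>\<^sup>+z. ennreal ((chain_dist (fst z) (snd z))\<^sup>2) \<partial>\<eta>')
      \<le> ennreal (contraction_rate TYPE('n)) * (\<integral>\<^sup>+z. ennreal ((chain_dist (fst z) (snd z))\<^sup>2) \<partial>\<eta>)"
proof -
  note c = couplingsD[OF \<eta> \<mu> \<nu>]
  interpret E: prob_space \<eta> by (rule c(1))
  interpret A: prob_space "angle_space :: (('n \<times> 'n) \<times> real) measure" by (rule prob_space_angle_space)
  obtain \<Phi> :: "(real^'n::{finite,linorder}^'n::{finite,linorder}) \<times> (real^'n::{finite,linorder}^'n::{finite,linorder}) \<Rightarrow> 'n \<times> 'n \<Rightarrow> real"
    where \<Phi>m: "\<And>p. (\<lambda>z. \<Phi> z p) \<in> borel_measurable (SO_borel \<Otimes>\<^sub>M SO_borel)"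
    and \<Phi>: "\<And>x y. x \<in> SO \<Longrightarrow> y \<in> SO \<Longrightarrow>
      (\<Sum>p\<in>pairs. (chain_dist x (rot (fst p) (snd p) (\<Phi> (x, y) p) ** y))\<^sup>2)
      \<le> real (CARD('n) choose 2) * contraction_rate TYPE('n) * (chain_dist x y)\<^sup>2"
    using measurable_twist[OF n] by blast
  let ?SS = "SO_borel \<Otimes>\<^sub>M SO_borel :: ((real^'n::{finite,linorder}^'n::{finite,linorder}) \<times> (real^'n::{finite,linorder}^'n::{finite,linorder})) measure"
  let ?O = "\<eta> \<Otimes>\<^sub>M (angle_space :: (('n \<times> 'n) \<times> real) measure)"
  define T1 where "T1 v = pair_rot (fst (snd v)) (snd (snd v)) ** fst (fst v)"
    for v :: "((real^'n::{finite,linorder}^'n::{finite,linorder}) \<times> (real^'n::{finite,linorder}^'n::{finite,linorder})) \<times> ('n \<times> 'n) \<times> real"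
  define T2 where "T2 v = pair_rot (fst (snd v)) (snd (snd v) + \<Phi> (fst v) (fst (snd v))) ** snd (fst v)"
    for v :: "((real^'n::{finite,linorder}^'n::{finite,linorder}) \<times> (real^'n::{finite,linorder}^'n::{finite,linorder})) \<times> ('n \<times> 'n) \<times> real"
  have idE: "(\<lambda>z. z) \<in> \<eta> \<rightarrow>\<^sub>M ?SS" using c(2) by (simp add: measurable_ident_sets)
  have fstE: "(\<lambda>v. fst v) \<in> ?O \<rightarrow>\<^sub>M ?SS" by (rule measurable_compose[OF measurable_fst idE])
  have shift: "(\<lambda>v. snd (snd v) + \<Phi> (fst v) (fst (snd v))) \<in> borel_measurable ?O"
  proof (rule borel_measurable_add[OF measurable_snd_snd_angle])
    show "(\<lambda>v. \<Phi> (fst v) (fst (snd v))) \<in> borel_measurable ?O"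
      by (rule measurable_compose_countable'[OF measurable_compose[OF fstE \<Phi>m] measurable_fst_snd_angle])
        (simp add: countable_finite)
  qed
  have T1: "T1 \<in> ?O \<rightarrow>\<^sub>M SO_borel"
    unfolding T1_def
    by (intro measurable_random_rot_mult measurable_compose[OF fstE measurable_fst] measurable_fst_snd_angle
        measurable_snd_snd_angle)
  have T2: "T2 \<in> ?O \<rightarrow>\<^sub>M SO_borel"
    unfolding T2_def
    by (intro measurable_random_rot_mult measurable_compose[OF fstE measurable_snd] measurable_fst_snd_angle shift)
  have T: "(\<lambda>v. (T1 v, T2 v)) \<in> ?O \<rightarrow>\<^sub>M ?SS" by (rule measurable_Pair[OF T1 T2])
  define \<eta>' where "\<eta>' = distr ?O ?SS (\<lambda>v. (T1 v, T2 v))"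
  \<comment> \<open>One transfer formula for all test functions; the two marginals and the cost are
    its three instances.\<close>
  have int: "(\<integral>\<^sup>+z. f z \<partial>\<eta>') = (\<integral>\<^sup>+z. kac_average (\<lambda>p \<theta>.
      f (pair_rot p \<theta> ** fst z, pair_rot p (\<theta> + \<Phi> z p) ** snd z)) \<partial>\<eta>)"
    if f: "f \<in> borel_measurable ?SS" for f
  proof -
    have m: "(\<lambda>v. f (T1 v, T2 v)) \<in> borel_measurable ?O" by (rule measurable_compose[OF T f])
    have "(\<integral>\<^sup>+z. f z \<partial>\<eta>') = (\<integral>\<^sup>+v. f (T1 v, T2 v) \<partial>?O)"
      unfolding \<eta>'_def by (rule nn_integral_distr[OF T]) (use f in simp)
    also have "\<dots> = (\<integral>\<^sup>+z. \<integral>\<^sup>+w. f (T1 (z, w), T2 (z, w)) \<partial>angle_space \<partial>\<eta>)"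
      by (rule A.nn_integral_fst[symmetric, OF m])
    also have "\<dots> = (\<integral>\<^sup>+z. kac_average (\<lambda>p \<theta>.
      f (pair_rot p \<theta> ** fst z, pair_rot p (\<theta> + \<Phi> z p) ** snd z)) \<partial>\<eta>)"
    proof (rule nn_integral_cong)
      fix z assume "z \<in> space \<eta>"
      from nn_integral_angle_space[OF n measurable_compose[OF measurable_Pair1'[OF this] m]]
      show "(\<integral>\<^sup>+w. f (T1 (z, w), T2 (z, w)) \<partial>angle_space) = kac_average (\<lambda>p \<theta>.
          f (pair_rot p \<theta> ** fst z, pair_rot p (\<theta> + \<Phi> z p) ** snd z))"
        by (simp add: T1_def T2_def)
    qed
    finally show ?thesis .
  qed
  have K: "SO_prob (kac_step \<mu>)" "SO_prob (kac_step \<nu>)" by (intro SO_prob_kac_step n \<mu> \<nu>)+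
  have P': "prob_space \<eta>'"
    unfolding \<eta>'_def by (rule prob_space.prob_space_distr[OF prob_space_pair[OF c(1) prob_space_angle_space] T])
  have s': "sets \<eta>' = sets ?SS" by (simp add: \<eta>'_def)
  have avg_meas: "(\<lambda>x. kac_average (\<lambda>p \<theta>. indicator S (pair_rot p \<theta> ** x))) \<in> borel_measurable SO_borel"
    if S: "S \<in> sets SO_borel" for S :: "(real^'n::{finite,linorder}^'n::{finite,linorder}) set"
  proof -
    have "(\<lambda>x. emeasure (kac_kernel x) S) \<in> borel_measurable SO_borel"
      by (rule measurable_emeasure_kernel[OF measurable_kac_kernel[OF n] S])
    then show ?thesis
      by (rule measurable_cong[THEN iffD1, rotated]) (simp add: emeasure_kac_kernel_average S)
  qed
  have m1: "distr \<eta>' (kac_step \<mu>) fst = kac_step \<mu>"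
  proof (rule measure_eqI)
    fix S assume "S \<in> sets (distr \<eta>' (kac_step \<mu>) fst)"
    then have S: "S \<in> sets SO_borel" using SO_prob_sets[OF K(1)] by simp
    have fm: "fst \<in> \<eta>' \<rightarrow>\<^sub>M kac_step \<mu>"
      unfolding measurable_cong_sets[OF s' SO_prob_sets[OF K(1)]] by (rule measurable_fst)
    have im: "(\<lambda>z. indicator S (fst z) :: ennreal) \<in> borel_measurable ?SS"
      by (rule measurable_compose[OF measurable_fst borel_measurable_indicator[OF S]])
    have "emeasure (distr \<eta>' (kac_step \<mu>) fst) S = (\<integral>\<^sup>+x. indicator S x \<partial>distr \<eta>' (kac_step \<mu>) fst)"
      using S SO_prob_sets[OF K(1)] by simp
    also have "\<dots> = (\<integral>\<^sup>+z. indicator S (fst z) \<partial>\<eta>')"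
      by (rule nn_integral_distr[OF fm]) (use S SO_prob_sets[OF K(1)] in simp)
    also have "\<dots> = (\<integral>\<^sup>+z. kac_average (\<lambda>p \<theta>. indicator S (pair_rot p \<theta> ** fst z)) \<partial>\<eta>)"
      by (subst int[OF im]) simp
    also have "\<dots> = (\<integral>\<^sup>+x. kac_average (\<lambda>p \<theta>. indicator S (pair_rot p \<theta> ** x)) \<partial>distr \<eta> \<mu> fst)"
    proof (rule nn_integral_distr[symmetric])
      show "fst \<in> \<eta> \<rightarrow>\<^sub>M \<mu>"
        unfolding measurable_cong_sets[OF c(2) SO_prob_sets[OF \<mu>]] by (rule measurable_fst)
      show "(\<lambda>x. kac_average (\<lambda>p \<theta>. indicator S (pair_rot p \<theta> ** x))) \<in> borel_measurable (distr \<eta> \<mu> fst)"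
        unfolding c(4) measurable_cong_sets[OF SO_prob_sets[OF \<mu>] refl] by (rule avg_meas[OF S])
    qed
    also have "\<dots> = emeasure (kac_step \<mu>) S" unfolding c(4) emeasure_kac_step_average[OF n \<mu> S] ..
    finally show "emeasure (distr \<eta>' (kac_step \<mu>) fst) S = emeasure (kac_step \<mu>) S" .
  qed simp
  have m2: "distr \<eta>' (kac_step \<nu>) snd = kac_step \<nu>"
  proof (rule measure_eqI)
    fix S assume "S \<in> sets (distr \<eta>' (kac_step \<nu>) snd)"
    then have S: "S \<in> sets SO_borel" using SO_prob_sets[OF K(2)] by simp
    have fm: "snd \<in> \<eta>' \<rightarrow>\<^sub>M kac_step \<nu>"
      unfolding measurable_cong_sets[OF s' SO_prob_sets[OF K(2)]] by (rule measurable_snd)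
    have im: "(\<lambda>z. indicator S (snd z) :: ennreal) \<in> borel_measurable ?SS"
      by (rule measurable_compose[OF measurable_snd borel_measurable_indicator[OF S]])
    have "emeasure (distr \<eta>' (kac_step \<nu>) snd) S = (\<integral>\<^sup>+x. indicator S x \<partial>distr \<eta>' (kac_step \<nu>) snd)"
      using S SO_prob_sets[OF K(2)] by simp
    also have "\<dots> = (\<integral>\<^sup>+z. indicator S (snd z) \<partial>\<eta>')"
      by (rule nn_integral_distr[OF fm]) (use S SO_prob_sets[OF K(2)] in simp)
    also have "\<dots> = (\<integral>\<^sup>+z. kac_average (\<lambda>p \<theta>. indicator S (pair_rot p (\<theta> + \<Phi> z p) ** snd z)) \<partial>\<eta>)"
      by (subst int[OF im]) simp
    \<comment> \<open>For fixed \<open>z\<close> the shift is a constant for each pair, so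
      invariance of the uniform angle removes it, although it depends on the first point
      too.\<close>
    also have "\<dots> = (\<integral>\<^sup>+z. kac_average (\<lambda>p \<theta>. indicator S (pair_rot p \<theta> ** snd z)) \<partial>\<eta>)"
      by (intro nn_integral_cong kac_average_shift borel_measurable_indicator S) (auto simp: c(3))
    also have "\<dots> = (\<integral>\<^sup>+x. kac_average (\<lambda>p \<theta>. indicator S (pair_rot p \<theta> ** x)) \<partial>distr \<eta> \<nu> snd)"
    proof (rule nn_integral_distr[symmetric])
      show "snd \<in> \<eta> \<rightarrow>\<^sub>M \<nu>"
        unfolding measurable_cong_sets[OF c(2) SO_prob_sets[OF \<nu>]] by (rule measurable_snd)
      show "(\<lambda>x. kac_average (\<lambda>p \<theta>. indicator S (pair_rot p \<theta> ** x))) \<in> borel_measurable (distr \<eta> \<nu> snd)"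
        unfolding c(5) measurable_cong_sets[OF SO_prob_sets[OF \<nu>] refl] by (rule avg_meas[OF S])
    qed
    also have "\<dots> = emeasure (kac_step \<nu>) S" unfolding c(5) emeasure_kac_step_average[OF n \<nu> S] ..
    finally show "emeasure (distr \<eta>' (kac_step \<nu>) snd) S = emeasure (kac_step \<nu>) S" .
  qed simp
  have "\<eta>' \<in> couplings (kac_step \<mu>) (kac_step \<nu>)"
    using P' s' m1 m2 sets_pair_measure_cong[OF SO_prob_sets[OF K(1)] SO_prob_sets[OF K(2)]]
    by (simp add: couplings_def)
  moreover have "(\<integral>\<^sup>+z. ennreal ((chain_dist (fst z) (snd z))\<^sup>2) \<partial>\<eta>')
      \<le> ennreal (contraction_rate TYPE('n)) * (\<integral>\<^sup>+z. ennreal ((chain_dist (fst z) (snd z))\<^sup>2) \<partial>\<eta>)"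
  proof -
    have cm: "(\<lambda>z. ennreal ((chain_dist (fst z) (snd z))\<^sup>2)) \<in> borel_measurable ?SS"
      by (intro measurable_compose[OF _ measurable_ennreal] borel_measurable_power borel_measurable_chain_dist)
    have cm\<eta>: "(\<lambda>z. ennreal ((chain_dist (fst z) (snd z))\<^sup>2)) \<in> borel_measurable \<eta>"
      unfolding measurable_cong_sets[OF c(2) refl] by (rule cm)
    have "(\<integral>\<^sup>+z. ennreal ((chain_dist (fst z) (snd z))\<^sup>2) \<partial>\<eta>')
        \<le> (\<integral>\<^sup>+z. ennreal (contraction_rate TYPE('n)) * ennreal ((chain_dist (fst z) (snd z))\<^sup>2) \<partial>\<eta>)"
      unfolding int[OF cm]
    proof (rule nn_integral_mono)
      fix z assume "z \<in> space \<eta>"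
      then obtain x y where z: "z = (x, y)" and xy: "x \<in> SO" "y \<in> SO" by (auto simp: c(3))
      let ?N = "real (CARD('n) choose 2)"
      let ?s = "\<lambda>p. (chain_dist x (rot (fst p) (snd p) (\<Phi> (x, y) p) ** y))\<^sup>2"
      have N: "?N > 0" using n by (simp add: zero_less_binomial)
      have inv: "chain_dist (pair_rot p \<theta> ** x) (pair_rot p (\<theta> + \<Phi> (x, y) p) ** y)
          = chain_dist x (rot (fst p) (snd p) (\<Phi> (x, y) p) ** y)" if p: "p \<in> pairs" for p \<theta>
      proof -
        have ne: "fst p \<noteq> snd p" using p by auto
        \<comment> \<open>Splits off the rotation by \<theta> that both copies share, which left
          invariance then cancels.\<close>
        have "pair_rot p (\<theta> + \<Phi> (x, y) p) ** y = pair_rot p \<theta> ** (rot (fst p) (snd p) (\<Phi> (x, y) p) ** y)"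
          using p by (simp only: pair_rot_def if_True matrix_mul_assoc rot_mult[OF ne])
        then show ?thesis
          using chain_dist_mult_left[OF pair_rot_in_SO xy(1) SO_mult[OF rot_in_SO[OF ne] xy(2)]] by metis
      qed
      have "kac_average (\<lambda>p \<theta>. ennreal ((chain_dist (fst (pair_rot p \<theta> ** fst z, pair_rot p (\<theta> + \<Phi> z p) ** snd z))
          (snd (pair_rot p \<theta> ** fst z, pair_rot p (\<theta> + \<Phi> z p) ** snd z)))\<^sup>2))
          = kac_average (\<lambda>p \<theta>. ennreal (?s p))"
        by (rule kac_average_cong) (simp only: z fst_conv snd_conv inv)
      \<comment> \<open>The cost no longer depends on the angle, so each integral is a multiple of 2
        \<pi> and a mean over the N pairs is left.\<close>
      also have "\<dots> = ennreal (1 / (2 * pi * ?N)) * (\<Sum>p\<in>pairs. ennreal (?s p) * ennreal (2 * pi))"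
        unfolding kac_average_def by (simp add: nn_integral_cmult_indicator)
      also have "\<dots> = ennreal (1 / (2 * pi * ?N) * ((\<Sum>p\<in>pairs. ?s p) * (2 * pi)))"
        by (simp add: ennreal_mult[symmetric] sum_ennreal sum_distrib_right sum_nonneg)
      also have "1 / (2 * pi * ?N) * ((\<Sum>p\<in>pairs. ?s p) * (2 * pi)) = (\<Sum>p\<in>pairs. ?s p) / ?N"
        using N by (simp add: field_simps)
      also have "ennreal ((\<Sum>p\<in>pairs. ?s p) / ?N) \<le> ennreal (contraction_rate TYPE('n) * (chain_dist x y)\<^sup>2)"
        using \<Phi>[OF xy] N by (intro ennreal_leI) (simp add: divide_le_eq ac_simps)
      also have "\<dots> = ennreal (contraction_rate TYPE('n)) * ennreal ((chain_dist (fst z) (snd z))\<^sup>2)"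
        by (simp add: z ennreal_mult contraction_rate_def)
      finally show "kac_average (\<lambda>p \<theta>. ennreal ((chain_dist (fst (pair_rot p \<theta> ** fst z, pair_rot p (\<theta> + \<Phi> z p) ** snd z))
          (snd (pair_rot p \<theta> ** fst z, pair_rot p (\<theta> + \<Phi> z p) ** snd z)))\<^sup>2))
        \<le> ennreal (contraction_rate TYPE('n)) * ennreal ((chain_dist (fst z) (snd z))\<^sup>2)" .
    qed
    also have "\<dots> = ennreal (contraction_rate TYPE('n)) * (\<integral>\<^sup>+z. ennreal ((chain_dist (fst z) (snd z))\<^sup>2) \<partial>\<eta>)"
      by (rule nn_integral_cmult[OF cm\<eta>])
    finally show ?thesis .
  qed
  ultimately show ?thesis by blast
qed

section \<open>Iteration of the coupling and the mixing time\<close>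

lemma pair_measure_in_couplings:
  assumes "prob_space \<mu>" "prob_space \<nu>"
  shows "\<mu> \<Otimes>\<^sub>M \<nu> \<in> couplings \<mu> \<nu>"
proof -
  interpret \<mu>: prob_space \<mu> by fact
  interpret \<nu>: prob_space \<nu> by fact
  have "distr (\<mu> \<Otimes>\<^sub>M \<nu>) \<nu> snd = \<nu>"
  proof (rule measure_eqI)
    fix A assume "A \<in> sets (distr (\<mu> \<Otimes>\<^sub>M \<nu>) \<nu> snd)"
    then have A: "A \<in> sets \<nu>" by simp
    have "emeasure (distr (\<mu> \<Otimes>\<^sub>M \<nu>) \<nu> snd) A = emeasure (\<mu> \<Otimes>\<^sub>M \<nu>) (snd -` A \<inter> space (\<mu> \<Otimes>\<^sub>M \<nu>))"
      by (rule emeasure_distr[OF measurable_snd A])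
    also have "snd -` A \<inter> space (\<mu> \<Otimes>\<^sub>M \<nu>) = space \<mu> \<times> A"
      using sets.sets_into_space[OF A] by (auto simp: space_pair_measure)
    also have "emeasure (\<mu> \<Otimes>\<^sub>M \<nu>) (space \<mu> \<times> A) = emeasure \<nu> A"
      by (subst \<nu>.emeasure_pair_measure_Times[OF sets.top A]) (simp add: \<mu>.emeasure_space_1)
    finally show "emeasure (distr (\<mu> \<Otimes>\<^sub>M \<nu>) \<nu> snd) A = emeasure \<nu> A" .
  qed simp
  then show ?thesis
    unfolding couplings_def using prob_space_pair[OF assms] \<nu>.distr_pair_fst[of \<mu>]
    by (intro CollectI conjI) simp_all
qed

lemma SO_prob_kac_steps:
  fixes \<mu> :: "(real^'n::{finite,linorder}^'n::{finite,linorder}) measure"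
  assumes "CARD('n) \<ge> 2" "SO_prob \<mu>"
  shows "SO_prob ((kac_step ^^ t) \<mu>)"
proof (induction t)
  case (Suc t)
  then show ?case unfolding funpow.simps o_apply by (rule SO_prob_kac_step[OF assms(1)])
qed (simp add: assms(2))

text \<open>Stationarity of the Haar measure keeps it as the second marginal, so the one-step
  contraction can be iterated against the same target.\<close>

lemma coupled_steps:
  fixes \<mu> \<H> :: "(real^'n::{finite,linorder}^'n::{finite,linorder}) measure"
  assumes n: "CARD('n) \<ge> 2" and \<mu>: "SO_prob \<mu>" and H: "SO_haar \<H>"
  shows "\<exists>\<eta>\<in>couplings ((kac_step ^^ t) \<mu>) \<H>. (\<integral>\<^sup>+z. ennreal ((chain_dist (fst z) (snd z))\<^sup>2) \<partial>\<eta>)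
      \<le> ennreal (contraction_rate TYPE('n) ^ t * (pi * sqrt (real CARD('n)))\<^sup>2)"
proof (induction t)
  case 0
  have P: "SO_prob \<H>" using H by (simp add: SO_haar_def)
  note c = pair_measure_in_couplings[OF SO_prob_prob[OF \<mu>] SO_prob_prob[OF P]]
  interpret \<eta>: prob_space "\<mu> \<Otimes>\<^sub>M \<H>" using couplingsD(1)[OF c \<mu> P] .
  have "(\<integral>\<^sup>+z. ennreal ((chain_dist (fst z) (snd z))\<^sup>2) \<partial>(\<mu> \<Otimes>\<^sub>M \<H>))
      \<le> (\<integral>\<^sup>+z. ennreal ((pi * sqrt (real CARD('n)))\<^sup>2) \<partial>(\<mu> \<Otimes>\<^sub>M \<H>))"
  proof (rule nn_integral_mono)
    fix z assume "z \<in> space (\<mu> \<Otimes>\<^sub>M \<H>)"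
    then have "z \<in> SO \<times> SO" by (simp only: couplingsD(3)[OF c \<mu> P])
    then have "fst z \<in> SO" "snd z \<in> SO" by auto
    then show "ennreal ((chain_dist (fst z) (snd z))\<^sup>2) \<le> ennreal ((pi * sqrt (real CARD('n)))\<^sup>2)"
      by (intro ennreal_leI power_mono chain_dist_le_diameter chain_dist_nonneg)
  qed
  also have "\<dots> = ennreal ((pi * sqrt (real CARD('n)))\<^sup>2)"
    by (simp only: nn_integral_const \<eta>.emeasure_space_1 mult_1_right)
  finally show ?case
    unfolding funpow.simps id_apply power_0 mult_1_left by (rule bexI[OF _ c])
next
  case (Suc t)
  then obtain \<eta> where \<eta>: "\<eta> \<in> couplings ((kac_step ^^ t) \<mu>) \<H>"
    "(\<integral>\<^sup>+z. ennreal ((chain_dist (fst z) (snd z))\<^sup>2) \<partial>\<eta>)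
      \<le> ennreal (contraction_rate TYPE('n) ^ t * (pi * sqrt (real CARD('n)))\<^sup>2)" by blast
  have P: "SO_prob \<H>" using H by (simp add: SO_haar_def)
  obtain \<eta>' where \<eta>': "\<eta>' \<in> couplings (kac_step ((kac_step ^^ t) \<mu>)) (kac_step \<H>)"
    "(\<integral>\<^sup>+z. ennreal ((chain_dist (fst z) (snd z))\<^sup>2) \<partial>\<eta>')
      \<le> ennreal (contraction_rate TYPE('n)) * (\<integral>\<^sup>+z. ennreal ((chain_dist (fst z) (snd z))\<^sup>2) \<partial>\<eta>)"
    using coupled_step[OF n SO_prob_kac_steps[OF n \<mu>] P \<eta>(1)] by blast
  note \<eta>'(2)
  also have "ennreal (contraction_rate TYPE('n)) * (\<integral>\<^sup>+z. ennreal ((chain_dist (fst z) (snd z))\<^sup>2) \<partial>\<eta>)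
      \<le> ennreal (contraction_rate TYPE('n)) * ennreal (contraction_rate TYPE('n) ^ t * (pi * sqrt (real CARD('n)))\<^sup>2)"
    by (intro mult_left_mono \<eta>(2)) simp
  also have "\<dots> = ennreal (contraction_rate TYPE('n) ^ Suc t * (pi * sqrt (real CARD('n)))\<^sup>2)"
    by (subst ennreal_mult[symmetric]) (simp_all add: contraction_rate_def mult.assoc)
  finally show ?case 
    using \<eta>'(1) unfolding kac_step_haar[OF n H] funpow.simps o_apply by (rule bexI)
qed

lemma ennreal_powr_le:
  assumes "x \<le> ennreal c" "0 \<le> c" "0 \<le> r"
  shows "ennreal_powr x r \<le> ennreal (c powr r)"
proof -
  have "x < \<top>" using assms(1) by (rule le_less_trans) simp
  moreover have "enn2real x \<le> c" using assms by (simp add: enn2real_leI)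
  ultimately show ?thesis
    using assms by (auto simp: ennreal_powr_def intro!: ennreal_leI powr_mono2)
qed

text \<open>Passes from \<open>chain_dist\<close> to \<open>SO_dist\<close> by a pointwise bound
  under the nonnegative integral, so measurability is handled entirely on the side of
  \<open>chain_dist\<close>. The square root halves the exponent of the rate.\<close>

lemma wasserstein_kac_steps:
  fixes \<mu> \<H> :: "(real^'n::{finite,linorder}^'n::{finite,linorder}) measure"
  assumes n: "CARD('n) \<ge> 2" and \<mu>: "SO_prob \<mu>" and H: "SO_haar \<H>"
  shows "wasserstein SO_dist 2 ((kac_step ^^ t) \<mu>) \<H>
    \<le> ennreal (pi * sqrt (real CARD('n)) * exp (- real t / (real CARD('n))\<^sup>2))"
proof -
  let ?c = "contraction_rate TYPE('n) ^ t * (pi * sqrt (real CARD('n)))\<^sup>2"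
  have P: "SO_prob \<H>" using H by (simp add: SO_haar_def)
  obtain \<eta> where \<eta>: "\<eta> \<in> couplings ((kac_step ^^ t) \<mu>) \<H>"
    "(\<integral>\<^sup>+z. ennreal ((chain_dist (fst z) (snd z))\<^sup>2) \<partial>\<eta>) \<le> ennreal ?c"
    using coupled_steps[OF assms] by blast
  have "(\<integral>\<^sup>+(x, y). ennreal (SO_dist x y powr 2) \<partial>\<eta>) \<le> (\<integral>\<^sup>+z. ennreal ((chain_dist (fst z) (snd z))\<^sup>2) \<partial>\<eta>)"
  proof (rule nn_integral_mono)
    fix z assume "z \<in> space \<eta>"
    then obtain x y where z: "z = (x, y)" and xy: "x \<in> SO" "y \<in> SO"
      by (auto simp: couplingsD(3)[OF \<eta>(1) SO_prob_kac_steps[OF n \<mu>] P])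
    show "(case z of (x, y) \<Rightarrow> ennreal (SO_dist x y powr 2)) \<le> ennreal ((chain_dist (fst z) (snd z))\<^sup>2)"
      using SO_dist_le_chain_dist[OF xy] by (auto simp: z powr_numeral intro!: ennreal_leI power_mono)
  qed
  then have "(\<integral>\<^sup>+(x, y). ennreal (SO_dist x y powr 2) \<partial>\<eta>) \<le> ennreal ?c" using \<eta>(2) by (rule order_trans)
  then have "ennreal_powr (\<integral>\<^sup>+(x, y). ennreal (SO_dist x y powr 2) \<partial>\<eta>) (1 / 2) \<le> ennreal (?c powr (1 / 2))"
    by (rule ennreal_powr_le) (simp_all add: contraction_rate_def)
  moreover have "?c powr (1 / 2) = pi * sqrt (real CARD('n)) * exp (- real t / (real CARD('n))\<^sup>2)"
  proof -
    have "contraction_rate TYPE('n) ^ t = exp (real t * (- 2 / (real CARD('n))\<^sup>2))"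
      unfolding contraction_rate_def by (rule exp_of_nat_mult[symmetric])
    also have "\<dots> = (exp (- real t / (real CARD('n))\<^sup>2))\<^sup>2"
      unfolding exp_double[symmetric] by simp
    finally have "?c = (pi * sqrt (real CARD('n)) * exp (- real t / (real CARD('n))\<^sup>2))\<^sup>2"
      by (simp only: power_mult_distrib mult.commute)
    moreover have "0 \<le> pi * sqrt (real CARD('n)) * exp (- real t / (real CARD('n))\<^sup>2)" by simp
    ultimately show ?thesis by (simp only: powr_half_sqrt zero_le_power2 real_sqrt_abs abs_of_nonneg)
  qed
  moreover have "wasserstein SO_dist 2 ((kac_step ^^ t) \<mu>) \<H>
      \<le> ennreal_powr (\<integral>\<^sup>+(x, y). ennreal (SO_dist x y powr 2) \<partial>\<eta>) (1 / 2)"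
    unfolding wasserstein_def by (rule INF_lower[OF \<eta>(1)])
  ultimately show ?thesis by simp
qed

theorem theorem1:
  fixes \<epsilon> :: real
    and \<H> :: "(real^'n::{finite,linorder}^'n::{finite,linorder}) measure"
  assumes "CARD('n) \<ge> 2"
    and "SO_haar \<H>"
    and "\<epsilon> > 0"
  shows "kac_mixing_time \<epsilon> \<H>
           \<le> enat (nat \<lceil>(real CARD('n))\<^sup>2 * ln (pi * sqrt (real CARD('n)) / \<epsilon>)\<rceil>)"
proof -
  let ?n = "real CARD('n)" and ?d = "pi * sqrt (real CARD('n))"
  \<comment> \<open>When \<epsilon> exceeds \<pi> sqrt n the logarithm is negative and
    \<open>nat\<close> truncates to t = 0; this still dominates the real number under the
    ceiling.\<close>
  define t where "t = nat \<lceil>?n\<^sup>2 * ln (?d / \<epsilon>)\<rceil>"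
  have n: "?n > 0" using assms(1) by simp
  then have d: "?d > 0" by simp
  have "?n\<^sup>2 * ln (?d / \<epsilon>) \<le> real t" unfolding t_def by (rule real_nat_ceiling_ge)
  then have "ln (?d / \<epsilon>) \<le> real t / ?n\<^sup>2" using n by (simp add: pos_le_divide_eq mult.commute)
  then have "exp (ln (?d / \<epsilon>)) \<le> exp (real t / ?n\<^sup>2)" by (simp only: exp_le_cancel_iff)
  moreover have "exp (ln (?d / \<epsilon>)) = ?d / \<epsilon>" using divide_pos_pos[OF d assms(3)] by (rule exp_ln)
  ultimately have "?d / \<epsilon> \<le> exp (real t / ?n\<^sup>2)" by simp
  then have "?d * exp (- real t / ?n\<^sup>2) \<le> \<epsilon>"
    using assms(3) by (simp add: exp_minus field_simps)
  then have "wasserstein SO_dist 2 ((kac_step ^^ t) \<mu>) \<H> \<le> ennreal \<epsilon>" if "SO_prob \<mu>" for \<mu>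
    using wasserstein_kac_steps[OF assms(1) that assms(2), of t] by (meson ennreal_leI order_trans)
  then show ?thesis
    unfolding kac_mixing_time_def t_def[symmetric] by (intro Inf_lower) blast
qed

end
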